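(* Let $U^0\in\mathcal{M}^N$ satisfy $E_{\mathrm{GS}}\leqslant E(U^0)<E_{\mathrm{ES}}$. Let $\{U^n\}_{n\geqslant0}$ be generated from $U^0$ by $$\frac{U^{n+1}-U^n}{\tau_n}=-\mathcal{L}_{U^n}\frac{U^{n+1}+U^n}{2},\qquad n\geqslant0,$$ with time steps $\tau_n\in[\tau_{\min},\tau_{\max}]$ for all $n\geqslant 0$, where $0<\tau_{\min}\leqslant\tau_{\max}$. If $\tau_{\max}$ is sufficiently small (i.e. there is $\bar\tau>0$ such that the following holds whenever $\tau_{\max}\leqslant\bar\tau$), then there exist $C>0$, $c>0$ and $Q^*\in\mathcal{O}^N$, all independent of $n$, such that for all $n\geqslant 0$ $$E(U^n)-E(U^* )\leqslant Ce^{-2cn}\qquad\text{and}\qquad\|U^n-U^*Q^*\|_a\leqslant Ce^{-cn}.$$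
   Context: Let $d,N\geqslant 1$ be integers and $\Omega\subset\mathbb{R}^d$ a bounded domain; all functions are real-valued. $(u,v)=\int_\Omega uv$ is the $L^2(\Omega)$ inner product and $\|\cdot\|$ its norm. $\mathcal{V}:\Omega\to\mathbb{R}$ is a potential such that $a(u,v)=\int_\Omega(\nabla u\cdot\nabla v+\mathcal{V}uv)$ is an inner product on $H_0^1(\Omega)$ and there are constants $c_1,c_2>0$ with $c_1\|\nabla u\|^2\leqslant a(u,u)\leqslant c_2\|\nabla u\|^2$ for all $u\in H_0^1(\Omega)$. The operator $\mathcal{G}=(-\Delta+\mathcal{V})^{-1}:H^{-1}(\Omega)\to H_0^1(\Omega)$ is defined by $a(\mathcal{G}f,v)=f(v)$ for all $v\in H_0^1(\Omega)$ (with $f(v)=(f,v)$ if $f\in L^2(\Omega)$), and acts componentwise on $N$-tuples. For $N$-tuples $U=(u_1,\dots,u_N)$, $V=(v_1,\dots,v_N)$, $\langle U,V\rangle\in\mathbb{R}^{N\times N}$ is the matrix with entries $(u_i,v_j)$; $\|U\|_a^2=\sum_i a(u_i,u_i)$. For $Q=(q_{ij})\in\mathbb{R}^{N\times N}$, $UQ$ is the $N$-tuple with $(UQ)_k=\sum_{i}u_iq_{ik}$. $\mathcal{O}^N$ is the set of $N\times N$ orthogonal matrices. $\mathcal{M}^N=\{U\in[H_0^1(\Omega)]^N:\langle U,U\rangle=I_N\}$. The energy is $E(U)=\frac12\|U\|_a^2$. For $U\in[H_0^1(\Omega)]^N$, $\mathcal{L}_UV=U\langle\mathcal{G}U,V\rangle-\mathcal{G}U\langle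 U,V\rangle$ for $V\in[H_0^1(\Omega)]^N$. For $U^n\in\mathcal{M}^N$ and $\tau_n>0$ the scheme determines a unique $U^{n+1}\in\mathcal{M}^N$. $0<\lambda_1\leqslant\lambda_2\leqslant\cdots$ are the eigenvalues, counted with multiplicity, of $-\Delta u+\mathcal{V}u=\lambda u$ in $H_0^1(\Omega)$ in the weak sense, i.e. $a(u,v)=\lambda(u,v)$ for all $v\in H_0^1(\Omega)$. It is assumed that $\lambda_N<\lambda_{N+1}$. $U^*\in\mathcal{M}^N$ has as its columns eigenfunctions $u_1^*,\dots,u_N^*$ associated with $\lambda_1,\dots,\lambda_N$ (so $U^*$ minimizes $E$ over $\mathcal{M}^N$). $E_{\mathrm{GS}}=\frac12\sum_{i=1}^N\lambda_i=E(U^* )$ and $E_{\mathrm{ES}}=\frac12\left(\lambda_{N+1}-\lambda_N+\sum_{i=1}^N\lambda_i\right)$. *)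

theory Defs
  imports "HOL-Analysis.Analysis"
begin

text \<open>
  Functions on \<open>\<Omega>\<close> are represented by functions on the whole space of which only the values on
  \<open>\<Omega>\<close> matter; elements of \<open>L\<^sup>2\<close> and of the Sobolev spaces are representatives of classes modulo
  almost everywhere equality with respect to \<^term>\<open>lebesgue_on \<Omega>\<close>.
\<close>

subsection \<open>The spaces \<open>L\<^sup>2(\<Omega>)\<close> and \<open>H\<^sub>0\<^sup>1(\<Omega>)\<close>\<close>

definition bounded_domain :: "(real^'d) set \<Rightarrow> bool" where
  "bounded_domain \<Omega> \<longleftrightarrow> open \<Omega> \<and> connected \<Omega> \<and> \<Omega> \<noteq> {} \<and> bounded \<Omega>"

definition ae_eq :: "(real^'d) set \<Rightarrow> (real^'d \<Rightarrow> real) \<Rightarrow> (real^'d \<Rightarrow> real) \<Rightarrow> bool" where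
  "ae_eq \<Omega> u v \<longleftrightarrow> (AE x in lebesgue_on \<Omega>. u x = v x)"

definition L2 :: "(real^'d) set \<Rightarrow> (real^'d \<Rightarrow> 'b::euclidean_space) set" where
  "L2 \<Omega> = {u. u \<in> borel_measurable (lebesgue_on \<Omega>) \<and>
                integrable (lebesgue_on \<Omega>) (\<lambda>x. (norm (u x))\<^sup>2)}"

definition L2_inner :: "(real^'d) set \<Rightarrow> (real^'d \<Rightarrow> 'b::euclidean_space) \<Rightarrow> (real^'d \<Rightarrow> 'b) \<Rightarrow> real" where
  "L2_inner \<Omega> u v = (LINT x|lebesgue_on \<Omega>. u x \<bullet> v x)"

definition L2_norm :: "(real^'d) set \<Rightarrow> (real^'d \<Rightarrow> 'b::euclidean_space) \<Rightarrow> real" where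
  "L2_norm \<Omega> u = sqrt (L2_inner \<Omega> u u)"

definition partial :: "'d \<Rightarrow> (real^'d \<Rightarrow> real) \<Rightarrow> real^'d \<Rightarrow> real" where
  "partial i f x = frechet_derivative f (at x) (axis i 1)"

primrec C_k :: "nat \<Rightarrow> (real^'d \<Rightarrow> real) \<Rightarrow> bool" where
  "C_k 0 f \<longleftrightarrow> continuous_on UNIV f"
| "C_k (Suc k) f \<longleftrightarrow> f differentiable_on UNIV \<and> (\<forall>i. C_k k (partial i f))"

definition test_functions :: "(real^'d) set \<Rightarrow> (real^'d \<Rightarrow> real) set" where
  "test_functions \<Omega> = {\<phi>. (\<forall>k. C_k k \<phi>) \<and>
     compact (closure {x. \<phi> x \<noteq> 0}) \<and> closure {x. \<phi> x \<noteq> 0} \<subseteq> \<Omega>}"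

definition has_weak_gradient ::
    "(real^'d) set \<Rightarrow> (real^'d \<Rightarrow> real) \<Rightarrow> (real^'d \<Rightarrow> real^'d) \<Rightarrow> bool" where
  "has_weak_gradient \<Omega> u g \<longleftrightarrow> u \<in> L2 \<Omega> \<and> g \<in> L2 \<Omega> \<and>
     (\<forall>\<phi>\<in>test_functions \<Omega>. \<forall>i.
        (LINT x|lebesgue_on \<Omega>. u x * partial i \<phi> x) = - (LINT x|lebesgue_on \<Omega>. g x $ i * \<phi> x))"

definition weak_gradient :: "(real^'d) set \<Rightarrow> (real^'d \<Rightarrow> real) \<Rightarrow> real^'d \<Rightarrow> real^'d" where
  "weak_gradient \<Omega> u = (SOME g. has_weak_gradient \<Omega> u g)"

definition H1 :: "(real^'d) set \<Rightarrow> (real^'d \<Rightarrow> real) set" where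
  "H1 \<Omega> = {u. \<exists>g. has_weak_gradient \<Omega> u g}"

definition H1_norm :: "(real^'d) set \<Rightarrow> (real^'d \<Rightarrow> real) \<Rightarrow> real" where
  "H1_norm \<Omega> u = sqrt ((L2_norm \<Omega> u)\<^sup>2 + (L2_norm \<Omega> (weak_gradient \<Omega> u))\<^sup>2)"

definition H10 :: "(real^'d) set \<Rightarrow> (real^'d \<Rightarrow> real) set" where
  "H10 \<Omega> = {u \<in> H1 \<Omega>. \<forall>e>0. \<exists>\<phi>\<in>test_functions \<Omega>. H1_norm \<Omega> (\<lambda>x. u x - \<phi> x) < e}"

subsection \<open>The form \<open>a\<close>, the solution operator and the eigenvalues\<close>

definition form_a ::
    "(real^'d) set \<Rightarrow> (real^'d \<Rightarrow> real) \<Rightarrow> (real^'d \<Rightarrow> real) \<Rightarrow> (real^'d \<Rightarrow> real) \<Rightarrow> real" where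
  "form_a \<Omega> \<V> u v =
     (LINT x|lebesgue_on \<Omega>. weak_gradient \<Omega> u x \<bullet> weak_gradient \<Omega> v x + \<V> x * u x * v x)"

definition inner_product_on_H10 ::
    "(real^'d) set \<Rightarrow> ((real^'d \<Rightarrow> real) \<Rightarrow> (real^'d \<Rightarrow> real) \<Rightarrow> real) \<Rightarrow> bool" where
  "inner_product_on_H10 \<Omega> b \<longleftrightarrow>
     (\<forall>u\<in>H10 \<Omega>. \<forall>v\<in>H10 \<Omega>. b u v = b v u) \<and>
     (\<forall>u\<in>H10 \<Omega>. \<forall>v\<in>H10 \<Omega>. \<forall>w\<in>H10 \<Omega>. b (\<lambda>x. u x + v x) w = b u w + b v w) \<and>
     (\<forall>c. \<forall>u\<in>H10 \<Omega>. \<forall>v\<in>H10 \<Omega>. b (\<lambda>x. c * u x) v = c * b u v) \<and>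
     (\<forall>u\<in>H10 \<Omega>. b u u \<ge> 0 \<and> (b u u = 0 \<longrightarrow> ae_eq \<Omega> u (\<lambda>x. 0)))"

text \<open>
  The measurability and integrability clauses express that \<^term>\<open>form_a \<Omega> \<V>\<close> is well defined;
  they are needed because the integral of a non-integrable function is \<open>0\<close> by convention.
\<close>

definition admissible_potential ::
    "(real^'d) set \<Rightarrow> (real^'d \<Rightarrow> real) \<Rightarrow> real \<Rightarrow> real \<Rightarrow> bool" where
  "admissible_potential \<Omega> \<V> c1 c2 \<longleftrightarrow>
     \<V> \<in> borel_measurable (lebesgue_on \<Omega>) \<and>
     (\<forall>u\<in>H10 \<Omega>. \<forall>v\<in>H10 \<Omega>. integrable (lebesgue_on \<Omega>) (\<lambda>x. \<V> x * u x * v x)) \<and>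
     inner_product_on_H10 \<Omega> (form_a \<Omega> \<V>) \<and>
     0 < c1 \<and> 0 < c2 \<and>
     (\<forall>u\<in>H10 \<Omega>. c1 * (L2_norm \<Omega> (weak_gradient \<Omega> u))\<^sup>2 \<le> form_a \<Omega> \<V> u u \<and>
                 form_a \<Omega> \<V> u u \<le> c2 * (L2_norm \<Omega> (weak_gradient \<Omega> u))\<^sup>2)"

text \<open>
  \<open>\<G>\<close> acts on functionals \<open>F\<close> on \<open>H\<^sub>0\<^sup>1(\<Omega>)\<close>; its value is meaningful for bounded linear \<open>F\<close>, and then
  determined up to almost everywhere equality. A function \<open>f\<close> in \<open>L\<^sup>2(\<Omega>)\<close> is identified with the
  functional \<^term>\<open>L2_inner \<Omega> f\<close>.
\<close>

definition solution_op ::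
    "(real^'d) set \<Rightarrow> (real^'d \<Rightarrow> real) \<Rightarrow> ((real^'d \<Rightarrow> real) \<Rightarrow> real) \<Rightarrow> real^'d \<Rightarrow> real" where
  "solution_op \<Omega> \<V> F = (SOME w. w \<in> H10 \<Omega> \<and> (\<forall>v\<in>H10 \<Omega>. form_a \<Omega> \<V> w v = F v))"

definition eigenspace ::
    "(real^'d) set \<Rightarrow> (real^'d \<Rightarrow> real) \<Rightarrow> real \<Rightarrow> (real^'d \<Rightarrow> real) set" where
  "eigenspace \<Omega> \<V> \<mu> = {u \<in> H10 \<Omega>. \<forall>v\<in>H10 \<Omega>. form_a \<Omega> \<V> u v = \<mu> * L2_inner \<Omega> u v}"

definition eigenfunction ::
    "(real^'d) set \<Rightarrow> (real^'d \<Rightarrow> real) \<Rightarrow> real \<Rightarrow> (real^'d \<Rightarrow> real) \<Rightarrow> bool" where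
  "eigenfunction \<Omega> \<V> \<mu> u \<longleftrightarrow> u \<in> eigenspace \<Omega> \<V> \<mu> \<and> \<not> ae_eq \<Omega> u (\<lambda>x. 0)"

text \<open>
  \<open>has_dim_ae \<Omega> S m\<close>: the quotient of the function space \<open>S\<close> by almost everywhere equality has a
  basis of \<open>m\<close> elements.
\<close>

definition has_dim_ae :: "(real^'d) set \<Rightarrow> (real^'d \<Rightarrow> real) set \<Rightarrow> nat \<Rightarrow> bool" where
  "has_dim_ae \<Omega> S m \<longleftrightarrow> (\<exists>b :: nat \<Rightarrow> real^'d \<Rightarrow> real.
     (\<forall>i<m. b i \<in> S) \<and>
     (\<forall>c :: nat \<Rightarrow> real. ae_eq \<Omega> (\<lambda>x. \<Sum>i<m. c i * b i x) (\<lambda>x. 0) \<longrightarrow> (\<forall>i<m. c i = 0)) \<and>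
     (\<forall>u\<in>S. \<exists>c :: nat \<Rightarrow> real. ae_eq \<Omega> u (\<lambda>x. \<Sum>i<m. c i * b i x)))"

text \<open>
  \<open>\<lambda>\<^sub>1 \<le> \<lambda>\<^sub>2 \<le> \<dots>\<close> are the eigenvalues counted with multiplicity: every real \<open>\<mu>\<close> occurs exactly as
  often as the dimension of its eigenspace (in particular not at all if it is not an eigenvalue).
  Indices start at \<open>1\<close>; the value at \<open>0\<close> is irrelevant.
\<close>

definition eigenvalue_sequence ::
    "(real^'d) set \<Rightarrow> (real^'d \<Rightarrow> real) \<Rightarrow> (nat \<Rightarrow> real) \<Rightarrow> bool" where
  "eigenvalue_sequence \<Omega> \<V> lam \<longleftrightarrow>
     0 < lam 1 \<and> (\<forall>k\<ge>1. lam k \<le> lam (Suc k)) \<and>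
     (\<forall>\<mu>. finite {k. 1 \<le> k \<and> lam k = \<mu>} \<and>
          has_dim_ae \<Omega> (eigenspace \<Omega> \<V> \<mu>) (card {k. 1 \<le> k \<and> lam k = \<mu>}))"

subsection \<open>Tuples of functions\<close>

text \<open>\<open>N\<close>-tuples are indexed by a finite type \<open>'n\<close>, so that \<open>N = CARD('n)\<close>.\<close>

type_synonym ('d, 'n) tuple = "'n \<Rightarrow> real^'d \<Rightarrow> real"

definition gram :: "(real^'d) set \<Rightarrow> ('d, 'n::finite) tuple \<Rightarrow> ('d, 'n) tuple \<Rightarrow> real^'n^'n" where
  "gram \<Omega> U W = (\<chi> i j. L2_inner \<Omega> (U i) (W j))"

definition tuple_mult :: "('d, 'n::finite) tuple \<Rightarrow> real^'n^'n \<Rightarrow> ('d, 'n) tuple" where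
  "tuple_mult U Q = (\<lambda>k x. \<Sum>i\<in>UNIV. U i x * Q $ i $ k)"

definition norm_a :: "(real^'d) set \<Rightarrow> (real^'d \<Rightarrow> real) \<Rightarrow> ('d, 'n::finite) tuple \<Rightarrow> real" where
  "norm_a \<Omega> \<V> U = sqrt (\<Sum>i\<in>UNIV. form_a \<Omega> \<V> (U i) (U i))"

definition energy :: "(real^'d) set \<Rightarrow> (real^'d \<Rightarrow> real) \<Rightarrow> ('d, 'n::finite) tuple \<Rightarrow> real" where
  "energy \<Omega> \<V> U = 1/2 * (norm_a \<Omega> \<V> U)\<^sup>2"

definition stiefel :: "(real^'d) set \<Rightarrow> ('d, 'n::finite) tuple set" where
  "stiefel \<Omega> = {U. (\<forall>i. U i \<in> H10 \<Omega>) \<and> gram \<Omega> U U = mat 1}"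

definition solution_op_tuple ::
    "(real^'d) set \<Rightarrow> (real^'d \<Rightarrow> real) \<Rightarrow> ('d, 'n::finite) tuple \<Rightarrow> ('d, 'n) tuple" where
  "solution_op_tuple \<Omega> \<V> U = (\<lambda>i. solution_op \<Omega> \<V> (L2_inner \<Omega> (U i)))"

definition L_op ::
    "(real^'d) set \<Rightarrow> (real^'d \<Rightarrow> real) \<Rightarrow> ('d, 'n::finite) tuple \<Rightarrow> ('d, 'n) tuple \<Rightarrow> ('d, 'n) tuple" where
  "L_op \<Omega> \<V> U W = (\<lambda>k x.
     tuple_mult U (gram \<Omega> (solution_op_tuple \<Omega> \<V> U) W) k x -
     tuple_mult (solution_op_tuple \<Omega> \<V> U) (gram \<Omega> U W) k x)"

definition scheme_step ::
    "(real^'d) set \<Rightarrow> (real^'d \<Rightarrow> real) \<Rightarrow> real \<Rightarrow> ('d, 'n::finite) tuple \<Rightarrow> ('d, 'n) tuple \<Rightarrow> bool" where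
  "scheme_step \<Omega> \<V> t U U' \<longleftrightarrow>
     (\<forall>i. ae_eq \<Omega> (\<lambda>x. (U' i x - U i x) / t)
                  (\<lambda>x. - L_op \<Omega> \<V> U (\<lambda>j y. (U' j y + U j y) / 2) i x))"

definition E_GS :: "(nat \<Rightarrow> real) \<Rightarrow> nat \<Rightarrow> real" where
  "E_GS lam N = 1/2 * (\<Sum>i=1..N. lam i)"

definition E_ES :: "(nat \<Rightarrow> real) \<Rightarrow> nat \<Rightarrow> real" where
  "E_ES lam N = 1/2 * (lam (N + 1) - lam N + (\<Sum>i=1..N. lam i))"

end

theory Submission
  imports Defs "HOL-Library.Function_Algebras" "HOL-Computational_Algebra.Polynomial"
begin

text \<open>
  Write \<open>R = \<L>\<^sub>U U\<close> for the gradient direction at \<open>U\<close>. Since \<open>R\<close> is \<open>a\<close>-orthogonal to \<open>\<G>U\<close>, the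
  dissipation \<open>a(R, U)\<close> of the energy is bounded below by a multiple of \<open>\<parallel>R\<parallel>\<^sub>a\<^sup>2\<close>, and a perturbation
  argument carries this over to one step of the scheme when the time step is small. Decompose
  \<open>U = U\<^sup>* X + Z\<close> with \<open>Z\<close> orthogonal to \<open>U\<^sup>*\<close> in \<open>L\<^sup>2\<close>. The spectral gap makes the energy excess
  comparable with \<open>\<parallel>Z\<parallel>\<^sub>a\<^sup>2\<close>, and an energy below \<open>E\<^sub>E\<^sub>S\<close> keeps \<open>X\<close> uniformly invertible; writing the span of
  \<open>U\<close> as the graph \<open>U\<^sup>* + Z X\<^sup>-\<^sup>1\<close> then gives \<open>\<parallel>Z\<parallel>\<^sub>a \<le> C \<parallel>R\<parallel>\<^sub>a\<close>. Hence the excess decays geometrically, so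
  the increments of \<open>U\<close> are summable and \<open>X\<close> converges to the orthogonal matrix \<open>Q\<^sup>*\<close>.

  The spectral gap and the solution operator need the completeness of \<open>H\<^sub>0\<^sup>1(\<Omega>)\<close> and the compactness of its
  embedding into \<open>L\<^sup>2(\<Omega>)\<close>. Both the Poincare inequality and the compactness follow from the estimate
  \<open>\<parallel>\<phi>(\<cdot> + z) - \<phi>\<parallel> \<le> \<bar>z\<bar> \<parallel>\<nabla>\<phi>\<parallel>\<close>: the former by taking \<open>z\<close> large, the latter by averaging over
  the \<open>z\<close> that connect points of one small cube.
\<close>

text \<open>Functions that agree almost everywhere are not identified, so the forms are only
  positive semidefinite and the scheme holds only up to null vectors. The convergence argument is
  therefore written for two abstract semidefinite forms \<open>a\<close> and \<open>b\<close> on a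
  real vector space, where a vector of zero \<open>a\<close>-norm is discarded by Cauchy-Schwarz.

  The dissipation a(R,U) is not a square. With s = <GU,U>, the orthogonality of R to GU gives
  <R,R>_a = <R,U>_a s, so the dissipation is the trace of s^-1 times the Gram matrix of R, and the
  lower bound becomes a trace inequality for products of semidefinite matrices.

  In a discrete step the remainder contains a(L W, U), with W the value of the operator at the
  midpoint; it looks like a term of first order in R. Its representer in the form \<open>b\<close>
  is itself a combination of R and U that vanishes with R, so the term is of second order and small
  time steps absorb it. The step threshold depends on the initial tuple only through its energy,
  which is why monotonicity of the energy is carried along the iteration; the decay rate also
  depends on the smallest time step.\<close>

instantiation "fun" :: (type, real_vector) real_vector
begin

definition scaleR_fun :: "real \<Rightarrow> ('a \<Rightarrow> 'b) \<Rightarrow> 'a \<Rightarrow> 'b" where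
  "scaleR_fun c f = (\<lambda>x. c *\<^sub>R f x)"

instance
  by standard (simp_all add: scaleR_fun_def fun_eq_iff algebra_simps)

end

subsection \<open>Positive semidefinite forms\<close>

text \<open>The form lives on a subspace because the L2 product and \<open>form_a\<close> behave
  well only on \<open>L2 \<Omega>\<close> and \<open>H10 \<Omega>\<close> inside the space of all
  functions. It is only semidefinite because a function vanishing almost everywhere need not be the
  zero vector.\<close>

locale psd_on =
  fixes S :: "'v::real_vector set" and f :: "'v \<Rightarrow> 'v \<Rightarrow> real"
  assumes subspace: "subspace S"
    and sym: "u \<in> S \<Longrightarrow> v \<in> S \<Longrightarrow> f u v = f v u"
    and add_left: "u \<in> S \<Longrightarrow> v \<in> S \<Longrightarrow> w \<in> S \<Longrightarrow> f (u + v) w = f u w + f v w"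
    and scale_left: "u \<in> S \<Longrightarrow> v \<in> S \<Longrightarrow> f (c *\<^sub>R u) v = c * f u v"
    and nonneg: "u \<in> S \<Longrightarrow> 0 \<le> f u u"
begin

definition snorm :: "'v \<Rightarrow> real" where
  "snorm u = sqrt (f u u)"

lemma mem [simp, intro]:
  "0 \<in> S" "u \<in> S \<Longrightarrow> v \<in> S \<Longrightarrow> u + v \<in> S" "u \<in> S \<Longrightarrow> v \<in> S \<Longrightarrow> u - v \<in> S"
  "u \<in> S \<Longrightarrow> c *\<^sub>R u \<in> S" "u \<in> S \<Longrightarrow> - u \<in> S" "(\<And>i. i \<in> I \<Longrightarrow> x i \<in> S) \<Longrightarrow> sum x I \<in> S"
  using subspace by (auto simp: subspace_0 subspace_add subspace_diff subspace_scale subspace_neg subspace_sum)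

lemma add_right: "u \<in> S \<Longrightarrow> v \<in> S \<Longrightarrow> w \<in> S \<Longrightarrow> f w (u + v) = f w u + f w v"
  by (metis add_left mem(2) sym)

lemma scale_right: "u \<in> S \<Longrightarrow> v \<in> S \<Longrightarrow> f u (c *\<^sub>R v) = c * f u v"
  by (metis scale_left mem(4) sym)

lemma minus_left: "u \<in> S \<Longrightarrow> v \<in> S \<Longrightarrow> f (- u) v = - f u v"
  using scale_left[of u v "-1"] by simp

lemma minus_right: "u \<in> S \<Longrightarrow> v \<in> S \<Longrightarrow> f u (- v) = - f u v"
  using scale_right[of u v "-1"] by simp

lemma diff_left: "u \<in> S \<Longrightarrow> v \<in> S \<Longrightarrow> w \<in> S \<Longrightarrow> f (u - v) w = f u w - f v w"
  using add_left[of u "- v" w] by (simp add: minus_left)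

lemma diff_right: "u \<in> S \<Longrightarrow> v \<in> S \<Longrightarrow> w \<in> S \<Longrightarrow> f w (u - v) = f w u - f w v"
  using add_right[of u "- v" w] by (simp add: minus_right)

lemma zero_left [simp]: "u \<in> S \<Longrightarrow> f 0 u = 0"
  using scale_left[of 0 u 0] by simp

lemma zero_right [simp]: "u \<in> S \<Longrightarrow> f u 0 = 0"
  using scale_right[of u 0 0] by simp

lemma sum_left: "(\<And>i. i \<in> I \<Longrightarrow> x i \<in> S) \<Longrightarrow> v \<in> S \<Longrightarrow> f (sum x I) v = (\<Sum>i\<in>I. f (x i) v)"
  by (induction I rule: infinite_finite_induct) (auto simp: add_left)

lemma sum_right: "(\<And>i. i \<in> I \<Longrightarrow> x i \<in> S) \<Longrightarrow> v \<in> S \<Longrightarrow> f v (sum x I) = (\<Sum>i\<in>I. f v (x i))"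
  by (induction I rule: infinite_finite_induct) (auto simp: add_right)

lemmas bilinear_simps =
  add_left add_right diff_left diff_right minus_left minus_right scale_left scale_right
  sum_left sum_right

lemma snorm_nonneg [simp]: "u \<in> S \<Longrightarrow> 0 \<le> snorm u"
  by (simp add: snorm_def nonneg)

lemma snorm_square: "u \<in> S \<Longrightarrow> (snorm u)\<^sup>2 = f u u"
  by (simp add: snorm_def nonneg)

lemma Cauchy_Schwarz_square:
  assumes u: "u \<in> S" and v: "v \<in> S"
  shows "(f u v)\<^sup>2 \<le> f u u * f v v"
proof -
  have q: "0 \<le> f u u + 2 * t * f u v + t\<^sup>2 * f v v" for t
    using nonneg[of "u + t *\<^sub>R v"] u v
    by (simp add: bilinear_simps sym[of v u] power2_eq_square algebra_simps)
  show ?thesis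
  proof (cases "f v v = 0")
    case True
    have "f u v = 0"
    proof (rule ccontr)
      assume nz: "f u v \<noteq> 0"
      \<comment> \<open>With \<open>f v v = 0\<close> the quadratic is affine in t, and this t gives
        it the value -1.\<close>
      have "0 \<le> f u u + 2 * (- (f u u + 1) / (2 * f u v)) * f u v"
        using q[of "- (f u u + 1) / (2 * f u v)"] True by simp
      also have "\<dots> = -1" using nz by (simp add: field_simps)
      finally show False by simp
    qed
    then show ?thesis using True by simp
  next
    case False
    then have p: "f v v > 0" using nonneg[OF v] by simp
    \<comment> \<open>The minimiser of the quadratic in t.\<close>
    have "0 \<le> f u u + 2 * (- f u v / f v v) * f u v + (- f u v / f v v)\<^sup>2 * f v v"
      by (rule q)
    also have "\<dots> = f u u - (f u v)\<^sup>2 / f v v"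
      using p by (simp add: field_simps power2_eq_square)
    finally show ?thesis using p by (simp add: field_simps)
  qed
qed

lemma Cauchy_Schwarz: "u \<in> S \<Longrightarrow> v \<in> S \<Longrightarrow> \<bar>f u v\<bar> \<le> snorm u * snorm v"
  using real_sqrt_le_mono[OF Cauchy_Schwarz_square[of u v]]
  by (simp add: snorm_def real_sqrt_mult)

lemma snorm_triangle:
  assumes "u \<in> S" "v \<in> S"
  shows "snorm (u + v) \<le> snorm u + snorm v"
proof (rule power2_le_imp_le)
  have "f u v \<le> snorm u * snorm v" using Cauchy_Schwarz[OF assms] by simp
  then show "(snorm (u + v))\<^sup>2 \<le> (snorm u + snorm v)\<^sup>2"
    using assms by (simp add: snorm_square power2_sum bilinear_simps sym[of v u])
qed (use assms in simp)

lemma snorm_scale: "u \<in> S \<Longrightarrow> snorm (c *\<^sub>R u) = \<bar>c\<bar> * snorm u"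
  by (simp add: snorm_def bilinear_simps real_sqrt_mult flip: mult.assoc)

lemma snorm_minus: "u \<in> S \<Longrightarrow> snorm (- u) = snorm u"
  by (simp add: snorm_def bilinear_simps)

lemma snorm_minus_commute: "u \<in> S \<Longrightarrow> v \<in> S \<Longrightarrow> snorm (u - v) = snorm (v - u)"
  using snorm_minus[of "u - v"] by simp

lemma snorm_triangle_diff: "u \<in> S \<Longrightarrow> v \<in> S \<Longrightarrow> snorm (u - v) \<le> snorm u + snorm v"
  using snorm_triangle[of u "- v"] by (simp add: snorm_minus)

lemma snorm_sum:
  "(\<And>i. i \<in> I \<Longrightarrow> x i \<in> S) \<Longrightarrow> snorm (sum x I) \<le> (\<Sum>i\<in>I. snorm (x i))"
proof (induction I rule: infinite_finite_induct)
  case (insert i I)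
  have "snorm (sum x (insert i I)) \<le> snorm (x i) + snorm (sum x I)"
    using insert by (simp add: snorm_triangle)
  then show ?case using insert by auto
qed (simp_all add: snorm_def)

text \<open>Null vectors are invisible to the form; this replaces passing to the quotient by almost
  everywhere equality.\<close>

lemma null_left: "u \<in> S \<Longrightarrow> v \<in> S \<Longrightarrow> f u u = 0 \<Longrightarrow> f u v = 0"
  using Cauchy_Schwarz_square[of u v] by simp

lemma parallelogram:
  "u \<in> S \<Longrightarrow> v \<in> S \<Longrightarrow> f (u - v) (u - v) = 2 * f u u + 2 * f v v - f (u + v) (u + v)"
  by (simp add: bilinear_simps sym)

lemma tendsto_left:
  assumes "\<And>n. x n \<in> S" "w \<in> S" "v \<in> S" and lim: "(\<lambda>n. f (x n - w) (x n - w)) \<longlonglongrightarrow> 0"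
  shows "(\<lambda>n. f (x n) v) \<longlonglongrightarrow> f w v"
proof (rule LIM_zero_cancel, rule Lim_null_comparison)
  show "\<forall>\<^sub>F n in sequentially. norm (f (x n) v - f w v) \<le> snorm (x n - w) * snorm v"
    using Cauchy_Schwarz assms by (simp flip: diff_left)
  show "(\<lambda>n. snorm (x n - w) * snorm v) \<longlonglongrightarrow> 0"
    using tendsto_mult_right[OF tendsto_real_sqrt[OF lim], of "snorm v"] by (simp add: snorm_def)
qed

lemma tendsto_square:
  assumes x: "\<And>n. x n \<in> S" and w: "w \<in> S" and lim: "(\<lambda>n. f (x n - w) (x n - w)) \<longlonglongrightarrow> 0"
  shows "(\<lambda>n. f (x n) (x n)) \<longlonglongrightarrow> f w w"
proof -
  have "f (x n) (x n) = f (x n - w) (x n - w) + 2 * f (x n) w - f w w" for n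
    using x[of n] w by (simp add: bilinear_simps sym[of w "x n"])
  moreover have "(\<lambda>n. f (x n - w) (x n - w) + 2 * f (x n) w - f w w) \<longlonglongrightarrow> 0 + 2 * f w w - f w w"
    by (intro tendsto_intros lim tendsto_left x w)
  ultimately show ?thesis by simp
qed

lemma null_diff:
  assumes "x \<in> S" "y \<in> S" "f (x - y) (x - y) = 0"
  shows "f x x = f y y"
proof -
  have n: "f (x - y) v = 0" if "v \<in> S" for v using null_left[of "x - y" v] assms that by simp
  have "f x x = f (x - y) x + f (x - y) y + f y y"
    using assms by (simp add: bilinear_simps sym[of y x])
  then show ?thesis using n assms by simp
qed

lemma square_sum_le:
  assumes "x \<in> S" "y \<in> S"
  shows "f (x + y) (x + y) \<le> 2 * f x x + 2 * f y y"
  using parallelogram[of x y] nonneg[of "x - y"] assms by simp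

end

locale psd_form = psd_on UNIV f for f :: "'v::real_vector \<Rightarrow> 'v \<Rightarrow> real"
begin

lemma quadratic_insert:
  fixes P :: "'i \<Rightarrow> 'i \<Rightarrow> real" and w :: "'i \<Rightarrow> 'v"
  assumes "finite I" "k \<notin> I" "\<And>i. i \<in> I \<Longrightarrow> P i k = P k i"
  shows "(\<Sum>i\<in>insert k I. \<Sum>j\<in>insert k I. P i j * f (w i) (w j)) =
    P k k * f (w k) (w k) + 2 * f (w k) (\<Sum>i\<in>I. P k i *\<^sub>R w i) + (\<Sum>i\<in>I. \<Sum>j\<in>I. P i j * f (w i) (w j))"
proof -
  have "(\<Sum>i\<in>I. P i k * f (w i) (w k)) = (\<Sum>i\<in>I. P k i * f (w k) (w i))"
    using assms by (intro sum.cong) (auto simp: sym)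
  then show ?thesis
    using assms by (simp add: sum.distrib bilinear_simps)
qed

text \<open>The subtracted matrix has rank one. With r the pivot row and p the pivot it is what one
  elimination step removes.\<close>

lemma quadratic_deflate:
  fixes P :: "'i \<Rightarrow> 'i \<Rightarrow> real" and w :: "'i \<Rightarrow> 'v"
  assumes "finite I" "p \<noteq> 0"
  shows "(\<Sum>i\<in>I. \<Sum>j\<in>I. (P i j - r i * r j / p) * f (w i) (w j)) =
    (\<Sum>i\<in>I. \<Sum>j\<in>I. P i j * f (w i) (w j)) - f (\<Sum>i\<in>I. r i *\<^sub>R w i) (\<Sum>i\<in>I. r i *\<^sub>R w i) / p"
proof -
  have "f (\<Sum>i\<in>I. r i *\<^sub>R w i) (\<Sum>i\<in>I. r i *\<^sub>R w i) = (\<Sum>i\<in>I. \<Sum>j\<in>I. r i * r j * f (w i) (w j))"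
    by (simp add: bilinear_simps sum_distrib_left mult_ac)
       (subst sum.swap, simp add: mult_ac)
  then show ?thesis
    by (simp add: algebra_simps sum_subtractf sum_divide_distrib)
qed

end

text \<open>Multiplication of reals is itself such a form, so the two identities above also serve
  the scalar quadratic form in the hypothesis of \<open>trace_nonneg\<close>.\<close>

interpretation real_form: psd_form "(*) :: real \<Rightarrow> real \<Rightarrow> real"
  by unfold_locales (auto simp: algebra_simps)

text \<open>Induction on the index set by elimination of one variable (Schur complement).\<close>

lemma (in psd_form) trace_nonneg:
  fixes P :: "'i \<Rightarrow> 'i \<Rightarrow> real" and w :: "'i \<Rightarrow> 'v"
  assumes "finite I" "\<And>i j. i \<in> I \<Longrightarrow> j \<in> I \<Longrightarrow> P i j = P j i"
    and "\<And>x. 0 \<le> (\<Sum>i\<in>I. \<Sum>j\<in>I. P i j * (x i * x j))"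
  shows "0 \<le> (\<Sum>i\<in>I. \<Sum>j\<in>I. P i j * f (w i) (w j))"
  using assms
proof (induction I arbitrary: P rule: finite_induct)
  case (insert k I)
  have s: "\<And>i. i \<in> I \<Longrightarrow> P i k = P k i" using insert.prems by auto
  \<comment> \<open>The hypothesis with the entry at k set to t, read as a quadratic in t.\<close>
  have psd: "0 \<le> P k k * (t * t) + 2 * (t * (\<Sum>i\<in>I. P k i * x i)) + (\<Sum>i\<in>I. \<Sum>j\<in>I. P i j * (x i * x j))" for t x
  proof -
    define y where "y = x(k := t)"
    have "0 \<le> (\<Sum>i\<in>insert k I. \<Sum>j\<in>insert k I. P i j * (y i * y j))"
      by (rule insert.prems(2))
    also have "\<dots> = P k k * (y k * y k) + 2 * (y k * (\<Sum>i\<in>I. P k i * y i)) + (\<Sum>i\<in>I. \<Sum>j\<in>I. P i j * (y i * y j))"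
      using real_form.quadratic_insert[of I k P y] insert.hyps s by simp
    also have "(\<Sum>i\<in>I. P k i * y i) = (\<Sum>i\<in>I. P k i * x i)"
      using insert.hyps by (intro sum.cong) (auto simp: y_def)
    also have "(\<Sum>i\<in>I. \<Sum>j\<in>I. P i j * (y i * y j)) = (\<Sum>i\<in>I. \<Sum>j\<in>I. P i j * (x i * x j))"
      using insert.hyps by (intro sum.cong refl) (auto simp: y_def)
    finally show ?thesis by (simp add: y_def)
  qed
  have p0: "0 \<le> P k k" using psd[of 1 "\<lambda>_. 0"] by simp
  show ?case
  proof (cases "P k k = 0")
    case True
    \<comment> \<open>A zero pivot forces a zero row: with entry t at k and 1 at i the form is
      affine in t with slope \<open>2 * P k i\<close>.\<close>
    have z: "P k i = 0" if "i \<in> I" for i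
    proof (rule ccontr)
      assume nz: "P k i \<noteq> 0"
      define x where "x = (\<lambda>j. if j = i then 1 else 0 :: real)"
      have d: "(\<Sum>j\<in>I. h j * x j) = h i" for h
        using insert.hyps(1) that by (simp add: x_def mult_delta_right)
      have "(\<Sum>j\<in>I. P k' j * (x k' * x j)) = P k' i * x k'" for k'
        using d[of "\<lambda>j. P k' j * x k'"] by (simp add: mult.assoc)
      then have x: "(\<Sum>j\<in>I. P k j * x j) = P k i" "(\<Sum>k\<in>I. \<Sum>j\<in>I. P k j * (x k * x j)) = P i i"
        by (simp_all add: d)
      have "0 \<le> 2 * (- (P i i + 1) / (2 * P k i) * P k i) + P i i"
        using psd[of "- (P i i + 1) / (2 * P k i)" x] True x by simp
      also have "\<dots> = -1" using nz by (simp add: field_simps)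
      finally show False by simp
    qed
    have "0 \<le> (\<Sum>i\<in>I. \<Sum>j\<in>I. P i j * f (w i) (w j))"
      using psd[of 0] insert.prems(1) by (intro insert.IH) auto
    moreover have "(\<Sum>i\<in>I. P k i *\<^sub>R w i) = 0" using z by simp
    ultimately show ?thesis
      using quadratic_insert[of I k P w] insert.hyps s True by simp
  next
    case False
    then have p: "P k k > 0" using p0 by simp
    \<comment> \<open>The Schur complement. It inherits positivity because the full form reduces to
      it at the minimising entry \<open>- m / P k k\<close>.\<close>
    define P' where "P' = (\<lambda>i j. P i j - P k i * P k j / P k k)"
    have "0 \<le> (\<Sum>i\<in>I. \<Sum>j\<in>I. P' i j * f (w i) (w j))"
    proof (rule insert.IH)
      show "P' i j = P' j i" if "i \<in> I" "j \<in> I" for i j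
        using insert.prems(1)[of i j] that by (simp add: P'_def)
      show "0 \<le> (\<Sum>i\<in>I. \<Sum>j\<in>I. P' i j * (x i * x j))" for x
      proof -
        define m where "m = (\<Sum>i\<in>I. P k i * x i)"
        have "0 \<le> P k k * (- m / P k k * (- m / P k k)) + 2 * (- m / P k k * m) + (\<Sum>i\<in>I. \<Sum>j\<in>I. P i j * (x i * x j))"
          unfolding m_def by (rule psd)
        also have "\<dots> = (\<Sum>i\<in>I. \<Sum>j\<in>I. P i j * (x i * x j)) - m * m / P k k"
          using p by (simp add: field_simps)
        also have "\<dots> = (\<Sum>i\<in>I. \<Sum>j\<in>I. P' i j * (x i * x j))"
          using real_form.quadratic_deflate[of I "P k k" P "P k" x] insert.hyps p
          by (simp add: P'_def m_def)
        finally show ?thesis .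
      qed
    qed
    then have q: "f (\<Sum>i\<in>I. P k i *\<^sub>R w i) (\<Sum>i\<in>I. P k i *\<^sub>R w i) / P k k \<le> (\<Sum>i\<in>I. \<Sum>j\<in>I. P i j * f (w i) (w j))"
      using quadratic_deflate[of I "P k k" P "P k" w] insert.hyps p by (simp add: P'_def)
    define v where "v = (\<Sum>i\<in>I. P k i *\<^sub>R w i)"
    \<comment> \<open>Completing the square in \<open>w k\<close> accounts for exactly what the
      elimination subtracted.\<close>
    have "0 \<le> f (P k k *\<^sub>R w k + v) (P k k *\<^sub>R w k + v) / P k k"
      using p by (simp add: nonneg)
    also have "\<dots> = P k k * f (w k) (w k) + 2 * f (w k) v + f v v / P k k"
      using p by (simp add: bilinear_simps sym[of v "w k"] field_simps)
    finally show ?thesis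
      using quadratic_insert[of I k P w] insert.hyps s q by (simp add: v_def)
  qed
qed simp

text \<open>A trivial kernel gives a left inverse, and squareness makes it two-sided. Applied to
  \<open>X\<close>, to write the span of u as a graph, and to \<open>s\<close>.\<close>

lemma finite_family_inverse:
  fixes X :: "'n::finite \<Rightarrow> 'n \<Rightarrow> real"
  assumes "\<And>x. (\<And>i. (\<Sum>k\<in>UNIV. X i k * x k) = 0) \<Longrightarrow> (\<And>k. x k = 0)"
  obtains P where "\<And>i j. (\<Sum>k\<in>UNIV. X i k * P k j) = (if i = j then 1 else 0)"
    and "\<And>i j. (\<Sum>k\<in>UNIV. P i k * X k j) = (if i = j then 1 else 0)"
proof -
  define A :: "real^'n^'n" where "A = (\<chi> i k. X i k)"
  have "x = 0" if "A *v x = 0" for x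
  proof -
    have "(\<Sum>k\<in>UNIV. X i k * x $ k) = 0" for i
      using arg_cong[OF that, of "\<lambda>y. y $ i"] by (simp add: A_def matrix_vector_mult_def)
    then have "x $ k = 0" for k by (rule assms)
    then show ?thesis by (simp add: vec_eq_iff)
  qed
  then obtain B where B: "B ** A = mat 1"
    using matrix_left_invertible_ker[of A] by auto
  then have B': "A ** B = mat 1" by (simp add: matrix_left_right_inverse)
  have "(\<Sum>k\<in>UNIV. X i k * B $ k $ j) = (if i = j then 1 else 0)"
    and "(\<Sum>k\<in>UNIV. B $ i $ k * X k j) = (if i = j then 1 else 0)" for i j
    using arg_cong[OF B, of "\<lambda>C. C $ i $ j"] arg_cong[OF B', of "\<lambda>C. C $ i $ j"]
    by (simp_all add: A_def matrix_matrix_mult_def mat_def)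
  then show ?thesis by (rule that)
qed

lemma sum_le_card_mult:
  fixes h :: "'n::finite \<Rightarrow> real"
  assumes "\<And>i. h i \<le> c"
  shows "(\<Sum>i\<in>UNIV. h i) \<le> real CARD('n) * c"
  using sum_mono[of UNIV h "\<lambda>_. c"] assms by simp

subsection \<open>Spectral gap\<close>

text \<open>In the application \<open>a\<close> is the energy form, \<open>b\<close> the L2 product,
  \<open>e\<close> the ground state, \<open>Lam\<close> is \<lambda>_N, \<open>M\<close> is
  \<lambda>_(N+1), and \<open>\<kappa>\<close> comes from the Poincare inequality. The gap is an
  assumption here and is discharged by \<open>spectral_gap\<close>.\<close>

locale ground_state = a: psd_form a + b: psd_form b
  for a b :: "'v::real_vector \<Rightarrow> 'v \<Rightarrow> real" +
  fixes e :: "'n::finite \<Rightarrow> 'v" and l :: "'n \<Rightarrow> real" and Lam M \<kappa> :: real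
  assumes \<kappa>_pos: "0 < \<kappa>" and b_le_a: "b v v \<le> \<kappa> * a v v"
    and e_orth: "b (e i) (e j) = (if i = j then 1 else 0)"
    and e_eigen: "a (e i) v = l i * b (e i) v"
    and l_pos: "0 < l i" and l_le: "l i \<le> Lam" and Lam_less: "Lam < M"
    and gap: "(\<And>i. b (e i) z = 0) \<Longrightarrow> M * b z z \<le> a z z"
begin

lemma Lam_pos: "0 < Lam"
  using l_pos l_le by (meson less_le_trans)

lemma M_pos: "0 < M"
  using Lam_pos Lam_less by simp

lemma b_snorm_le: "b.snorm v \<le> sqrt \<kappa> * a.snorm v"
  using real_sqrt_le_mono[OF b_le_a[of v]] by (simp add: a.snorm_def b.snorm_def real_sqrt_mult)

end

text \<open>\<open>g\<close> plays the part of GU. The bound \<open>K\<close> is a parameter of its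
  own, so that the constants built from it are the same for all iterates whose energy stays below
  the initial one.\<close>

locale ground_state_tuple = ground_state a b e l Lam M \<kappa>
  for a b :: "'v::real_vector \<Rightarrow> 'v \<Rightarrow> real" and e :: "'n::finite \<Rightarrow> 'v" and l Lam M \<kappa> +
  fixes u g :: "'n \<Rightarrow> 'v" and K :: real
  assumes u_orth: "b (u i) (u j) = (if i = j then 1 else 0)"
    and a_g: "a (g i) v = b (u i) v"
    and energy_le: "(\<Sum>k\<in>UNIV. a (u k) (u k)) \<le> K"
begin

definition X :: "'n \<Rightarrow> 'n \<Rightarrow> real" where "X i k = b (e i) (u k)"
definition z :: "'n \<Rightarrow> 'v" where "z k = u k - (\<Sum>i\<in>UNIV. X i k *\<^sub>R e i)"
definition s :: "'n \<Rightarrow> 'n \<Rightarrow> real" where "s i k = b (g i) (u k)"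
text \<open>This is L_U U: since <U,U> = I, the second term of the operator has become GU.\<close>

definition R :: "'n \<Rightarrow> 'v" where "R k = (\<Sum>i\<in>UNIV. s i k *\<^sub>R u i) - g k"
definition r :: real where "r = sqrt (\<Sum>k\<in>UNIV. a (R k) (R k))"
text \<open>The factor 1/2 is dropped, so this is twice the energy difference to the ground
  state.\<close>

definition excess :: real where "excess = (\<Sum>k\<in>UNIV. a (u k) (u k)) - (\<Sum>i\<in>UNIV. l i)"

lemma a_u_le: "a (u k) (u k) \<le> K"
  using member_le_sum[of k UNIV "\<lambda>k. a (u k) (u k)"] energy_le a.nonneg by auto

lemma K_nonneg: "0 \<le> K"
  using a_u_le a.nonneg by (meson UNIV_I order_trans)

lemma a_snorm_u: "a.snorm (u k) \<le> sqrt K"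
  using a_u_le by (simp add: a.snorm_def)

lemma b_snorm_u: "b.snorm (u k) = 1"
  by (simp add: b.snorm_def u_orth)

lemma b_snorm_e: "b.snorm (e k) = 1"
  by (simp add: b.snorm_def e_orth)

lemma a_snorm_g: "a.snorm (g k) \<le> sqrt \<kappa>"
proof (cases "a.snorm (g k) = 0")
  case False
  then have p: "a.snorm (g k) > 0" by (simp add: less_le)
  have "(a.snorm (g k))\<^sup>2 = b (u k) (g k)" by (simp add: a.snorm_square a_g)
  also have "\<dots> \<le> b.snorm (u k) * b.snorm (g k)" using b.Cauchy_Schwarz[of "u k" "g k"] by simp
  also have "\<dots> \<le> sqrt \<kappa> * a.snorm (g k)" using b_snorm_le by (simp add: b_snorm_u)
  finally show ?thesis using p by (simp add: power2_eq_square)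
qed (use \<kappa>_pos in simp)

lemma b_snorm_g: "b.snorm (g k) \<le> \<kappa>"
proof -
  have "b.snorm (g k) \<le> sqrt \<kappa> * sqrt \<kappa>"
    using b_snorm_le[of "g k"] a_snorm_g[of k] \<kappa>_pos
    by (meson mult_left_mono order_trans real_sqrt_ge_zero less_imp_le)
  then show ?thesis using \<kappa>_pos by simp
qed

lemma s_eq: "s i k = a (g i) (g k)"
  by (simp add: s_def b.sym[of "g i"] a_g[symmetric] a.sym[of "g k"])

lemma s_sym: "s i k = s k i"
  by (simp add: s_eq a.sym)

lemma b_e_z: "b (e i) (z k) = 0"
  by (simp add: z_def b.bilinear_simps e_orth X_def mult_delta_right)

lemma b_z_e: "b (z k) (e i) = 0"
  using b_e_z b.sym by simp

text \<open>Eigenvectors turn \<open>b\<close>-orthogonality into \<open>a\<close>-orthogonality, so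
  the splitting into ground space and \<open>z\<close> is orthogonal for both forms; this gives the
  Pythagoras identities \<open>b_u_u\<close> and \<open>a_u_u\<close>.\<close>

lemma a_e_z: "a (e i) (z k) = 0"
  by (simp add: e_eigen b_e_z)

lemma a_z_e: "a (z k) (e i) = 0"
  using a_e_z a.sym by simp

lemma u_decomp: "u k = (\<Sum>i\<in>UNIV. X i k *\<^sub>R e i) + z k"
  by (simp add: z_def)

lemma b_u_u: "b (u j) (u k) = (\<Sum>i\<in>UNIV. X i j * X i k) + b (z j) (z k)"
  by (simp add: u_decomp[of j] u_decomp[of k] b.bilinear_simps b_e_z b_z_e e_orth mult_delta_right
      mult_delta_left mult.commute)

lemma a_u_u: "a (u k) (u k) = (\<Sum>i\<in>UNIV. l i * (X i k)\<^sup>2) + a (z k) (z k)"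
  by (simp add: u_decomp[of k] a.bilinear_simps b_e_z a_z_e e_eigen e_orth mult_delta_right
      mult_delta_left power2_eq_square mult_ac)

lemma X_bessel: "(\<Sum>k\<in>UNIV. (X i k)\<^sup>2) \<le> 1"
proof -
  define y where "y = e i - (\<Sum>k\<in>UNIV. X i k *\<^sub>R u k)"
  have "0 \<le> b y y" by (simp add: b.nonneg)
  also have "b y y = 1 - (\<Sum>k\<in>UNIV. (X i k)\<^sup>2)"
    by (simp add: y_def b.bilinear_simps u_orth e_orth mult_delta_right
      mult_delta_left power2_eq_square b.sym[of "u _" "e i"] flip: X_def)
  finally show ?thesis by simp
qed

lemma abs_X_le: "\<bar>X i k\<bar> \<le> 1"
  using b.Cauchy_Schwarz[of "e i" "u k"] by (simp add: X_def b_snorm_u b_snorm_e)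

lemma excess_eq: "excess = (\<Sum>k\<in>UNIV. a (z k) (z k)) - (\<Sum>i\<in>UNIV. l i * (1 - (\<Sum>k\<in>UNIV. (X i k)\<^sup>2)))"
proof -
  have "(\<Sum>k\<in>UNIV. \<Sum>i\<in>UNIV. l i * (X i k)\<^sup>2) = (\<Sum>i\<in>UNIV. l i * (\<Sum>k\<in>UNIV. (X i k)\<^sup>2))"
    by (subst sum.swap) (simp add: sum_distrib_left)
  then show ?thesis
    by (simp add: excess_def a_u_u sum.distrib right_diff_distrib sum_subtractf)
qed

lemma excess_le: "excess \<le> (\<Sum>k\<in>UNIV. a (z k) (z k))"
  unfolding excess_eq using X_bessel l_pos by (simp add: sum_nonneg less_imp_le)

text \<open>The norm of \<open>z k\<close> is the deficit of column k of \<open>X\<close>. Summing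
  squares by columns or by rows gives the same total, so these deficits match the row deficits
  occurring in \<open>excess_eq\<close>.\<close>

lemma b_z_sum: "(\<Sum>k\<in>UNIV. b (z k) (z k)) = (\<Sum>i\<in>UNIV. 1 - (\<Sum>k\<in>UNIV. (X i k)\<^sup>2))"
proof -
  have "b (z k) (z k) = 1 - (\<Sum>i\<in>UNIV. (X i k)\<^sup>2)" for k
    using b_u_u[of k k] by (simp add: u_orth power2_eq_square)
  then have "(\<Sum>k\<in>UNIV. b (z k) (z k)) = real CARD('n) - (\<Sum>k\<in>UNIV. \<Sum>i\<in>UNIV. (X i k)\<^sup>2)"
    by (simp add: sum_subtractf)
  also have "\<dots> = real CARD('n) - (\<Sum>i\<in>UNIV. \<Sum>k\<in>UNIV. (X i k)\<^sup>2)"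
    by (subst sum.swap) simp
  finally show ?thesis by (simp add: sum_subtractf)
qed

lemma M_b_z_le: "M * b (z k) (z k) \<le> a (z k) (z k)"
  by (rule gap) (rule b_e_z)

lemma M_b_z_sum: "M * (\<Sum>k\<in>UNIV. b (z k) (z k)) \<le> (\<Sum>k\<in>UNIV. a (z k) (z k))"
  unfolding sum_distrib_left by (intro sum_mono M_b_z_le)

text \<open>The row deficits are nonnegative by Bessel, so raising every \<open>l i\<close> to
  \<open>Lam\<close> only enlarges what is subtracted.\<close>

lemma excess_ge: "(\<Sum>k\<in>UNIV. a (z k) (z k)) - Lam * (\<Sum>k\<in>UNIV. b (z k) (z k)) \<le> excess"
proof -
  have "(\<Sum>i\<in>UNIV. l i * (1 - (\<Sum>k\<in>UNIV. (X i k)\<^sup>2))) \<le> (\<Sum>i\<in>UNIV. Lam * (1 - (\<Sum>k\<in>UNIV. (X i k)\<^sup>2)))"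
    using X_bessel l_le by (intro sum_mono mult_right_mono) auto
  then show ?thesis unfolding excess_eq b_z_sum by (simp add: sum_distrib_left)
qed

lemma excess_ge_b: "(M - Lam) * (\<Sum>k\<in>UNIV. b (z k) (z k)) \<le> excess"
  using excess_ge M_b_z_sum
  by (simp add: left_diff_distrib)

lemma excess_ge_a: "(1 - Lam / M) * (\<Sum>k\<in>UNIV. a (z k) (z k)) \<le> excess"
proof -
  have "(\<Sum>k\<in>UNIV. b (z k) (z k)) \<le> (\<Sum>k\<in>UNIV. a (z k) (z k)) / M"
    using M_b_z_sum M_pos
    by (simp add: field_simps)
  then have "Lam * (\<Sum>k\<in>UNIV. b (z k) (z k)) \<le> Lam * ((\<Sum>k\<in>UNIV. a (z k) (z k)) / M)"
    using Lam_pos by (intro mult_left_mono) auto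
  then show ?thesis using excess_ge by (simp add: left_diff_distrib)
qed

lemma excess_nonneg: "0 \<le> excess"
  using excess_ge_b Lam_less
  by (smt (verit) UNIV_I b.nonneg mult_nonneg_nonneg sum_nonneg)

subsection \<open>Gradient domination\<close>

lemma r_nonneg: "0 \<le> r"
  by (simp add: r_def sum_nonneg a.nonneg)

lemma r_square: "r\<^sup>2 = (\<Sum>k\<in>UNIV. a (R k) (R k))"
  by (simp add: r_def sum_nonneg a.nonneg)

lemma a_snorm_R: "a.snorm (R k) \<le> r"
  using member_le_sum[of k UNIV "\<lambda>k. a (R k) (R k)"] a.nonneg
  by (simp add: r_def a.snorm_def)

text \<open>Eigenvectors other than the first N also give R = 0. The bound on \<open>z\<close>
  excludes them: it keeps X^T X above \<delta>, whence 1 / sqrt \<delta> bounds the entries of the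
  inverse of \<open>X\<close>. In graph coordinates v = e + y, the gradient minus a suitable element
  of the span of u is v_i / l_i - G v_i. Tested with y_i, which is \<open>b\<close>-orthogonal to
  all e, it leaves a(y_i,y_i) / l_i - b(y_i,y_i), and the gap bounds this below by 1 / Lam - 1 / M
  times a(y_i,y_i).\<close>

lemma gradient_domination:
  fixes \<delta> :: real
  assumes \<delta>: "0 < \<delta>" and zb: "(\<Sum>k\<in>UNIV. b (z k) (z k)) \<le> 1 - \<delta>"
  defines "N \<equiv> real CARD('n)" and "p \<equiv> 1 / sqrt \<delta>"
  shows "excess \<le> N * (N * (N * p * (1 + N * sqrt \<kappa> * (N * p * sqrt K)) / (1 / Lam - 1 / M)))\<^sup>2 * r\<^sup>2"
proof -
  \<comment> \<open>X^T X is the identity minus the \<open>b\<close>-Gram matrix of z, and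
    Cauchy-Schwarz bounds the latter by the sum of all \<open>b (z k) (z k)\<close>.\<close>
  have coercive: "\<delta> * (\<Sum>k\<in>UNIV. (c k)\<^sup>2) \<le> (\<Sum>i\<in>UNIV. (\<Sum>k\<in>UNIV. X i k * c k)\<^sup>2)" for c
  proof -
    define q where "q = (\<Sum>k\<in>UNIV. (c k)\<^sup>2)"
    define zz where "zz = (\<Sum>k\<in>UNIV. c k *\<^sub>R z k)"
    have "(\<Sum>i\<in>UNIV. (\<Sum>k\<in>UNIV. X i k * c k)\<^sup>2) = (\<Sum>j\<in>UNIV. \<Sum>k\<in>UNIV. c j * c k * (\<Sum>i\<in>UNIV. X i j * X i k))"
    proof -
      have "(\<Sum>k\<in>UNIV. X i k * c k)\<^sup>2 = (\<Sum>j\<in>UNIV. \<Sum>k\<in>UNIV. c j * c k * (X i j * X i k))" for i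
        by (simp add: power2_eq_square sum_product mult_ac)
      then have "(\<Sum>i\<in>UNIV. (\<Sum>k\<in>UNIV. X i k * c k)\<^sup>2) = (\<Sum>i\<in>UNIV. \<Sum>j\<in>UNIV. \<Sum>k\<in>UNIV. c j * c k * (X i j * X i k))"
        by simp
      also have "\<dots> = (\<Sum>j\<in>UNIV. \<Sum>i\<in>UNIV. \<Sum>k\<in>UNIV. c j * c k * (X i j * X i k))"
        by (rule sum.swap)
      also have "\<dots> = (\<Sum>j\<in>UNIV. \<Sum>k\<in>UNIV. \<Sum>i\<in>UNIV. c j * c k * (X i j * X i k))"
        by (rule sum.cong[OF refl]) (rule sum.swap)
      finally show ?thesis by (simp add: sum_distrib_left)
    qed
    also have "\<dots> = (\<Sum>j\<in>UNIV. \<Sum>k\<in>UNIV. c j * c k * (b (u j) (u k) - b (z j) (z k)))"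
      by (simp add: b_u_u)
    also have "\<dots> = q - b zz zz"
    proof -
      have "b zz zz = (\<Sum>j\<in>UNIV. \<Sum>k\<in>UNIV. c j * c k * b (z j) (z k))"
        unfolding zz_def
        by (subst b.sum_left, simp, simp)
           (simp add: b.sum_right b.scale_left b.scale_right sum_distrib_left mult_ac)
      then show ?thesis
        by (simp add: right_diff_distrib sum_subtractf u_orth mult_delta_right q_def power2_eq_square)
    qed
    finally have eq: "(\<Sum>i\<in>UNIV. (\<Sum>k\<in>UNIV. X i k * c k)\<^sup>2) = q - b zz zz" .
    have "b.snorm zz \<le> (\<Sum>k\<in>UNIV. \<bar>c k\<bar> * b.snorm (z k))"
      unfolding zz_def using b.snorm_sum[of UNIV "\<lambda>k. c k *\<^sub>R z k"] by (simp add: b.snorm_scale)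
    then have "(b.snorm zz)\<^sup>2 \<le> (\<Sum>k\<in>UNIV. \<bar>c k\<bar> * b.snorm (z k))\<^sup>2"
      by (intro power_mono) auto
    also have "\<dots> \<le> (\<Sum>k\<in>UNIV. \<bar>c k\<bar>\<^sup>2) * (\<Sum>k\<in>UNIV. (b.snorm (z k))\<^sup>2)"
      by (rule Cauchy_Schwarz_ineq_sum)
    also have "\<dots> = q * (\<Sum>k\<in>UNIV. b (z k) (z k))"
      by (simp add: q_def b.snorm_square)
    also have "\<dots> \<le> q * (1 - \<delta>)"
      using zb by (intro mult_left_mono) (auto simp: q_def sum_nonneg)
    finally show ?thesis unfolding eq using b.snorm_square[of zz] by (simp add: algebra_simps q_def)
  qed
  have ker: "c k = 0" if "\<And>i. (\<Sum>k\<in>UNIV. X i k * c k) = 0" for c k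
  proof -
    have "\<delta> * (\<Sum>k\<in>UNIV. (c k)\<^sup>2) \<le> 0" using coercive[of c] that by simp
    then have "(\<Sum>k\<in>UNIV. (c k)\<^sup>2) \<le> 0" using \<delta> by (simp add: mult_le_0_iff)
    then have "(\<Sum>k\<in>UNIV. (c k)\<^sup>2) = 0" by (intro antisym) (auto simp: sum_nonneg)
    then show ?thesis by (simp add: sum_nonneg_eq_0_iff)
  qed
  obtain P where XP: "\<And>i j. (\<Sum>k\<in>UNIV. X i k * P k j) = (if i = j then 1 else 0)"
    and PX: "\<And>i j. (\<Sum>k\<in>UNIV. P i k * X k j) = (if i = j then 1 else 0)"
    using finite_family_inverse[of X] ker by blast
  have p: "0 < p" using \<delta> by (simp add: p_def)
  \<comment> \<open>Coercivity on a column of \<open>P\<close>, which \<open>X\<close> maps to a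
    unit vector.\<close>
  have P_le: "\<bar>P k j\<bar> \<le> p" for k j
  proof -
    have "\<delta> * (\<Sum>k\<in>UNIV. (P k j)\<^sup>2) \<le> 1"
      using coercive[of "\<lambda>k. P k j"] by (simp add: XP if_distrib[of "\<lambda>x. x\<^sup>2"] cong: if_cong)
    moreover have "(P k j)\<^sup>2 \<le> (\<Sum>k\<in>UNIV. (P k j)\<^sup>2)"
      by (rule member_le_sum) auto
    ultimately have "(P k j)\<^sup>2 \<le> 1 / \<delta>" using \<delta>
      by (metis mult.commute mult_left_mono order_trans pos_le_divide_eq less_imp_le)
    then show ?thesis
      using real_sqrt_le_mono by (fastforce simp: p_def real_sqrt_divide)
  qed
  have N: "0 < N" by (simp add: N_def)
  \<comment> \<open>The basis U X^-1 of the span of u. Its components in the ground space are those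
    of e, so that the rest is y = Z X^-1.\<close>
  define v where "v = (\<lambda>i. \<Sum>k\<in>UNIV. P k i *\<^sub>R u k)"
  define y where "y = (\<lambda>i. v i - e i)"
  have b_e_v: "b (e m) (v i) = (if m = i then 1 else 0)" for m i
    using XP[of m i] by (simp add: v_def b.bilinear_simps mult.commute flip: X_def)
  have b_e_y: "b (e m) (y i) = 0" for m i
    by (simp add: y_def b.bilinear_simps b_e_v e_orth)
  have u_v: "u j = (\<Sum>m\<in>UNIV. X m j *\<^sub>R v m)" for j
  proof -
    have "(\<Sum>m\<in>UNIV. X m j *\<^sub>R v m) = (\<Sum>k\<in>UNIV. (\<Sum>m\<in>UNIV. P k m * X m j) *\<^sub>R u k)"
      by (simp add: v_def scaleR_sum_right scaleR_sum_left mult.commute) (rule sum.swap)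
    then show ?thesis by (simp add: PX if_distrib[of "\<lambda>x. x *\<^sub>R _"] if_distribR cong: if_cong)
  qed
  define RR where "RR = (\<lambda>i. \<Sum>k\<in>UNIV. P k i *\<^sub>R R k)"
  define q where "q = (\<lambda>j i. \<Sum>k\<in>UNIV. s j k * P k i)"
  define m where "m = (\<lambda>h i. \<Sum>j\<in>UNIV. X h j * q j i)"
  have proj: "(\<Sum>j\<in>UNIV. q j i *\<^sub>R u j) = (\<Sum>h\<in>UNIV. m h i *\<^sub>R v h)" for i
    by (simp add: m_def u_v scaleR_sum_right scaleR_sum_left mult.commute) (rule sum.swap)
  have RR_eq: "RR i = (\<Sum>j\<in>UNIV. q j i *\<^sub>R u j) - (\<Sum>k\<in>UNIV. P k i *\<^sub>R g k)" for i
    by (simp add: RR_def R_def scaleR_diff_right sum_subtractf scaleR_sum_right q_def scaleR_sum_left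
        mult.commute) (rule sum.swap)
  have b_e_RR: "b (e h) (RR i) = m h i - (if h = i then 1 else 0) / l h" for h i
  proof -
    have "b (e h) (g k) = X h k / l h" for k
      using e_eigen[of h "g k"] l_pos[of h] a_g[of k "e h"]
      by (simp add: a.sym[of "e h"] X_def b.sym[of "e h"] field_simps)
    then have "b (e h) (\<Sum>k\<in>UNIV. P k i *\<^sub>R g k) = (\<Sum>k\<in>UNIV. X h k * P k i) / l h"
      by (simp add: b.bilinear_simps sum_divide_distrib mult.commute)
    then show ?thesis
      by (simp add: RR_eq proj b.diff_right b.sum_right b.scale_right b_e_v mult_delta_right XP)
  qed
  \<comment> \<open>The components of \<open>RR\<close> along e tell which combination of the v to
    remove; the unknown coefficients \<open>m\<close> then cancel.\<close>
  have residual: "RR i - (\<Sum>h\<in>UNIV. b (e h) (RR i) *\<^sub>R v h) = (1 / l i) *\<^sub>R v i - (\<Sum>k\<in>UNIV. P k i *\<^sub>R g k)" for i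
  proof -
    have "(\<Sum>h\<in>UNIV. b (e h) (RR i) *\<^sub>R v h) = (\<Sum>h\<in>UNIV. m h i *\<^sub>R v h) - (\<Sum>h\<in>UNIV. ((if h = i then 1 else 0) / l h) *\<^sub>R v h)"
      by (simp add: b_e_RR scaleR_diff_left sum_subtractf)
    also have "(\<Sum>h\<in>UNIV. ((if h = i then 1 else 0) / l h) *\<^sub>R v h) = (\<Sum>h\<in>UNIV. if h = i then (1 / l h) *\<^sub>R v h else 0)"
      by (intro sum.cong) auto
    finally show ?thesis by (simp add: RR_eq proj)
  qed
  define \<gamma> where "\<gamma> = 1 / Lam - 1 / M"
  have \<gamma>: "0 < \<gamma>" using Lam_pos Lam_less by (simp add: \<gamma>_def field_simps)
  \<comment> \<open>Assembled from the bound N p r for \<open>RR\<close>, the factor sqrt \<kappa>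
    for passing from \<open>a\<close> to \<open>b\<close>, the bound N p sqrt K for
    \<open>v\<close>, and the gap \<gamma>.\<close>
  define D where "D = N * p * (1 + N * sqrt \<kappa> * (N * p * sqrt K)) / \<gamma>"
  have D0: "0 \<le> D" using N p \<kappa>_pos K_nonneg \<gamma> by (simp add: D_def)
  have y_le: "a.snorm (y i) \<le> D * r" for i
  proof (cases "a.snorm (y i) = 0")
    case True
    then show ?thesis using D0 r_nonneg by simp
  next
    case False
    then have pos: "0 < a.snorm (y i)" by (simp add: less_le)
    have RR_le: "a.snorm (RR i) \<le> N * (p * r)"
    proof -
      have "a.snorm (RR i) \<le> (\<Sum>k\<in>UNIV. \<bar>P k i\<bar> * a.snorm (R k))"
        unfolding RR_def using a.snorm_sum[of UNIV "\<lambda>k. P k i *\<^sub>R R k"] by (simp add: a.snorm_scale)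
      also have "\<dots> \<le> N * (p * r)"
        unfolding N_def by (intro sum_le_card_mult mult_mono) (use P_le a_snorm_R p in auto)
      finally show ?thesis .
    qed
    have v_le: "a.snorm (v h) \<le> N * (p * sqrt K)" for h
    proof -
      have "a.snorm (v h) \<le> (\<Sum>k\<in>UNIV. \<bar>P k h\<bar> * a.snorm (u k))"
        unfolding v_def using a.snorm_sum[of UNIV "\<lambda>k. P k h *\<^sub>R u k"] by (simp add: a.snorm_scale)
      also have "\<dots> \<le> N * (p * sqrt K)"
        unfolding N_def by (intro sum_le_card_mult mult_mono) (use P_le a_snorm_u p in auto)
      finally show ?thesis .
    qed
    have b_le: "\<bar>b (e h) (RR i)\<bar> \<le> sqrt \<kappa> * (N * (p * r))" for h
    proof -
      have "\<bar>b (e h) (RR i)\<bar> \<le> b.snorm (RR i)"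
        using b.Cauchy_Schwarz[of "e h" "RR i"] by (simp add: b_snorm_e)
      also have "\<dots> \<le> sqrt \<kappa> * a.snorm (RR i)" by (rule b_snorm_le)
      also have "\<dots> \<le> sqrt \<kappa> * (N * (p * r))" using RR_le \<kappa>_pos by (intro mult_left_mono) auto
      finally show ?thesis .
    qed
    have a_v_y: "a (v i) (y i) = a (y i) (y i)"
    proof -
      have "v i = e i + y i" by (simp add: y_def)
      then have "a (v i) (y i) = a (e i) (y i) + a (y i) (y i)" by (simp add: a.add_left)
      then show ?thesis by (simp add: e_eigen b_e_y)
    qed
    have b_v_y: "b (v i) (y i) = b (y i) (y i)"
    proof -
      have "v i = e i + y i" by (simp add: y_def)
      then have "b (v i) (y i) = b (e i) (y i) + b (y i) (y i)" by (simp add: b.add_left)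
      then show ?thesis by (simp add: b_e_y)
    qed
    have "b (y i) (y i) \<le> a (y i) (y i) / M"
      using gap[of "y i"] b_e_y M_pos by (simp add: field_simps)
    moreover have "a (y i) (y i) / Lam \<le> a (y i) (y i) / l i"
      using l_pos l_le a.nonneg[of "y i"] by (intro divide_left_mono) (auto simp: Lam_pos)
    ultimately have "\<gamma> * (a.snorm (y i))\<^sup>2 \<le> a (y i) (y i) / l i - b (y i) (y i)"
      by (simp add: \<gamma>_def left_diff_distrib a.snorm_square)
    also have "\<dots> = a ((1 / l i) *\<^sub>R v i - (\<Sum>k\<in>UNIV. P k i *\<^sub>R g k)) (y i)"
    proof -
      have "a (\<Sum>k\<in>UNIV. P k i *\<^sub>R g k) (y i) = b (v i) (y i)"
        by (simp add: v_def a.bilinear_simps b.bilinear_simps a_g)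
      then show ?thesis by (simp add: a.diff_left a.scale_left a_v_y b_v_y)
    qed
    also have "\<dots> = a (RR i - (\<Sum>h\<in>UNIV. b (e h) (RR i) *\<^sub>R v h)) (y i)"
      by (simp only: residual)
    also have "\<dots> \<le> a.snorm (RR i - (\<Sum>h\<in>UNIV. b (e h) (RR i) *\<^sub>R v h)) * a.snorm (y i)"
      using a.Cauchy_Schwarz by (simp add: abs_le_iff)
    finally have "\<gamma> * a.snorm (y i) \<le> a.snorm (RR i - (\<Sum>h\<in>UNIV. b (e h) (RR i) *\<^sub>R v h))"
      using pos by (simp add: power2_eq_square flip: mult.assoc)
    also have "\<dots> \<le> a.snorm (RR i) + (\<Sum>h\<in>UNIV. \<bar>b (e h) (RR i)\<bar> * a.snorm (v h))"
      using a.snorm_triangle_diff[of "RR i" "\<Sum>h\<in>UNIV. b (e h) (RR i) *\<^sub>R v h"]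
        a.snorm_sum[of UNIV "\<lambda>h. b (e h) (RR i) *\<^sub>R v h"]
      by (simp add: a.snorm_scale)
    also have "\<dots> \<le> N * (p * r) + N * ((sqrt \<kappa> * (N * (p * r))) * (N * (p * sqrt K)))"
      unfolding N_def by (intro add_mono sum_le_card_mult mult_mono)
        (use RR_le b_le v_le r_nonneg p \<kappa>_pos in \<open>auto simp: N_def\<close>)
    also have "\<dots> = \<gamma> * (D * r)"
      using \<gamma> by (simp add: D_def field_simps)
    finally show ?thesis using \<gamma> by simp
  qed
  have z_y: "z k = (\<Sum>i\<in>UNIV. X i k *\<^sub>R y i)" for k
    by (simp add: z_def y_def scaleR_diff_right sum_subtractf flip: u_v)
  have z_le: "a (z k) (z k) \<le> (N * D)\<^sup>2 * r\<^sup>2" for k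
  proof -
    have "a.snorm (z k) \<le> (\<Sum>i\<in>UNIV. \<bar>X i k\<bar> * a.snorm (y i))"
      unfolding z_y using a.snorm_sum[of UNIV "\<lambda>i. X i k *\<^sub>R y i"] by (simp add: a.snorm_scale)
    also have "\<dots> \<le> N * (1 * (D * r))"
      unfolding N_def by (intro sum_le_card_mult mult_mono) (use abs_X_le y_le in auto)
    finally have "(a.snorm (z k))\<^sup>2 \<le> (N * (D * r))\<^sup>2" by (intro power_mono) auto
    then show ?thesis by (simp add: a.snorm_square power_mult_distrib mult_ac)
  qed
  have "excess \<le> N * ((N * D)\<^sup>2 * r\<^sup>2)"
    using excess_le sum_le_card_mult[of "\<lambda>k. a (z k) (z k)", OF z_le] by (simp add: N_def)
  then show ?thesis by (simp add: D_def \<gamma>_def mult.assoc)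
qed

end

section \<open>Dissipation of the energy along the gradient direction\<close>

context ground_state_tuple
begin

lemma K_pos: "0 < K"
proof -
  have "1 \<le> \<kappa> * a (u k) (u k)" for k using b_le_a[of "u k"] by (simp add: u_orth)
  then have "1 \<le> \<kappa> * K"
    using a_u_le \<kappa>_pos by (meson mult_left_mono order_trans less_imp_le)
  then show ?thesis using \<kappa>_pos K_nonneg by (cases "K = 0") auto
qed

text \<open>Duality: |x|^2 is the \<open>a\<close>-product of the combinations of g and of u with
  coefficients x. The latter has \<open>a\<close>-norm at most |x| sqrt K, so the former cannot be
  small.\<close>

lemma s_coercive: "(\<Sum>k\<in>UNIV. (x k)\<^sup>2) / K \<le> (\<Sum>i\<in>UNIV. \<Sum>j\<in>UNIV. s i j * (x i * x j))"
proof -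
  define q where "q = (\<Sum>k\<in>UNIV. (x k)\<^sup>2)"
  define G where "G = (\<Sum>k\<in>UNIV. x k *\<^sub>R g k)"
  define U where "U = (\<Sum>k\<in>UNIV. x k *\<^sub>R u k)"
  have sG: "(\<Sum>i\<in>UNIV. \<Sum>j\<in>UNIV. s i j * (x i * x j)) = a G G"
    unfolding G_def
    by (subst a.sum_left, simp, simp)
       (simp add: a.sum_right a.scale_left a.scale_right sum_distrib_left s_eq mult_ac)
  have GU: "a G U = q"
    by (simp add: G_def U_def q_def a.bilinear_simps a_g u_orth mult_delta_right power2_eq_square)
  have "a.snorm U \<le> (\<Sum>k\<in>UNIV. \<bar>x k\<bar> * a.snorm (u k))"
    unfolding U_def using a.snorm_sum[of UNIV "\<lambda>k. x k *\<^sub>R u k"] by (simp add: a.snorm_scale)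
  then have "(a.snorm U)\<^sup>2 \<le> (\<Sum>k\<in>UNIV. \<bar>x k\<bar> * a.snorm (u k))\<^sup>2"
    by (intro power_mono) auto
  also have "\<dots> \<le> (\<Sum>k\<in>UNIV. \<bar>x k\<bar>\<^sup>2) * (\<Sum>k\<in>UNIV. (a.snorm (u k))\<^sup>2)"
    by (rule Cauchy_Schwarz_ineq_sum)
  also have "\<dots> = q * (\<Sum>k\<in>UNIV. a (u k) (u k))"
    by (simp add: q_def a.snorm_square)
  also have "\<dots> \<le> q * K"
    using energy_le by (intro mult_left_mono) (auto simp: q_def sum_nonneg)
  finally have UU: "a U U \<le> q * K" by (simp add: a.snorm_square)
  have "q\<^sup>2 \<le> a G G * a U U"
    using a.Cauchy_Schwarz_square[of G U] by (simp add: GU)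
  also have "\<dots> \<le> a G G * (q * K)"
    using UU by (intro mult_left_mono) (auto simp: a.nonneg)
  finally have *: "q * q \<le> q * (a G G * K)" by (simp add: power2_eq_square mult_ac)
  have "q \<le> a G G * K"
  proof (cases "q = 0")
    case False
    then have "0 < q" by (simp add: q_def less_le sum_nonneg)
    then show ?thesis using * by simp
  qed (use K_pos in \<open>simp add: a.nonneg\<close>)
  then show ?thesis using K_pos by (simp add: sG q_def[symmetric] pos_divide_le_eq)
qed

text \<open>R is tangent to the orthonormality constraint, which is exactly the symmetry of
  \<open>s\<close>. Through the equation for g this becomes \<open>a\<close>-orthogonality to
  g.\<close>

lemma b_u_R: "b (u i) (R k) = 0"
  using s_sym[of i k]
  by (simp add: R_def b.bilinear_simps u_orth mult_delta_right s_def b.sym[of "u i" "g k"])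

lemma a_R_g: "a (R k) (g i) = 0"
  using b_u_R[of i k] a_g[of i "R k"] a.sym[of "R k" "g i"] by simp

lemma a_R_R: "a (R k) (R j) = (\<Sum>i\<in>UNIV. s i j * a (R k) (u i))"
  by (subst (2) R_def) (simp add: a.bilinear_simps a_R_g)

text \<open>By \<open>a_R_R\<close> the dissipation is the trace of s^-1 times the
  \<open>a\<close>-Gram matrix of R. Substituting R = w s moves the matrix to the other side, where
  only the lower bound 1 / K of \<open>s\<close> is used; the entries of \<open>s\<close>, at most
  \<kappa>, then compare w with R.\<close>

lemma dissipation:
  "r\<^sup>2 / (K * (real CARD('n) * \<kappa>)\<^sup>2) \<le> (\<Sum>k\<in>UNIV. a (R k) (u k))"
proof -
  have ker: "x k = 0" if x: "\<And>i. (\<Sum>k\<in>UNIV. s i k * x k) = 0" for x k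
  proof -
    have "(\<Sum>i\<in>UNIV. \<Sum>j\<in>UNIV. s i j * (x i * x j)) = (\<Sum>i\<in>UNIV. x i * (\<Sum>j\<in>UNIV. s i j * x j))"
      by (simp add: sum_distrib_left mult_ac)
    then have "(\<Sum>k\<in>UNIV. (x k)\<^sup>2) / K \<le> 0" using s_coercive[of x] x by simp
    then have "(\<Sum>k\<in>UNIV. (x k)\<^sup>2) = 0"
      using K_pos by (intro antisym) (auto simp: sum_nonneg divide_le_0_iff)
    then show ?thesis by (simp add: sum_nonneg_eq_0_iff)
  qed
  obtain P where sP: "\<And>i j. (\<Sum>k\<in>UNIV. s i k * P k j) = (if i = j then 1 else 0)"
    and Ps: "\<And>i j. (\<Sum>k\<in>UNIV. P i k * s k j) = (if i = j then 1 else 0)"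
    using finite_family_inverse[of s] ker by blast
  \<comment> \<open>w = R s^-1, so that the dissipation is the trace of \<open>s\<close> times the
    \<open>a\<close>-Gram matrix of w.\<close>
  define w where "w = (\<lambda>j. \<Sum>k\<in>UNIV. P k j *\<^sub>R R k)"
  have R_w: "R k = (\<Sum>j\<in>UNIV. s j k *\<^sub>R w j)" for k
  proof -
    have "(\<Sum>j\<in>UNIV. s j k *\<^sub>R w j) = (\<Sum>m\<in>UNIV. (\<Sum>j\<in>UNIV. P m j * s j k) *\<^sub>R R m)"
      by (simp add: w_def scaleR_sum_right scaleR_sum_left mult.commute) (rule sum.swap)
    then show ?thesis by (simp add: Ps if_distrib[of "\<lambda>x. x *\<^sub>R _"] if_distribR cong: if_cong)
  qed
  have a_R_w: "a (R k) (w j) = a (R k) (u j)" for k j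
  proof -
    have "a (R k) (w j) = (\<Sum>m\<in>UNIV. P m j * (\<Sum>i\<in>UNIV. s i m * a (R k) (u i)))"
      by (simp add: w_def a.bilinear_simps a_R_R)
    also have "\<dots> = (\<Sum>m\<in>UNIV. \<Sum>i\<in>UNIV. s i m * P m j * a (R k) (u i))"
      by (simp add: sum_distrib_left mult_ac)
    also have "\<dots> = (\<Sum>i\<in>UNIV. \<Sum>m\<in>UNIV. s i m * P m j * a (R k) (u i))"
      by (rule sum.swap)
    also have "\<dots> = (\<Sum>i\<in>UNIV. (\<Sum>m\<in>UNIV. s i m * P m j) * a (R k) (u i))"
      by (simp add: sum_distrib_right)
    finally show ?thesis by (simp add: sP mult_delta_left)
  qed
  define W where "W = (\<Sum>k\<in>UNIV. a (w k) (w k))"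
  \<comment> \<open>Both s - I / K and the Gram matrix of w are positive semidefinite, so the trace
    of their product is nonnegative.\<close>
  have "0 \<le> (\<Sum>i\<in>UNIV. \<Sum>j\<in>UNIV. (s i j - (if i = j then 1 / K else 0)) * a (w i) (w j))"
  proof (rule a.trace_nonneg)
    show "0 \<le> (\<Sum>i\<in>UNIV. \<Sum>j\<in>UNIV. (s i j - (if i = j then 1 / K else 0)) * (x i * x j))" for x
      using s_coercive[of x]
      by (simp add: left_diff_distrib sum_subtractf mult_delta_left power2_eq_square sum_divide_distrib)
  qed (auto simp: s_sym)
  then have "W / K \<le> (\<Sum>i\<in>UNIV. \<Sum>j\<in>UNIV. s i j * a (w i) (w j))"
    by (simp add: left_diff_distrib sum_subtractf mult_delta_left W_def sum_divide_distrib)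
  also have "\<dots> = (\<Sum>j\<in>UNIV. \<Sum>i\<in>UNIV. s i j * a (w i) (w j))"
    by (rule sum.swap)
  also have "\<dots> = (\<Sum>j\<in>UNIV. a (R j) (w j))"
    by (simp add: R_w a.bilinear_simps)
  finally have D: "W / K \<le> (\<Sum>k\<in>UNIV. a (R k) (u k))"
    by (simp add: a_R_w)
  have W0: "0 \<le> W" by (simp add: W_def sum_nonneg a.nonneg)
  have s_le: "\<bar>s j k\<bar> \<le> \<kappa>" for j k
  proof -
    have "\<bar>s j k\<bar> \<le> a.snorm (g j) * a.snorm (g k)"
      using a.Cauchy_Schwarz by (simp add: s_eq)
    also have "\<dots> \<le> sqrt \<kappa> * sqrt \<kappa>" using a_snorm_g \<kappa>_pos by (intro mult_mono) auto
    finally show ?thesis using \<kappa>_pos by simp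
  qed
  have R_le: "a (R k) (R k) \<le> real CARD('n) * (\<kappa>\<^sup>2 * W)" for k
  proof -
    have "a.snorm (R k) \<le> (\<Sum>j\<in>UNIV. \<bar>s j k\<bar> * a.snorm (w j))"
      unfolding R_w using a.snorm_sum[of UNIV "\<lambda>j. s j k *\<^sub>R w j"] by (simp add: a.snorm_scale)
    then have "(a.snorm (R k))\<^sup>2 \<le> (\<Sum>j\<in>UNIV. \<bar>s j k\<bar> * a.snorm (w j))\<^sup>2"
      by (intro power_mono) auto
    also have "\<dots> \<le> (\<Sum>j\<in>UNIV. \<bar>s j k\<bar>\<^sup>2) * (\<Sum>j\<in>UNIV. (a.snorm (w j))\<^sup>2)"
      by (rule Cauchy_Schwarz_ineq_sum)
    also have "\<dots> = (\<Sum>j\<in>UNIV. \<bar>s j k\<bar>\<^sup>2) * W"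
      by (simp add: W_def a.snorm_square)
    also have "\<dots> \<le> (real CARD('n) * \<kappa>\<^sup>2) * W"
      using W0 s_le by (intro mult_right_mono sum_le_card_mult power_mono) auto
    finally show ?thesis by (simp add: a.snorm_square)
  qed
  have "r\<^sup>2 \<le> real CARD('n) * (real CARD('n) * (\<kappa>\<^sup>2 * W))"
    unfolding r_square by (rule sum_le_card_mult) (rule R_le)
  then have "r\<^sup>2 \<le> W * (real CARD('n) * \<kappa>)\<^sup>2" by (simp add: power2_eq_square mult_ac)
  then have "r\<^sup>2 / (real CARD('n) * \<kappa>)\<^sup>2 \<le> W"
    using \<kappa>_pos by (simp add: pos_divide_le_eq)
  from divide_right_mono[OF this, of K] show ?thesis
    using D K_pos by (simp add: mult.commute)
qed

subsection \<open>One step of the scheme\<close>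

definition L :: "'v \<Rightarrow> 'v" where
  "L v = (\<Sum>i\<in>UNIV. b (g i) v *\<^sub>R u i) - (\<Sum>i\<in>UNIV. b (u i) v *\<^sub>R g i)"

lemma L_add: "L (v + w) = L v + L w"
  by (simp add: L_def b.add_right scaleR_add_left sum.distrib)

lemma L_scale: "L (c *\<^sub>R v) = c *\<^sub>R L v"
  by (simp add: L_def b.scale_right scaleR_sum_right scaleR_diff_right)

lemma L_diff: "L (v - w) = L v - L w"
  using L_add[of "v - w" w] by simp

lemma L_u: "L (u k) = R k"
  by (simp add: L_def R_def s_def u_orth if_distrib[of "\<lambda>x. x *\<^sub>R _"] if_distribR cong: if_cong)

text \<open>The scheme determines the new iterate only up to null vectors of \<open>a\<close>. These
  are null for \<open>b\<close> as well and leave \<open>L\<close> unchanged.\<close>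

lemma L_null:
  assumes "a v v = 0"
  shows "L v = 0"
proof -
  have "b v v = 0" using b_le_a[of v] assms b.nonneg[of v] by simp
  then have "b w v = 0" for w using b.null_left[of v w] b.sym[of w v] by simp
  then show ?thesis by (simp add: L_def)
qed

definition K1 :: real where
  "K1 = real CARD('n) * (\<kappa> * sqrt \<kappa> * sqrt K) + real CARD('n) * (sqrt \<kappa> * sqrt \<kappa>)"

lemma L_bound: "a.snorm (L v) \<le> K1 * a.snorm v"
proof -
  have bg: "\<bar>b (g i) v\<bar> \<le> \<kappa> * (sqrt \<kappa> * a.snorm v)" for i
  proof -
    have "\<bar>b (g i) v\<bar> \<le> b.snorm (g i) * b.snorm v" by (simp add: b.Cauchy_Schwarz)
    also have "\<dots> \<le> \<kappa> * (sqrt \<kappa> * a.snorm v)"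
      using b_snorm_g b_snorm_le \<kappa>_pos by (intro mult_mono) auto
    finally show ?thesis .
  qed
  have bu: "\<bar>b (u i) v\<bar> \<le> sqrt \<kappa> * a.snorm v" for i
    using b.Cauchy_Schwarz[of "u i" v] b_snorm_le[of v] by (simp add: b_snorm_u)
  have "a.snorm (L v) \<le> (\<Sum>i\<in>UNIV. \<bar>b (g i) v\<bar> * a.snorm (u i)) + (\<Sum>i\<in>UNIV. \<bar>b (u i) v\<bar> * a.snorm (g i))"
    unfolding L_def
    using a.snorm_triangle_diff[of "\<Sum>i\<in>UNIV. b (g i) v *\<^sub>R u i" "\<Sum>i\<in>UNIV. b (u i) v *\<^sub>R g i"]
      a.snorm_sum[of UNIV "\<lambda>i. b (g i) v *\<^sub>R u i"] a.snorm_sum[of UNIV "\<lambda>i. b (u i) v *\<^sub>R g i"]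
    by (simp add: a.snorm_scale)
  also have "\<dots> \<le> real CARD('n) * ((\<kappa> * (sqrt \<kappa> * a.snorm v)) * sqrt K) + real CARD('n) * ((sqrt \<kappa> * a.snorm v) * sqrt \<kappa>)"
    using bg bu a_snorm_u a_snorm_g \<kappa>_pos by (intro add_mono sum_le_card_mult mult_mono) auto
  also have "\<dots> = K1 * a.snorm v" by (simp add: K1_def algebra_simps)
  finally show ?thesis .
qed

text \<open>The representer, with respect to \<open>b\<close>, of the functional v \<mapsto> sum of
  a(L v_k, u_k); see \<open>a_L_u\<close>.\<close>

definition h :: "'n \<Rightarrow> 'v" where
  "h k = (\<Sum>i\<in>UNIV. a (u i) (u k) *\<^sub>R g i) - u k"

text \<open>The representer is linear in R and hence of first order in \<open>r\<close>. This makes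
  a(L W, u) a term of second order. The identity rests on the matrix equation <R,U>_a = s <U,U>_a -
  I.\<close>

lemma h_eq: "h k = (\<Sum>j\<in>UNIV. a (R j) (u k) *\<^sub>R u j) - (\<Sum>i\<in>UNIV. a (u i) (u k) *\<^sub>R R i)"
proof -
  have aR: "a (R j) (u k) = (\<Sum>i\<in>UNIV. s i j * a (u i) (u k)) - (if j = k then 1 else 0)" for j
    by (simp add: R_def a.bilinear_simps a_g u_orth)
  have "(\<Sum>i\<in>UNIV. a (u i) (u k) *\<^sub>R R i) = (\<Sum>i\<in>UNIV. a (u i) (u k) *\<^sub>R (\<Sum>j\<in>UNIV. s j i *\<^sub>R u j)) - (\<Sum>i\<in>UNIV. a (u i) (u k) *\<^sub>R g i)"
    by (simp add: R_def scaleR_diff_right sum_subtractf)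
  also have "(\<Sum>i\<in>UNIV. a (u i) (u k) *\<^sub>R (\<Sum>j\<in>UNIV. s j i *\<^sub>R u j)) = (\<Sum>j\<in>UNIV. (\<Sum>i\<in>UNIV. s i j * a (u i) (u k)) *\<^sub>R u j)"
    by (simp add: scaleR_sum_right scaleR_sum_left mult.commute s_sym) (subst sum.swap, simp add: s_sym)
  also have "\<dots> = (\<Sum>j\<in>UNIV. a (R j) (u k) *\<^sub>R u j) + u k"
    by (simp add: aR scaleR_diff_left sum_subtractf if_distrib[of "\<lambda>x. x *\<^sub>R _"] if_distribR cong: if_cong)
  finally show ?thesis by (simp add: h_def)
qed

definition K2 :: real where
  "K2 = real CARD('n) * sqrt K + real CARD('n) * (K * sqrt \<kappa>)"

lemma h_bound: "b.snorm (h k) \<le> K2 * r"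
proof -
  have aR: "\<bar>a (R j) (u k)\<bar> \<le> r * sqrt K" for j
  proof -
    have "\<bar>a (R j) (u k)\<bar> \<le> a.snorm (R j) * a.snorm (u k)" by (simp add: a.Cauchy_Schwarz)
    also have "\<dots> \<le> r * sqrt K" using a_snorm_R a_snorm_u r_nonneg by (intro mult_mono) auto
    finally show ?thesis .
  qed
  have au: "\<bar>a (u i) (u k)\<bar> \<le> K" for i
  proof -
    have "\<bar>a (u i) (u k)\<bar> \<le> a.snorm (u i) * a.snorm (u k)" by (simp add: a.Cauchy_Schwarz)
    also have "\<dots> \<le> sqrt K * sqrt K" using a_snorm_u K_nonneg by (intro mult_mono) auto
    finally show ?thesis using K_nonneg by simp
  qed
  have bR: "b.snorm (R i) \<le> sqrt \<kappa> * r" for i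
    using b_snorm_le[of "R i"] a_snorm_R[of i] \<kappa>_pos
    by (meson mult_left_mono order_trans real_sqrt_ge_zero less_imp_le)
  have "b.snorm (h k) \<le> (\<Sum>j\<in>UNIV. \<bar>a (R j) (u k)\<bar> * b.snorm (u j)) + (\<Sum>i\<in>UNIV. \<bar>a (u i) (u k)\<bar> * b.snorm (R i))"
    unfolding h_eq
    using b.snorm_triangle_diff[of "\<Sum>j\<in>UNIV. a (R j) (u k) *\<^sub>R u j" "\<Sum>i\<in>UNIV. a (u i) (u k) *\<^sub>R R i"]
      b.snorm_sum[of UNIV "\<lambda>j. a (R j) (u k) *\<^sub>R u j"] b.snorm_sum[of UNIV "\<lambda>i. a (u i) (u k) *\<^sub>R R i"]
    by (simp add: b.snorm_scale)
  also have "\<dots> \<le> real CARD('n) * ((r * sqrt K) * 1) + real CARD('n) * (K * (sqrt \<kappa> * r))"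
    using aR au bR b_snorm_u r_nonneg K_nonneg by (intro add_mono sum_le_card_mult mult_mono) auto
  also have "\<dots> = K2 * r" by (simp add: K2_def algebra_simps)
  finally show ?thesis .
qed

lemma a_L_u: "(\<Sum>k\<in>UNIV. a (L (v k)) (u k)) = (\<Sum>k\<in>UNIV. b (h k) (v k))"
proof -
  have "a (L (v k)) (u k) = (\<Sum>i\<in>UNIV. b (g i) (v k) * a (u i) (u k)) - b (u k) (v k)" for k
    by (simp add: L_def a.bilinear_simps a_g u_orth mult_delta_right)
  moreover have "b (h k) (v k) = (\<Sum>i\<in>UNIV. b (g i) (v k) * a (u i) (u k)) - b (u k) (v k)" for k
    by (simp add: h_def b.bilinear_simps mult.commute)
  ultimately show ?thesis by simp
qed

definition k0 :: real where "k0 = 1 / (K * (real CARD('n) * \<kappa>)\<^sup>2)"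
text \<open>Bounds the remainder of one step in units of r^2. The condition
  \<open>t * K3 \<le> k0\<close> spends on it half of the guaranteed decrease 2 t k0 r^2.\<close>

definition K3 :: real where "K3 = real CARD('n) * (K2 * (sqrt \<kappa> * 2)) + real CARD('n) * 4"

lemma k0_pos: "0 < k0"
  using K_pos \<kappa>_pos by (simp add: k0_def)

lemma K1_nonneg: "0 \<le> K1"
  using K_nonneg \<kappa>_pos by (simp add: K1_def)

lemma K3_pos: "0 < K3"
  using K_nonneg \<kappa>_pos by (simp add: K3_def K2_def add_nonneg_pos)

text \<open>Up to a null vector the step is u' = u - t W with W the value of \<open>L\<close> at the
  midpoint. The condition with \<open>K1\<close> makes the implicit equation for W contractive, so
  that W has \<open>a\<close>-norm at most 2 r; the condition with \<open>K3\<close> keeps half of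
  the dissipation.\<close>

lemma scheme_step:
  assumes t: "0 < t" "t * K1 \<le> 1" "t * K3 \<le> k0"
    and null: "\<And>k. a (u' k - u k + t *\<^sub>R L ((1/2) *\<^sub>R (u k + u' k))) (u' k - u k + t *\<^sub>R L ((1/2) *\<^sub>R (u k + u' k))) = 0"
  shows "(\<Sum>k\<in>UNIV. a (u' k) (u' k)) \<le> (\<Sum>k\<in>UNIV. a (u k) (u k)) - t * k0 * r\<^sup>2"
    and "a.snorm (u' k - u k) \<le> 2 * t * r"
proof -
  define W where "W = (\<lambda>k. L ((1/2) *\<^sub>R (u k + u' k)))"
  define d where "d = (\<lambda>k. u' k - u k + t *\<^sub>R W k)"
  have d0: "a (d k) (d k) = 0" for k using null by (simp add: d_def W_def)
  have ad: "a (d k) v = 0" "a v (d k) = 0" for k v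
    using a.null_left[of "d k" v] d0 a.sym[of v "d k"] by simp_all
  have u': "u' k = (u k - t *\<^sub>R W k) + d k" for k by (simp add: d_def)
  \<comment> \<open>Eliminating u' from the midpoint leaves an implicit equation for W
    alone.\<close>
  have W_eq: "W k = R k - (t / 2) *\<^sub>R L (W k)" for k
  proof -
    have "(1/2) *\<^sub>R (u k + u' k) = u k + (- t / 2) *\<^sub>R W k + (1/2) *\<^sub>R d k"
      by (simp add: u' algebra_simps flip: scaleR_add_left)
    then have "W k = L (u k + (- t / 2) *\<^sub>R W k + (1/2) *\<^sub>R d k)" by (simp add: W_def)
    then show ?thesis by (simp add: L_add L_diff L_scale L_null[OF d0] L_u)
  qed
  have W_le: "a.snorm (W k) \<le> 2 * r" for k
  proof -
    have "a.snorm (W k) \<le> a.snorm (R k) + t / 2 * a.snorm (L (W k))"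
      using a.snorm_triangle_diff[of "R k" "(t / 2) *\<^sub>R L (W k)"] W_eq[of k] t
      by (simp add: a.snorm_scale)
    also have "\<dots> \<le> r + t / 2 * (K1 * a.snorm (W k))"
      using a_snorm_R L_bound t by (intro add_mono mult_left_mono) auto
    also have "\<dots> = r + (t * K1) * a.snorm (W k) / 2" by simp
    also have "\<dots> \<le> r + 1 * a.snorm (W k) / 2"
      using t by (intro add_left_mono divide_right_mono mult_right_mono) auto
    finally show ?thesis by simp
  qed
  have "a.snorm (u' k - u k) \<le> t * a.snorm (W k)"
  proof -
    have "u' k - u k = d k + (- t) *\<^sub>R W k" by (simp add: d_def)
    then have "a.snorm (u' k - u k) \<le> a.snorm (d k) + a.snorm ((- t) *\<^sub>R W k)"
      by (simp add: a.snorm_triangle del: scaleR_minus_left)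
    then show ?thesis using t by (simp add: a.snorm_def d0 a.snorm_scale[unfolded a.snorm_def] del: scaleR_minus_left)
  qed
  also have "\<dots> \<le> t * (2 * r)" using W_le t by (intro mult_left_mono) auto
  finally show "a.snorm (u' k - u k) \<le> 2 * t * r" by simp
  have a_u': "a (u' k) (u' k) = a (u k) (u k) - 2 * t * a (W k) (u k) + t\<^sup>2 * a (W k) (W k)" for k
    by (simp add: u' a.add_left a.add_right ad)
       (simp add: a.bilinear_simps a.sym[of "u k" "W k"] power2_eq_square algebra_simps)
  have a_W_u: "a (W k) (u k) = a (R k) (u k) - t / 2 * a (L (W k)) (u k)" for k
    by (subst W_eq) (simp add: a.bilinear_simps)
  have b_h_W: "b (h k) (W k) \<le> (K2 * r) * (sqrt \<kappa> * (2 * r))" for k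
  proof -
    have "b (h k) (W k) \<le> b.snorm (h k) * b.snorm (W k)"
      using b.Cauchy_Schwarz[of "h k" "W k"] by simp
    also have "\<dots> \<le> (K2 * r) * (sqrt \<kappa> * (2 * r))"
    proof (intro mult_mono h_bound)
      show "b.snorm (W k) \<le> sqrt \<kappa> * (2 * r)"
        using b_snorm_le[of "W k"] W_le[of k] \<kappa>_pos
        by (meson mult_left_mono order_trans real_sqrt_ge_zero less_imp_le)
    qed (use K_nonneg \<kappa>_pos r_nonneg in \<open>auto simp: K2_def\<close>)
    finally show ?thesis .
  qed
  have a_W_W: "a (W k) (W k) \<le> 4 * r\<^sup>2" for k
    using power_mono[OF W_le[of k], of 2] by (simp add: a.snorm_square power_mult_distrib)
  have err: "(\<Sum>k\<in>UNIV. a (L (W k)) (u k)) + (\<Sum>k\<in>UNIV. a (W k) (W k)) \<le> K3 * r\<^sup>2"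
  proof -
    have "(\<Sum>k\<in>UNIV. a (L (W k)) (u k)) + (\<Sum>k\<in>UNIV. a (W k) (W k))
      \<le> real CARD('n) * ((K2 * r) * (sqrt \<kappa> * (2 * r))) + real CARD('n) * (4 * r\<^sup>2)"
      unfolding a_L_u by (intro add_mono sum_le_card_mult b_h_W a_W_W)
    also have "\<dots> = K3 * r\<^sup>2" by (simp add: K3_def algebra_simps power2_eq_square)
    finally show ?thesis .
  qed
  have diss: "k0 * r\<^sup>2 \<le> (\<Sum>k\<in>UNIV. a (R k) (u k))"
    using dissipation by (simp add: k0_def)
  \<comment> \<open>Inserting W = R - (t/2) L W into the linear term -2 t a(W,u) contributes the
    term with \<open>L (W k)\<close> at order t^2.\<close>
  have "(\<Sum>k\<in>UNIV. a (u' k) (u' k)) = (\<Sum>k\<in>UNIV. a (u k) (u k)) - 2 * t * (\<Sum>k\<in>UNIV. a (R k) (u k))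
      + t\<^sup>2 * ((\<Sum>k\<in>UNIV. a (L (W k)) (u k)) + (\<Sum>k\<in>UNIV. a (W k) (W k)))"
    by (simp add: a_u' a_W_u sum.distrib sum_subtractf sum_distrib_left power2_eq_square algebra_simps)
  also have "\<dots> \<le> (\<Sum>k\<in>UNIV. a (u k) (u k)) - 2 * t * (k0 * r\<^sup>2) + t\<^sup>2 * (K3 * r\<^sup>2)"
    using t diss err by (intro add_mono diff_mono mult_left_mono) auto
  also have "t\<^sup>2 * (K3 * r\<^sup>2) = t * (t * K3) * r\<^sup>2" by (simp add: power2_eq_square)
  also have "\<dots> \<le> t * k0 * r\<^sup>2" using t by (intro mult_right_mono mult_left_mono) auto
  finally show "(\<Sum>k\<in>UNIV. a (u' k) (u' k)) \<le> (\<Sum>k\<in>UNIV. a (u k) (u k)) - t * k0 * r\<^sup>2"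
    by simp
qed

end

subsection \<open>Exponential convergence\<close>

text \<open>The increments from index n on are dominated by a geometric series of ratio exp (- c),
  whose sum gives the constant.\<close>

lemma exp_increments_limit:
  fixes x :: "nat \<Rightarrow> real"
  assumes c: "0 < c" and inc: "\<And>n. \<bar>x (Suc n) - x n\<bar> \<le> C * exp (- c * real n)"
  shows "\<exists>q. \<forall>n. \<bar>x n - q\<bar> \<le> C / (1 - exp (- c)) * exp (- c * real n)"
proof -
  define \<rho> where "\<rho> = exp (- c)"
  have \<rho>: "0 < \<rho>" "\<rho> < 1" using c by (auto simp: \<rho>_def)
  have pow: "exp (- c * real n) = \<rho> ^ n" for n
    by (simp add: \<rho>_def exp_of_nat_mult[symmetric] mult.commute)
  define d where "d = (\<lambda>n. x (Suc n) - x n)"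
  have d: "norm (d n) \<le> C * \<rho> ^ n" for n using inc[of n] by (simp only: d_def real_norm_def pow)
  have geo: "(\<lambda>k. C * \<rho> ^ (k + n)) sums (C * \<rho> ^ n / (1 - \<rho>))" for n
    using sums_mult[OF geometric_sums[of \<rho>], of "C * \<rho> ^ n"] \<rho> by (simp add: power_add mult_ac)
  have sd: "summable (\<lambda>k. d (k + n))" for n
    by (rule summable_comparison_test'[OF sums_summable[OF geo[of n]]]) (rule d)
  have x_eq: "x n - (x 0 + suminf d) = - (\<Sum>k. d (k + n))" for n
  proof -
    have "suminf d = (\<Sum>k. d (k + n)) + (\<Sum>k<n. d k)"
      using suminf_split_initial_segment[of d n] sd[of 0] by simp
    moreover have "(\<Sum>k<n. d k) = x n - x 0"
      unfolding d_def by (rule sum_lessThan_telescope)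
    ultimately show ?thesis by simp
  qed
  have "\<bar>x n - (x 0 + suminf d)\<bar> \<le> C / (1 - \<rho>) * \<rho> ^ n" for n
  proof -
    have "norm (\<Sum>k. d (k + n)) \<le> (\<Sum>k. C * \<rho> ^ (k + n))"
      by (rule norm_suminf_le[OF d sums_summable[OF geo]])
    also have "\<dots> = C * \<rho> ^ n / (1 - \<rho>)" using geo by (rule sums_unique[symmetric])
    finally show ?thesis by (simp add: x_eq)
  qed
  then show ?thesis unfolding pow \<rho>_def[symmetric] by blast
qed

context ground_state
begin

text \<open>The residual of the scheme multiplied by the time step. It is only required to have zero
  \<open>a\<close>-norm, since the scheme is an equation almost everywhere.\<close>

definition step_defect :: "real \<Rightarrow> ('n \<Rightarrow> 'v) \<Rightarrow> ('n \<Rightarrow> 'v) \<Rightarrow> ('n \<Rightarrow> 'v) \<Rightarrow> 'n \<Rightarrow> 'v" where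
  "step_defect t u g u' k = (let w = (1/2) *\<^sub>R (u k + u' k) in
     u' k - u k + t *\<^sub>R ((\<Sum>i\<in>UNIV. b (g i) w *\<^sub>R u i) - (\<Sum>i\<in>UNIV. b (u i) w *\<^sub>R g i)))"

definition exp_convergent :: "(nat \<Rightarrow> 'n \<Rightarrow> 'v) \<Rightarrow> bool" where
  "exp_convergent u \<longleftrightarrow>
     (\<exists>C>0. \<exists>c>0. \<exists>Q :: 'n \<Rightarrow> 'n \<Rightarrow> real. (\<forall>i j. (\<Sum>k\<in>UNIV. Q k i * Q k j) = (if i = j then 1 else 0)) \<and>
      (\<forall>n. (\<Sum>k\<in>UNIV. a (u n k) (u n k)) - (\<Sum>i\<in>UNIV. l i) \<le> C * exp (- 2 * c * real n) \<and>
        sqrt (\<Sum>k\<in>UNIV. a (u n k - (\<Sum>i\<in>UNIV. Q i k *\<^sub>R e i)) (u n k - (\<Sum>i\<in>UNIV. Q i k *\<^sub>R e i))) \<le> C * exp (- c * real n)))"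

theorem exponential_convergence:
  fixes u0 g0 :: "'n \<Rightarrow> 'v"
  assumes orth0: "\<And>i j. b (u0 i) (u0 j) = (if i = j then 1 else 0)"
    and g0: "\<And>i v. a (g0 i) v = b (u0 i) v"
    and energy0: "(\<Sum>k\<in>UNIV. a (u0 k) (u0 k)) < (\<Sum>i\<in>UNIV. l i) + (M - Lam)"
  shows "\<exists>taubar>0. \<forall>taumin (tau :: nat \<Rightarrow> real) u g. 0 < taumin \<longrightarrow> (\<forall>n. taumin \<le> tau n \<and> tau n \<le> taubar) \<longrightarrow>
    u 0 = u0 \<longrightarrow> (\<forall>n i j. b (u n i) (u n j) = (if i = j then 1 else 0)) \<longrightarrow>
    (\<forall>n i v. a (g n i) v = b (u n i) v) \<longrightarrow>
    (\<forall>n k. a (step_defect (tau n) (u n) (g n) (u (Suc n)) k) (step_defect (tau n) (u n) (g n) (u (Suc n)) k) = 0) \<longrightarrow>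
    exp_convergent u"
proof -
  define K where "K = (\<Sum>k\<in>UNIV. a (u0 k) (u0 k))"
  \<comment> \<open>Mainly for its constants: they are built from \<open>K\<close>,
    \<open>\<kappa>\<close> and the number of functions alone, hence agree with those of every later
    iterate.\<close>
  interpret T0: ground_state_tuple a b e l Lam M \<kappa> u0 g0 K
    by unfold_locales (auto simp: orth0 g0 K_def)
  define S where "S = (\<Sum>i\<in>UNIV. l i)"
  define N where "N = real CARD('n)"
  \<comment> \<open>By \<open>excess_ge_b\<close> the total \<open>b\<close>-norm of z is at most (K
    - S) / (M - Lam), and the initial energy keeps this quotient below 1.\<close>
  define \<delta> where "\<delta> = 1 - (K - S) / (M - Lam)"
  have \<delta>: "0 < \<delta>" using energy0 Lam_less by (simp add: \<delta>_def K_def S_def field_simps)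
  define C0 where "C0 = N * (N * (N * (1 / sqrt \<delta>) * (1 + N * sqrt \<kappa> * (N * (1 / sqrt \<delta>) * sqrt K)) / (1 / Lam - 1 / M)))\<^sup>2 + 1"
  have C0: "0 < C0" by (simp add: C0_def N_def add_nonneg_pos)
  define taubar where "taubar = min (1 / (T0.K1 + 1)) (T0.k0 / T0.K3)"
  have taubar: "0 < taubar" using T0.K1_nonneg T0.k0_pos T0.K3_pos by (simp add: taubar_def)
  have tb1: "t * T0.K1 \<le> 1" and tb2: "t * T0.K3 \<le> T0.k0" if "0 < t" "t \<le> taubar" for t
  proof -
    have "t * (T0.K1 + 1) \<le> 1" using that T0.K1_nonneg by (simp add: taubar_def pos_le_divide_eq)
    then show "t * T0.K1 \<le> 1" using that by (simp add: algebra_simps)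
    show "t * T0.K3 \<le> T0.k0" using that T0.K3_pos by (simp add: taubar_def pos_le_divide_eq)
  qed
  have LM: "0 < 1 - Lam / M" using Lam_less M_pos by simp
  show ?thesis
  proof (rule exI[of _ taubar], intro conjI taubar allI impI)
    fix taumin and tau :: "nat \<Rightarrow> real" and u g :: "nat \<Rightarrow> 'n \<Rightarrow> 'v"
    assume tm: "0 < taumin" and tau: "\<forall>n. taumin \<le> tau n \<and> tau n \<le> taubar" and u_0: "u 0 = u0"
      and orth: "\<forall>n i j. b (u n i) (u n j) = (if i = j then 1 else 0)"
      and sol: "\<forall>n i v. a (g n i) v = b (u n i) v"
      and scheme: "\<forall>n k. a (step_defect (tau n) (u n) (g n) (u (Suc n)) k) (step_defect (tau n) (u n) (g n) (u (Suc n)) k) = 0"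
    define F where "F = (\<lambda>n. (\<Sum>k\<in>UNIV. a (u n k) (u n k)) - S)"
    define X where "X = (\<lambda>n i k. b (e i) (u n k))"
    define z where "z = (\<lambda>n k. u n k - (\<Sum>i\<in>UNIV. X n i k *\<^sub>R e i))"
    define \<rho> where "\<rho> = (\<lambda>n. ground_state_tuple.r a b (u n) (g n))"
    have tau_pos: "0 < tau n" for n using tau tm by (meson less_le_trans)
    \<comment> \<open>Everything about one step, conditional on the energy bound; the bound itself
      follows by induction from the decrease contained here.\<close>
    have step: "0 \<le> F n \<and> F n \<le> C0 * (\<rho> n)\<^sup>2 \<and> F (Suc n) \<le> F n - tau n * T0.k0 * (\<rho> n)\<^sup>2 \<and> 0 \<le> \<rho> n \<and>
        (\<forall>k. a.snorm (u (Suc n) k - u n k) \<le> 2 * tau n * \<rho> n) \<and>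
        (\<forall>k. a (z n k) (z n k) \<le> F n / (1 - Lam / M)) \<and>
        (\<forall>j k. \<bar>(\<Sum>i\<in>UNIV. X n i j * X n i k) - (if j = k then 1 else 0)\<bar> \<le> F n / (M - Lam))"
      if FK: "F n \<le> K - S" for n
    proof -
      interpret T: ground_state_tuple a b e l Lam M \<kappa> "u n" "g n" K
        using FK orth sol by unfold_locales (auto simp: F_def)
      have X: "T.X = X n" by (simp add: X_def T.X_def fun_eq_iff)
      have z: "T.z = z n" by (simp add: z_def T.z_def X fun_eq_iff)
      have F: "T.excess = F n" by (simp add: F_def T.excess_def S_def)
      have r: "T.r = \<rho> n" by (simp add: \<rho>_def)
      have bz: "(\<Sum>k\<in>UNIV. b (T.z k) (T.z k)) \<le> F n / (M - Lam)"
        using T.excess_ge_b Lam_less by (simp add: F pos_le_divide_eq mult.commute)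
      also have "\<dots> \<le> 1 - \<delta>" using FK Lam_less by (simp add: \<delta>_def divide_right_mono)
      finally have "T.excess \<le> (C0 - 1) * T.r\<^sup>2"
        using T.gradient_domination[OF \<delta>] by (simp add: C0_def N_def)
      also have "\<dots> \<le> C0 * T.r\<^sup>2" by (intro mult_right_mono) auto
      finally have dom: "F n \<le> C0 * (\<rho> n)\<^sup>2" by (simp add: F r)
      have null: "a (u (Suc n) k - u n k + tau n *\<^sub>R T.L ((1/2) *\<^sub>R (u n k + u (Suc n) k)))
          (u (Suc n) k - u n k + tau n *\<^sub>R T.L ((1/2) *\<^sub>R (u n k + u (Suc n) k))) = 0" for k
        using scheme[rule_format, of n k] by (simp add: step_defect_def Let_def T.L_def)
      note s = T.scheme_step[OF tau_pos tb1 tb2 null, OF tau_pos _ tau_pos]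
      have s1: "F (Suc n) \<le> F n - tau n * T0.k0 * (\<rho> n)\<^sup>2"
        using s(1) tau by (simp add: F_def r)
      have s2: "a.snorm (u (Suc n) k - u n k) \<le> 2 * tau n * \<rho> n" for k
        using s(2)[of k] tau by (simp add: r)
      have az: "a (z n k) (z n k) \<le> F n / (1 - Lam / M)" for k
      proof -
        have "a (z n k) (z n k) \<le> (\<Sum>k\<in>UNIV. a (z n k) (z n k))"
          by (rule member_le_sum) (auto simp: a.nonneg)
        also have "\<dots> \<le> F n / (1 - Lam / M)"
          using T.excess_ge_a LM by (simp add: F z pos_le_divide_eq mult.commute)
        finally show ?thesis .
      qed
      have XX: "\<bar>(\<Sum>i\<in>UNIV. X n i j * X n i k) - (if j = k then 1 else 0)\<bar> \<le> F n / (M - Lam)" for j k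
      proof -
        have bzk: "b (T.z k) (T.z k) \<le> F n / (M - Lam)" for k
          using member_le_sum[of k UNIV "\<lambda>k. b (T.z k) (T.z k)"] bz b.nonneg by auto
        have Fn: "0 \<le> F n / (M - Lam)"
          by (rule order_trans[OF b.nonneg[OF UNIV_I] bzk])
        have "(b (T.z j) (T.z k))\<^sup>2 \<le> b (T.z j) (T.z j) * b (T.z k) (T.z k)"
          by (rule b.Cauchy_Schwarz_square) auto
        also have "\<dots> \<le> (F n / (M - Lam))\<^sup>2"
          unfolding power2_eq_square by (intro mult_mono bzk) (simp_all add: b.nonneg Fn)
        finally have "\<bar>b (T.z j) (T.z k)\<bar> \<le> F n / (M - Lam)"
          by (intro power2_le_imp_le[OF _ Fn]) simp
        then show ?thesis using T.b_u_u[of j k] by (simp add: T.u_orth X)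
      qed
      show ?thesis using T.excess_nonneg dom s1 s2 az XX T.r_nonneg by (simp add: F r)
    qed
    have FK: "F n \<le> K - S" for n
    proof (induction n)
      case (Suc n)
      have "0 \<le> tau n * T0.k0 * (\<rho> n)\<^sup>2" using tau_pos[of n] T0.k0_pos by simp
      then show ?case using step[OF Suc] Suc by linarith
    qed (simp add: F_def u_0 K_def)
    note st = step[OF FK]
    \<comment> \<open>The decrease by tau k0 \<rho>^2 and the domination F \<le> C0 \<rho>^2 combine
      to F (n+1) \<le> (1 - x) F n, uniformly because tau is at least taumin.\<close>
    define x where "x = taumin * T0.k0 / C0"
    have x: "0 < x" using tm T0.k0_pos C0 by (simp add: x_def)
    have F0: "0 \<le> F n" for n using st by blast
    have decay: "F (Suc n) \<le> exp (- x) * F n" for n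
    proof -
      have "x * F n \<le> x * (C0 * (\<rho> n)\<^sup>2)" using st x by (intro mult_left_mono) auto
      also have "\<dots> = taumin * T0.k0 * (\<rho> n)\<^sup>2" using C0 by (simp add: x_def)
      also have "\<dots> \<le> tau n * T0.k0 * (\<rho> n)\<^sup>2"
        using tau T0.k0_pos by (intro mult_right_mono) auto
      finally have "F (Suc n) \<le> (1 + - x) * F n" using st[of n] by (simp add: algebra_simps)
      also have "\<dots> \<le> exp (- x) * F n"
        using F0 exp_ge_add_one_self[of "- x"] by (intro mult_right_mono) auto
      finally show ?thesis .
    qed
    \<comment> \<open>Half of the energy rate, since distances scale like the square root of the
      energy excess.\<close>
    define c where "c = x / 2"
    have c: "0 < c" using x by (simp add: c_def)
    have F_exp: "F n \<le> F 0 * exp (- 2 * c * real n)" for n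
    proof (induction n)
      case (Suc n)
      have "F (Suc n) \<le> exp (- x) * (F 0 * exp (- 2 * c * real n))"
        using decay[of n] Suc by (meson exp_ge_zero mult_left_mono order_trans)
      also have "\<dots> = F 0 * exp (- 2 * c * real (Suc n))"
        by (simp add: c_def algebra_simps flip: exp_add)
      finally show ?case .
    qed simp
    have exp2: "exp (- 2 * c * real n) = (exp (- c * real n))\<^sup>2" for n
      by (simp add: power2_eq_square flip: exp_add)
    \<comment> \<open>The excess stays nonnegative, so tau k0 \<rho>^2 \<le> F n. Hence (2 tau
      \<rho>)^2 = 4 tau (tau \<rho>^2) is at most 4 taubar F n / k0.\<close>
    define Cs where "Cs = sqrt (4 * taubar / T0.k0 * F 0)"
    have inc: "a.snorm (u (Suc n) k - u n k) \<le> Cs * exp (- c * real n)" for n k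
    proof -
      have "tau n * T0.k0 * (\<rho> n)\<^sup>2 \<le> F n" using st[of n] F0[of "Suc n"] by linarith
      then have \<rho>: "tau n * (\<rho> n)\<^sup>2 \<le> F n / T0.k0" using T0.k0_pos by (simp add: field_simps)
      have "(2 * tau n * \<rho> n)\<^sup>2 = 4 * tau n * (tau n * (\<rho> n)\<^sup>2)" by (simp add: power2_eq_square)
      also have "\<dots> \<le> 4 * taubar * (F n / T0.k0)"
        using \<rho> tau tau_pos[of n] taubar by (intro mult_mono) auto
      also have "\<dots> \<le> 4 * taubar * (F 0 * exp (- 2 * c * real n) / T0.k0)"
        using F_exp taubar T0.k0_pos by (intro mult_left_mono divide_right_mono) auto
      also have "\<dots> = (Cs * exp (- c * real n))\<^sup>2"
        using taubar T0.k0_pos F0[of 0] by (simp only: exp2) (simp add: Cs_def power_mult_distrib)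
      finally have "2 * tau n * \<rho> n \<le> Cs * exp (- c * real n)"
        by (rule power2_le_imp_le) (use taubar T0.k0_pos F0 in \<open>simp add: Cs_def\<close>)
      then show ?thesis using st[of n] by (meson order_trans)
    qed
    have X_inc: "\<bar>X (Suc n) i k - X n i k\<bar> \<le> sqrt \<kappa> * Cs * exp (- c * real n)" for n i k
    proof -
      have "\<bar>X (Suc n) i k - X n i k\<bar> = \<bar>b (e i) (u (Suc n) k - u n k)\<bar>"
        by (simp add: X_def b.diff_right)
      also have "\<dots> \<le> b.snorm (u (Suc n) k - u n k)"
        using b.Cauchy_Schwarz[of "e i" "u (Suc n) k - u n k"] by (simp add: T0.b_snorm_e)
      also have "\<dots> \<le> sqrt \<kappa> * (Cs * exp (- c * real n))"
        using b_snorm_le[of "u (Suc n) k - u n k"] inc[of n k] \<kappa>_pos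
        by (meson mult_left_mono order_trans real_sqrt_ge_zero less_imp_le)
      finally show ?thesis by (simp add: mult.assoc)
    qed
    define Cq where "Cq = sqrt \<kappa> * Cs / (1 - exp (- c))"
    have "\<exists>q. \<forall>n. \<bar>X n i k - q\<bar> \<le> Cq * exp (- c * real n)" for i k
      unfolding Cq_def by (rule exp_increments_limit[OF c]) (rule X_inc)
    then obtain Q where Q: "\<And>n i k. \<bar>X n i k - Q i k\<bar> \<le> Cq * exp (- c * real n)"
      by metis
    have exp0: "(\<lambda>n. exp (- c * real n)) \<longlonglongrightarrow> 0"
    proof -
      have "(\<lambda>n. (exp (- c)) ^ n) \<longlonglongrightarrow> 0" using c by (intro LIMSEQ_power_zero) auto
      then show ?thesis by (simp add: exp_of_nat_mult[symmetric] mult.commute)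
    qed
    have X_lim: "(\<lambda>n. X n i k) \<longlonglongrightarrow> Q i k" for i k
    proof (rule LIM_zero_cancel, rule Lim_null_comparison)
      show "\<forall>\<^sub>F n in sequentially. norm (X n i k - Q i k) \<le> Cq * exp (- c * real n)"
        using Q by simp
      show "(\<lambda>n. Cq * exp (- c * real n)) \<longlonglongrightarrow> 0"
        using tendsto_mult_left[OF exp0, of Cq] by simp
    qed
    have F_lim: "F \<longlonglongrightarrow> 0"
    proof (rule Lim_null_comparison)
      show "\<forall>\<^sub>F n in sequentially. norm (F n) \<le> F 0 * (exp (- c * real n))\<^sup>2"
        using F_exp F0 by (simp only: exp2[symmetric] real_norm_def abs_of_nonneg eventually_True simp_thms)
      show "(\<lambda>n. F 0 * (exp (- c * real n))\<^sup>2) \<longlonglongrightarrow> 0"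
        using tendsto_mult_left[OF tendsto_power[OF exp0, of 2], of "F 0"] by simp
    qed
    \<comment> \<open>The deviation of X^T X from the identity is, up to sign, the
      \<open>b\<close>-Gram matrix of z, whose entries are bounded by F / (M - Lam).\<close>
    have orthQ: "(\<Sum>k\<in>UNIV. Q k i * Q k j) = (if i = j then 1 else 0)" for i j
    proof (rule LIMSEQ_unique)
      show "(\<lambda>n. \<Sum>k\<in>UNIV. X n k i * X n k j) \<longlonglongrightarrow> (\<Sum>k\<in>UNIV. Q k i * Q k j)"
        by (intro tendsto_intros X_lim)
      show "(\<lambda>n. \<Sum>k\<in>UNIV. X n k i * X n k j) \<longlonglongrightarrow> (if i = j then 1 else 0)"
      proof (rule LIM_zero_cancel, rule Lim_null_comparison)
        show "\<forall>\<^sub>F n in sequentially. norm ((\<Sum>k\<in>UNIV. X n k i * X n k j) - (if i = j then 1 else 0)) \<le> F n / (M - Lam)"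
          using st by simp
        show "(\<lambda>n. F n / (M - Lam)) \<longlonglongrightarrow> 0"
          using tendsto_divide[OF F_lim tendsto_const, of "M - Lam"] Lam_less by simp
      qed
    qed
    \<comment> \<open>The first summand controls the part z outside the ground space; the second
      controls the N coefficients X - Q, each multiplying some e of \<open>a\<close>-norm at most
      sqrt Lam.\<close>
    define Ck where "Ck = sqrt (F 0 / (1 - Lam / M)) + N * (Cq * sqrt Lam)"
    have Cq: "0 \<le> Cq" using Q[of 0] by (simp) (metis abs_ge_zero order_trans)
    have dist: "a.snorm (u n k - (\<Sum>i\<in>UNIV. Q i k *\<^sub>R e i)) \<le> Ck * exp (- c * real n)" for n k
    proof -
      have "u n k - (\<Sum>i\<in>UNIV. Q i k *\<^sub>R e i) = z n k + (\<Sum>i\<in>UNIV. (X n i k - Q i k) *\<^sub>R e i)"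
        by (simp add: z_def scaleR_diff_left sum_subtractf)
      then have "a.snorm (u n k - (\<Sum>i\<in>UNIV. Q i k *\<^sub>R e i)) \<le> a.snorm (z n k) + (\<Sum>i\<in>UNIV. \<bar>X n i k - Q i k\<bar> * a.snorm (e i))"
        using a.snorm_triangle[of "z n k" "\<Sum>i\<in>UNIV. (X n i k - Q i k) *\<^sub>R e i"]
          a.snorm_sum[of UNIV "\<lambda>i. (X n i k - Q i k) *\<^sub>R e i"]
        by (simp add: a.snorm_scale)
      also have "(\<Sum>i\<in>UNIV. \<bar>X n i k - Q i k\<bar> * a.snorm (e i)) \<le> N * ((Cq * exp (- c * real n)) * sqrt Lam)"
        unfolding N_def
      proof (intro sum_le_card_mult mult_mono Q)
        show "a.snorm (e i) \<le> sqrt Lam" for i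
          using l_le by (simp add: a.snorm_def e_eigen e_orth)
      qed (use Cq in auto)
      also have "a.snorm (z n k) \<le> sqrt (F 0 / (1 - Lam / M)) * exp (- c * real n)"
      proof -
        have "a.snorm (z n k) \<le> sqrt (F n / (1 - Lam / M))"
          using st[of n] unfolding a.snorm_def by (meson real_sqrt_le_mono)
        also have "\<dots> \<le> sqrt (F 0 * exp (- 2 * c * real n) / (1 - Lam / M))"
          using F_exp LM by (intro real_sqrt_le_mono divide_right_mono) auto
        also have "\<dots> = sqrt (F 0 / (1 - Lam / M) * (exp (- c * real n))\<^sup>2)"
          by (simp only: exp2) simp
        finally show ?thesis by (simp only: real_sqrt_mult) simp
      qed
      finally show ?thesis by (simp add: Ck_def algebra_simps)
    qed
    define C where "C = max (F 0) (N * Ck) + 1"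
    have C: "0 < C" using F0[of 0] by (simp add: C_def)
    have "F n \<le> C * exp (- 2 * c * real n)" for n
    proof -
      have "F 0 * exp (- 2 * c * real n) \<le> C * exp (- 2 * c * real n)"
        by (intro mult_right_mono) (auto simp: C_def)
      then show ?thesis using F_exp[of n] by linarith
    qed
    moreover have "sqrt (\<Sum>k\<in>UNIV. a (u n k - (\<Sum>i\<in>UNIV. Q i k *\<^sub>R e i)) (u n k - (\<Sum>i\<in>UNIV. Q i k *\<^sub>R e i))) \<le> C * exp (- c * real n)" for n
    proof -
      have "sqrt (\<Sum>k\<in>UNIV. a (u n k - (\<Sum>i\<in>UNIV. Q i k *\<^sub>R e i)) (u n k - (\<Sum>i\<in>UNIV. Q i k *\<^sub>R e i)))
          = L2_set (\<lambda>k. a.snorm (u n k - (\<Sum>i\<in>UNIV. Q i k *\<^sub>R e i))) UNIV"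
        by (simp add: L2_set_def a.snorm_square)
      also have "\<dots> \<le> (\<Sum>k\<in>UNIV. a.snorm (u n k - (\<Sum>i\<in>UNIV. Q i k *\<^sub>R e i)))"
        by (rule L2_set_le_sum) simp
      also have "\<dots> \<le> N * (Ck * exp (- c * real n))"
        unfolding N_def by (rule sum_le_card_mult) (rule dist)
      also have "\<dots> \<le> C * exp (- c * real n)"
        unfolding mult.assoc[symmetric] by (intro mult_right_mono) (auto simp: C_def)
      finally show ?thesis .
    qed
    ultimately show "exp_convergent u"
      using C c orthQ unfolding F_def S_def exp_convergent_def by blast
  qed
qed

end

subsection \<open>Riesz representation and minimisers of the Rayleigh quotient\<close>

text \<open>The first-order condition at a minimum: for small t of the right sign the linear term
  would win.\<close>

lemma quadratic_nonneg_imp_linear_zero: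
  fixes x y :: real
  assumes "\<And>t. 0 \<le> 2 * t * x + t\<^sup>2 * y"
  shows "x = 0"
proof (rule ccontr)
  assume "x \<noteq> 0"
  define c where "c = \<bar>y\<bar> + 1"
  have c: "0 < c" "y < c" by (auto simp: c_def)
  have "0 \<le> 2 * (- x / c) * x + (- x / c)\<^sup>2 * y" by (rule assms)
  also have "\<dots> = (x\<^sup>2 / c) * (y / c - 2)"
    using c by (simp add: field_simps power2_eq_square)
  also have "\<dots> < 0"
    using c \<open>x \<noteq> 0\<close> by (intro mult_pos_neg) (auto simp: pos_divide_less_eq)
  finally show False by simp
qed

lemma finite_family_convergent_subseq:
  fixes x :: "nat \<Rightarrow> nat \<Rightarrow> real"
  assumes "\<And>j. j < m \<Longrightarrow> bounded (range (x j))"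
  shows "\<exists>r. strict_mono (r :: nat \<Rightarrow> nat) \<and> (\<forall>j<m. convergent (x j \<circ> r))"
  using assms
proof (induction m)
  case 0
  show ?case by (auto intro: exI[of _ id] strict_mono_id)
next
  case (Suc m)
  have "\<exists>r. strict_mono (r :: nat \<Rightarrow> nat) \<and> (\<forall>j<m. convergent (x j \<circ> r))"
    using Suc.prems by (intro Suc.IH) simp
  then obtain r where r: "strict_mono r" "\<forall>j<m. convergent (x j \<circ> r)" by blast
  have "bounded (range (x m \<circ> r))"
    using Suc.prems[of m] by (rule bounded_subset) auto
  then obtain l s where s: "strict_mono s" "((x m \<circ> r) \<circ> s) \<longlonglongrightarrow> l"
    using bounded_imp_convergent_subsequence by blast
  have "convergent (x j \<circ> (r \<circ> s))" if "j < Suc m" for j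
  proof (cases "j = m")
    case True
    then show ?thesis using s by (auto simp: convergent_def o_assoc)
  next
    case False
    then have "convergent (x j \<circ> r)" using r that by simp
    then show ?thesis using convergent_subseq_convergent s(1) by (metis o_assoc)
  qed
  then show ?case using strict_mono_o[OF r(1) s(1)] by blast
qed

locale complete_form = psd_form a for a :: "'v::real_vector \<Rightarrow> 'v \<Rightarrow> real" +
  assumes complete: "(\<And>\<epsilon>. 0 < \<epsilon> \<Longrightarrow> \<exists>N. \<forall>m\<ge>N. \<forall>n\<ge>N. a (u m - u n) (u m - u n) < \<epsilon>) \<Longrightarrow>
    \<exists>w. (\<lambda>n. a (u n - w) (u n - w)) \<longlonglongrightarrow> 0"
begin

lemma Cauchy_criterion:
  assumes "\<And>m n. a (u m - u n) (u m - u n) \<le> s m n"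
    and "\<And>\<epsilon>. 0 < \<epsilon> \<Longrightarrow> \<exists>N. \<forall>m\<ge>N. \<forall>n\<ge>N. s m n < (\<epsilon>::real)"
  obtains w where "(\<lambda>n. a (u n - w) (u n - w)) \<longlonglongrightarrow> 0"
  using complete[of u] assms by (meson order_le_less_trans)

text \<open>The representer minimises a(v,v) - 2 F(v). A minimising sequence is Cauchy by the
  parallelogram identity, so completeness in the seminorm is enough.\<close>

lemma Riesz_representation:
  fixes F :: "'v \<Rightarrow> real"
  assumes lin: "linear F" and bdd: "\<And>v. \<bar>F v\<bar> \<le> K * snorm v"
  shows "\<exists>w. \<forall>v. a w v = F v"
proof -
  define J where "J = (\<lambda>v. a v v - 2 * F v)"
  have J_ge: "- (K\<^sup>2) \<le> J v" for v
  proof -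
    have "2 * F v \<le> 2 * (K * snorm v)" using bdd[of v] by simp
    also have "\<dots> \<le> K\<^sup>2 + (snorm v)\<^sup>2"
      using sum_squares_bound[of K "snorm v"] by simp
    finally show ?thesis by (simp add: J_def snorm_square)
  qed
  define I where "I = Inf (range J)"
  have bb: "bdd_below (range J)" using J_ge by (intro bdd_belowI2)
  have I_le: "I \<le> J v" for v unfolding I_def by (rule cInf_lower) (auto simp: bb)
  have "\<exists>v. J v < I + 1 / real (Suc n)" for n
    using cInf_lessD[of "range J" "I + 1 / real (Suc n)"] by (auto simp: I_def)
  then obtain v where v: "\<And>n. J (v n) < I + 1 / real (Suc n)" by metis
  have "a (v m - v n) (v m - v n) \<le> 2 / real (Suc m) + 2 / real (Suc n)" for m n
  proof -
    have "J ((1/2) *\<^sub>R (v m + v n)) = a (v m + v n) (v m + v n) / 4 - F (v m) - F (v n)"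
      by (simp add: J_def bilinear_simps linear_add[OF lin] linear_scale[OF lin] field_simps)
    then have "a (v m - v n) (v m - v n) = 2 * J (v m) + 2 * J (v n) - 4 * J ((1/2) *\<^sub>R (v m + v n))"
      by (simp add: parallelogram J_def)
    then show ?thesis using v[of m] v[of n] I_le[of "(1/2) *\<^sub>R (v m + v n)"] by simp
  qed
  moreover have "\<exists>N. \<forall>m\<ge>N. \<forall>n\<ge>N. 2 / real (Suc m) + 2 / real (Suc n) < \<epsilon>" if "0 < \<epsilon>" for \<epsilon>
  proof -
    have "(\<lambda>n. 2 * inverse (real (Suc n))) \<longlonglongrightarrow> 2 * 0"
      by (intro tendsto_intros LIMSEQ_inverse_real_of_nat)
    then have "\<forall>\<^sub>F n in sequentially. 2 / real (Suc n) < \<epsilon> / 2"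
      unfolding divide_inverse[of 2] by (rule order_tendstoD(2)) (use that in simp)
    then obtain N where "\<And>n. n \<ge> N \<Longrightarrow> 2 / real (Suc n) < \<epsilon> / 2"
      unfolding eventually_sequentially by blast
    then have "2 / real (Suc m) + 2 / real (Suc n) < \<epsilon>" if "N \<le> m" "N \<le> n" for m n
      using add_strict_mono[of "2 / real (Suc m)" "\<epsilon> / 2" "2 / real (Suc n)" "\<epsilon> / 2"] that by simp
    then show ?thesis by blast
  qed
  ultimately obtain w where w: "(\<lambda>n. a (v n - w) (v n - w)) \<longlonglongrightarrow> 0"
    by (rule Cauchy_criterion)
  have "a w y = F y" for y
  proof -
    \<comment> \<open>The comparison with the infimum is made along the minimising sequence, with
      error 1 / (n+1), and then passed to the limit.\<close>
    have "0 \<le> 2 * t * (a w y - F y) + t\<^sup>2 * a y y" for t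
    proof (rule LIMSEQ_le_const)
      have "(\<lambda>n. 2 * t * (a (v n) y - F y) + t\<^sup>2 * a y y + inverse (real (Suc n))) \<longlonglongrightarrow> 2 * t * (a w y - F y) + t\<^sup>2 * a y y + 0"
        by (intro tendsto_intros tendsto_left[OF _ _ _ w] LIMSEQ_inverse_real_of_nat) auto
      then show "(\<lambda>n. 2 * t * (a (v n) y - F y) + t\<^sup>2 * a y y + inverse (real (Suc n))) \<longlonglongrightarrow> 2 * t * (a w y - F y) + t\<^sup>2 * a y y"
        by simp
      have "0 \<le> 2 * t * (a (v n) y - F y) + t\<^sup>2 * a y y + inverse (real (Suc n))" for n
      proof -
        have "J (v n + t *\<^sub>R y) = J (v n) + 2 * t * (a (v n) y - F y) + t\<^sup>2 * a y y"
          by (simp add: J_def bilinear_simps sym[of y "v n"] linear_add[OF lin] linear_scale[OF lin]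
              power2_eq_square algebra_simps)
        then show ?thesis using I_le[of "v n + t *\<^sub>R y"] v[of n] by (simp add: inverse_eq_divide)
      qed
      then show "\<exists>N. \<forall>n\<ge>N. 0 \<le> 2 * t * (a (v n) y - F y) + t\<^sup>2 * a y y + inverse (real (Suc n))"
        by blast
    qed
    then have "a w y - F y = 0" by (rule quadratic_nonneg_imp_linear_zero)
    then show ?thesis by simp
  qed
  then show ?thesis by blast
qed

end

text \<open>The last assumption is a finite-rank form of the compactness of the embedding.\<close>

locale compact_pair = a: complete_form a + b: psd_form b
  for a b :: "'v::real_vector \<Rightarrow> 'v \<Rightarrow> real" +
  fixes \<kappa> :: real
  assumes \<kappa>_pos: "0 < \<kappa>" and b_le_a: "b v v \<le> \<kappa> * a v v"
    and compact: "0 < \<epsilon> \<Longrightarrow> \<exists>(m::nat) f. (\<forall>j<m. (\<forall>u v. f j (u - v) = f j u - f j v) \<and>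
      (\<exists>K. \<forall>v. \<bar>f j v\<bar> \<le> K * a.snorm v)) \<and> (\<forall>v. b v v \<le> \<epsilon> * a v v + (\<Sum>j<m. (f j v)\<^sup>2))"
begin

lemma solution_exists: "\<exists>w. \<forall>v. a w v = b u v"
proof (rule a.Riesz_representation)
  show "linear (b u)" by (rule linearI) (simp_all add: b.bilinear_simps)
  show "\<bar>b u v\<bar> \<le> (b.snorm u * sqrt \<kappa>) * a.snorm v" for v
  proof -
    have "b.snorm v \<le> sqrt \<kappa> * a.snorm v"
      using real_sqrt_le_mono[OF b_le_a[of v]] by (simp add: a.snorm_def b.snorm_def real_sqrt_mult)
    then have "b.snorm u * b.snorm v \<le> b.snorm u * (sqrt \<kappa> * a.snorm v)"
      by (intro mult_left_mono) auto
    then show ?thesis using b.Cauchy_Schwarz[of u v] by (simp add: mult.assoc)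
  qed
qed

lemma tendsto_b_null:
  assumes "(\<lambda>n. a (y n - w) (y n - w)) \<longlonglongrightarrow> 0"
  shows "(\<lambda>n. b (y n - w) (y n - w)) \<longlonglongrightarrow> 0"
proof (rule Lim_null_comparison)
  show "\<forall>\<^sub>F n in sequentially. norm (b (y n - w) (y n - w)) \<le> \<kappa> * a (y n - w) (y n - w)"
    using b_le_a by (simp add: b.nonneg)
  show "(\<lambda>n. \<kappa> * a (y n - w) (y n - w)) \<longlonglongrightarrow> 0"
    using tendsto_mult_left[OF assms, of \<kappa>] by simp
qed

lemma tendsto_b: "(\<lambda>n. a (y n - w) (y n - w)) \<longlonglongrightarrow> 0 \<Longrightarrow> (\<lambda>n. b (y n) v) \<longlonglongrightarrow> b w v"
  by (intro b.tendsto_left tendsto_b_null) auto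

text \<open>The given z makes the infimum of the Rayleigh quotient over the
  \<open>b\<close>-orthogonal complement of the e smaller than M, and compactness makes it attained.
  The minimiser satisfies the eigenvalue equation on the complement, hence everywhere, because it is
  orthogonal to the e in both forms.\<close>

lemma orthogonal_eigenvector:
  fixes e :: "'n::finite \<Rightarrow> 'v" and l :: "'n \<Rightarrow> real"
  assumes e_orth: "\<And>i j. b (e i) (e j) = (if i = j then 1 else 0)"
    and e_eigen: "\<And>i v. a (e i) v = l i * b (e i) v"
    and z: "\<And>i. b (e i) z = 0" "a z z < M * b z z"
  shows "\<exists>\<mu> w. \<mu> < M \<and> 0 < b w w \<and> (\<forall>i. b (e i) w = 0) \<and> (\<forall>v. a w v = \<mu> * b w v)"
proof -
  define Z where "Z = {y. \<forall>i. b (e i) y = 0}"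
  have Z_add: "x + y \<in> Z" if "x \<in> Z" "y \<in> Z" for x y
    using that by (auto simp: Z_def b.bilinear_simps)
  have Z_scale: "c *\<^sub>R x \<in> Z" if "x \<in> Z" for x c
    using that by (auto simp: Z_def b.bilinear_simps)
  define A where "A = (\<lambda>y. a y y) ` {y \<in> Z. b y y = 1}"
  define \<mu> where "\<mu> = Inf A"
  have A_ge: "1 / \<kappa> \<le> x" if x: "x \<in> A" for x
  proof -
    obtain y where "b y y = 1" "x = a y y" using x by (auto simp: A_def)
    then show ?thesis using b_le_a[of y] \<kappa>_pos by (simp add: pos_divide_le_eq mult.commute)
  qed
  then have bb: "bdd_below A" by (rule bdd_belowI)
  have bz: "0 < b z z"
  proof (rule ccontr)
    assume "\<not> 0 < b z z"
    then have "b z z = 0" using b.nonneg[of z] by simp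
    then show False using z(2) a.nonneg[of z] by simp
  qed
  define z1 where "z1 = (1 / sqrt (b z z)) *\<^sub>R z"
  have norm1: "b ((1 / sqrt (b y y)) *\<^sub>R y) ((1 / sqrt (b y y)) *\<^sub>R y) = 1"
    and norm2: "a ((1 / sqrt (b y y)) *\<^sub>R y) ((1 / sqrt (b y y)) *\<^sub>R y) = a y y / b y y" if "0 < b y y" for y
    using that by (simp_all add: a.bilinear_simps b.bilinear_simps)
  have z_Z: "z \<in> Z" using z by (simp add: Z_def)
  have A_z: "a z z / b z z \<in> A"
    using norm1[OF bz] norm2[OF bz] Z_scale[OF z_Z] by (force simp: A_def)
  then have A_ne: "A \<noteq> {}" by auto
  have \<mu>_M: "\<mu> < M"
    using cInf_lower[OF A_z bb] z(2) bz unfolding \<mu>_def by (simp add: pos_divide_less_eq order_le_less_trans)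
  have "1 / \<kappa> \<le> \<mu>" unfolding \<mu>_def by (rule cInf_greatest[OF A_ne A_ge])
  then have \<mu>: "0 < \<mu>" using \<kappa>_pos by (meson less_le_trans zero_less_divide_1_iff)
  have \<mu>_le: "\<mu> * b y y \<le> a y y" if "y \<in> Z" for y
  proof (cases "b y y = 0")
    case False
    then have p: "0 < b y y" using b.nonneg[of y] by simp
    then have "a y y / b y y \<in> A"
      using norm1[OF p] norm2[OF p] Z_scale[OF that] by (force simp: A_def)
    then have "\<mu> \<le> a y y / b y y" unfolding \<mu>_def using bb by (rule cInf_lower)
    then show ?thesis using p by (simp add: pos_le_divide_eq)
  qed (simp add: a.nonneg)
  have "\<exists>y. y \<in> Z \<and> b y y = 1 \<and> a y y < \<mu> + 1 / real (Suc n)" for n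
    using cInf_lessD[OF A_ne, of "\<mu> + 1 / real (Suc n)"] by (auto simp: \<mu>_def A_def)
  then obtain x where x: "\<And>n. x n \<in> Z" "\<And>n. b (x n) (x n) = 1" "\<And>n. a (x n) (x n) < \<mu> + 1 / real (Suc n)"
    by metis
  \<comment> \<open>With this \<epsilon>, \<mu> times the compactness estimate contains half of the
    \<open>a\<close>-norm, which can be absorbed on the left.\<close>
  have "0 < 1 / (2 * \<mu>)" using \<mu> by simp
  from compact[OF this] obtain m :: nat and f where
    f: "\<forall>j<m. (\<forall>u v. f j (u - v) = f j u - f j v) \<and> (\<exists>K. \<forall>v. \<bar>f j v\<bar> \<le> K * a.snorm v)"
    and b_le': "\<forall>v. b v v \<le> 1 / (2 * \<mu>) * a v v + (\<Sum>j<m. (f j v)\<^sup>2)"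
    by blast
  from f have f_diff: "\<And>j u v. j < m \<Longrightarrow> f j (u - v) = f j u - f j v"
    and f_bdd: "\<And>j. j < m \<Longrightarrow> \<exists>K. \<forall>v. \<bar>f j v\<bar> \<le> K * a.snorm v" by blast+
  note b_le = b_le'[rule_format]
  have "bounded (range (\<lambda>n. f j (x n)))" if j: "j < m" for j
  proof -
    obtain K where K: "\<And>v. \<bar>f j v\<bar> \<le> K * a.snorm v" using f_bdd[OF j] by auto
    have "\<bar>f j (x n)\<bar> \<le> \<bar>K\<bar> * sqrt (\<mu> + 1)" for n
    proof -
      have "a (x n) (x n) \<le> \<mu> + 1" proof -
        have "1 / real (Suc n) \<le> 1" by simp
        then show ?thesis using x(3)[of n] by linarith
      qed
      then have "a.snorm (x n) \<le> sqrt (\<mu> + 1)" by (simp add: a.snorm_def)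
      then have "\<bar>K\<bar> * a.snorm (x n) \<le> \<bar>K\<bar> * sqrt (\<mu> + 1)" by (intro mult_left_mono) auto
      moreover have "K * a.snorm (x n) \<le> \<bar>K\<bar> * a.snorm (x n)" by (intro mult_right_mono) auto
      ultimately show ?thesis using K[of "x n"] by linarith
    qed
    then show ?thesis by (intro boundedI) auto
  qed
  then obtain r where r: "strict_mono r" "\<And>j. j < m \<Longrightarrow> convergent ((\<lambda>n. f j (x n)) \<circ> r)"
    using finite_family_convergent_subseq[of m "\<lambda>j n. f j (x n)"] by blast
  define y where "y = x \<circ> r"
  have y: "y n \<in> Z" "b (y n) (y n) = 1" "a (y n) (y n) < \<mu> + 1 / real (Suc n)" for n
  proof -
    have "1 / real (Suc (r n)) \<le> 1 / real (Suc n)"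
      using seq_suble[OF r(1), of n] by (intro divide_left_mono) auto
    then show "a (y n) (y n) < \<mu> + 1 / real (Suc n)" using x(3)[of "r n"] by (simp add: y_def)
  qed (auto simp: y_def x)
  define s where "s = (\<lambda>p q. 4 / real (Suc p) + 4 / real (Suc q) + 2 * \<mu> * (\<Sum>j<m. (f j (y p) - f j (y q))\<^sup>2))"
  have a_s: "a (y p - y q) (y p - y q) \<le> s p q" for p q
  proof -
    have "\<mu> * b (y p + y q) (y p + y q) \<le> a (y p + y q) (y p + y q)"
      by (intro \<mu>_le Z_add y)
    moreover have "b (y p + y q) (y p + y q) = 4 - b (y p - y q) (y p - y q)"
      using b.parallelogram[of "y p" "y q"] y by simp
    moreover have "a (y p - y q) (y p - y q) = 2 * a (y p) (y p) + 2 * a (y q) (y q) - a (y p + y q) (y p + y q)"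
      by (rule a.parallelogram) auto
    \<comment> \<open>Since \<open>y p + y q\<close> lies in \<open>Z\<close>, minimality bounds its
      \<open>a\<close>-norm from below; the parallelogram identities of both forms turn this into a
      bound for the difference.\<close>
    ultimately have 1: "a (y p - y q) (y p - y q) \<le> 2 / real (Suc p) + 2 / real (Suc q) + \<mu> * b (y p - y q) (y p - y q)"
      using y(3)[of p] y(3)[of q] by (simp add: right_diff_distrib)
    have "\<mu> * b (y p - y q) (y p - y q) \<le> \<mu> * (1 / (2 * \<mu>) * a (y p - y q) (y p - y q) + (\<Sum>j<m. (f j (y p - y q))\<^sup>2))"
      using \<mu> by (intro mult_left_mono b_le) auto
    also have "\<dots> = a (y p - y q) (y p - y q) / 2 + \<mu> * (\<Sum>j<m. (f j (y p) - f j (y q))\<^sup>2)"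
      using \<mu> by (simp add: f_diff distrib_left)
    finally show ?thesis using 1 by (simp add: s_def)
  qed
  have s_small: "\<exists>N. \<forall>p\<ge>N. \<forall>q\<ge>N. s p q < \<epsilon>" if "0 < \<epsilon>" for \<epsilon>
  proof -
    define g where "g = (\<lambda>j. lim ((\<lambda>n. f j (x n)) \<circ> r))"
    have g: "(\<lambda>n. f j (y n)) \<longlonglongrightarrow> g j" if "j < m" for j
      using r(2)[OF that] by (simp add: g_def convergent_LIMSEQ_iff y_def o_def)
    \<comment> \<open>Inserting the limits \<open>g j\<close> splits the bound into a term in p and
      a term in q, each tending to 0.\<close>
    define h where "h = (\<lambda>n. 4 * inverse (real (Suc n)) + 4 * \<mu> * (\<Sum>j<m. (f j (y n) - g j)\<^sup>2))"
    have "h \<longlonglongrightarrow> 4 * 0 + 4 * \<mu> * (\<Sum>j<m. (g j - g j)\<^sup>2)"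
      unfolding h_def by (intro tendsto_intros LIMSEQ_inverse_real_of_nat g) auto
    then have "\<forall>\<^sub>F n in sequentially. h n < \<epsilon> / 2"
      by (rule order_tendstoD(2)) (use that in simp)
    then obtain N where N: "\<And>n. n \<ge> N \<Longrightarrow> h n < \<epsilon> / 2"
      unfolding eventually_sequentially by blast
    have s_h: "s p q \<le> h p + h q" for p q
    proof -
      have "(f j (y p) - f j (y q))\<^sup>2 \<le> 2 * (f j (y p) - g j)\<^sup>2 + 2 * (f j (y q) - g j)\<^sup>2" for j
        using sum_squares_bound[of "f j (y p) - g j" "- (f j (y q) - g j)"]
        by (simp add: power2_eq_square algebra_simps)
      then have "(\<Sum>j<m. (f j (y p) - f j (y q))\<^sup>2) \<le> 2 * (\<Sum>j<m. (f j (y p) - g j)\<^sup>2) + 2 * (\<Sum>j<m. (f j (y q) - g j)\<^sup>2)"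
        by (simp add: sum_distrib_left sum_mono flip: sum.distrib)
      then have "2 * \<mu> * (\<Sum>j<m. (f j (y p) - f j (y q))\<^sup>2) \<le> 2 * \<mu> * (2 * (\<Sum>j<m. (f j (y p) - g j)\<^sup>2) + 2 * (\<Sum>j<m. (f j (y q) - g j)\<^sup>2))"
        using \<mu> by (intro mult_left_mono) auto
      then show ?thesis by (simp add: s_def h_def divide_inverse distrib_left)
    qed
    have "s p q < \<epsilon>" if "N \<le> p" "N \<le> q" for p q
      using order_le_less_trans[OF s_h add_strict_mono[OF N[OF that(1)] N[OF that(2)]]] by simp
    then show ?thesis by blast
  qed
  obtain w where w: "(\<lambda>n. a (y n - w) (y n - w)) \<longlonglongrightarrow> 0"
    using a.Cauchy_criterion[OF a_s s_small] by blast
  have w_Z: "b (e i) w = 0" for i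
  proof -
    have "b (y n) (e i) = 0" for n using y(1)[of n] b.sym[of "y n" "e i"] by (simp add: Z_def)
    then have "(\<lambda>n. b (y n) (e i)) \<longlonglongrightarrow> 0" by simp
    then have "b w (e i) = 0" using LIMSEQ_unique tendsto_b[OF w] by blast
    then show ?thesis using b.sym by simp
  qed
  have bw: "b w w = 1"
  proof (rule LIMSEQ_unique)
    have "b (y n - w) (y n - w) = 1 - 2 * b (y n) w + b w w" for n
      using y(2)[of n] by (simp add: b.bilinear_simps b.sym[of w "y n"])
    then have "(\<lambda>n. b (y n - w) (y n - w)) \<longlonglongrightarrow> 1 - 2 * b w w + b w w"
      by (simp only:) (intro tendsto_intros tendsto_b[OF w])
    then have "1 - 2 * b w w + b w w = 0"
      using LIMSEQ_unique tendsto_b_null[OF w] by blast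
    then have "b w w = 1" by simp
    then show "(\<lambda>n. 1::real) \<longlonglongrightarrow> b w w" by simp
  qed simp
  have eq_Z: "a w v = \<mu> * b w v" if v: "v \<in> Z" for v
  proof -
    have "0 \<le> 2 * t * (a w v - \<mu> * b w v) + t\<^sup>2 * (a v v - \<mu> * b v v)" for t
    proof (rule LIMSEQ_le_const)
      have "(\<lambda>n. 2 * t * (a (y n) v - \<mu> * b (y n) v) + t\<^sup>2 * (a v v - \<mu> * b v v) + inverse (real (Suc n)))
          \<longlonglongrightarrow> 2 * t * (a w v - \<mu> * b w v) + t\<^sup>2 * (a v v - \<mu> * b v v) + 0"
        by (intro tendsto_intros a.tendsto_left[OF _ _ _ w] tendsto_b[OF w] LIMSEQ_inverse_real_of_nat) auto
      then show "(\<lambda>n. 2 * t * (a (y n) v - \<mu> * b (y n) v) + t\<^sup>2 * (a v v - \<mu> * b v v) + inverse (real (Suc n)))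
          \<longlonglongrightarrow> 2 * t * (a w v - \<mu> * b w v) + t\<^sup>2 * (a v v - \<mu> * b v v)" by simp
      have "0 \<le> 2 * t * (a (y n) v - \<mu> * b (y n) v) + t\<^sup>2 * (a v v - \<mu> * b v v) + inverse (real (Suc n))" for n
      proof -
        have "\<mu> * b (y n + t *\<^sub>R v) (y n + t *\<^sub>R v) \<le> a (y n + t *\<^sub>R v) (y n + t *\<^sub>R v)"
          by (intro \<mu>_le Z_add Z_scale y v)
        then show ?thesis using y(2,3)[of n]
          by (simp add: a.bilinear_simps b.bilinear_simps a.sym[of v "y n"] b.sym[of v "y n"]
              power2_eq_square inverse_eq_divide algebra_simps)
      qed
      then show "\<exists>N. \<forall>n\<ge>N. 0 \<le> 2 * t * (a (y n) v - \<mu> * b (y n) v) + t\<^sup>2 * (a v v - \<mu> * b v v) + inverse (real (Suc n))"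
        by blast
    qed
    then have "a w v - \<mu> * b w v = 0" by (rule quadratic_nonneg_imp_linear_zero)
    then show ?thesis by simp
  qed
  have "a w v = \<mu> * b w v" for v
  proof -
    define v' where "v' = v - (\<Sum>i\<in>UNIV. b (e i) v *\<^sub>R e i)"
    have v: "v = v' + (\<Sum>i\<in>UNIV. b (e i) v *\<^sub>R e i)" by (simp add: v'_def)
    have "v' \<in> Z" by (simp add: Z_def v'_def b.bilinear_simps e_orth mult_delta_right)
    moreover have "a w (e i) = 0" "b w (e i) = 0" for i
      using a.sym[of w "e i"] b.sym[of w "e i"] by (simp_all add: e_eigen w_Z)
    ultimately show ?thesis
      by (subst (1 2) v) (simp add: a.bilinear_simps b.bilinear_simps eq_Z)
  qed
  then show ?thesis using \<mu>_M bw w_Z by (intro exI[of _ \<mu>] exI[of _ w]) auto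
qed

end

subsection \<open>The space of square integrable functions\<close>

lemma integrable_L2_inner:
  assumes "u \<in> L2 \<Omega>" "v \<in> L2 \<Omega>"
  shows "integrable (lebesgue_on \<Omega>) (\<lambda>x. u x \<bullet> v x)"
proof (rule Bochner_Integration.integrable_bound)
  show "integrable (lebesgue_on \<Omega>) (\<lambda>x. (norm (u x))\<^sup>2 + (norm (v x))\<^sup>2)"
    using assms by (auto simp: L2_def)
  show "(\<lambda>x. u x \<bullet> v x) \<in> borel_measurable (lebesgue_on \<Omega>)"
    using assms by (auto simp: L2_def intro: borel_measurable_inner)
  have "\<bar>u x \<bullet> v x\<bar> \<le> (norm (u x))\<^sup>2 + (norm (v x))\<^sup>2" for x
  proof -
    have "\<bar>u x \<bullet> v x\<bar> \<le> norm (u x) * norm (v x)" by (rule Cauchy_Schwarz_ineq2)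
    also have "\<dots> \<le> (norm (u x))\<^sup>2 + (norm (v x))\<^sup>2"
      using sum_squares_bound[of "norm (u x)" "norm (v x)"]
        mult_nonneg_nonneg[OF norm_ge_zero[of "u x"] norm_ge_zero[of "v x"]]
      by linarith
    finally show ?thesis .
  qed
  then show "AE x in lebesgue_on \<Omega>. norm (u x \<bullet> v x) \<le> norm ((norm (u x))\<^sup>2 + (norm (v x))\<^sup>2)"
    by (intro AE_I2) auto
qed

lemma L2_add:
  assumes "u \<in> L2 \<Omega>" "v \<in> L2 \<Omega>"
  shows "u + v \<in> L2 \<Omega>"
proof -
  have "(norm ((u + v) x))\<^sup>2 = (norm (u x))\<^sup>2 + 2 * (u x \<bullet> v x) + (norm (v x))\<^sup>2" for x
    by (simp add: power2_norm_eq_inner inner_add_left inner_add_right inner_commute)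
  moreover have "integrable (lebesgue_on \<Omega>) (\<lambda>x. (norm (u x))\<^sup>2 + 2 * (u x \<bullet> v x) + (norm (v x))\<^sup>2)"
    using assms integrable_L2_inner[OF assms] by (auto simp: L2_def)
  ultimately show ?thesis
    using assms by (auto simp: L2_def plus_fun_def)
qed

lemma L2_scale: "u \<in> L2 \<Omega> \<Longrightarrow> c *\<^sub>R u \<in> L2 \<Omega>"
  by (auto simp: L2_def scaleR_fun_def power_mult_distrib)

lemma subspace_L2: "subspace (L2 \<Omega>)"
  by (rule subspaceI) (auto simp: L2_add L2_scale, simp add: L2_def zero_fun_def)

lemma psd_on_L2: "psd_on (L2 \<Omega>) (L2_inner \<Omega>)"
proof
  show "L2_inner \<Omega> (u + v) w = L2_inner \<Omega> u w + L2_inner \<Omega> v w"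
    if "u \<in> L2 \<Omega>" "v \<in> L2 \<Omega>" "w \<in> L2 \<Omega>" for u v w
    using that by (simp add: L2_inner_def inner_add_left integrable_L2_inner)
  show "L2_inner \<Omega> (c *\<^sub>R u) v = c * L2_inner \<Omega> u v" for c u v
    by (simp add: L2_inner_def scaleR_fun_def)
qed (auto simp: subspace_L2 L2_inner_def inner_commute)

interpretation L2: psd_on "L2 \<Omega>" "L2_inner \<Omega>" for \<Omega> :: "(real^'d) set"
  by (rule psd_on_L2)

lemma L2_norm_eq_snorm: "L2_norm \<Omega> u = L2.snorm \<Omega> u"
  by (simp add: L2_norm_def L2.snorm_def)

lemma AE_null_L2: "AE x in lebesgue_on \<Omega>. u x = 0 \<Longrightarrow> L2_inner \<Omega> u u = 0"
  unfolding L2_inner_def by (rule integral_eq_zero_AE) (auto elim: AE_mp)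

lemma finite_measure_bounded:
  fixes \<Omega> :: "(real^'d) set"
  assumes "bounded_domain \<Omega>"
  shows "finite_measure (lebesgue_on \<Omega>)"
proof
  have "\<Omega> \<in> lmeasurable"
    using assms by (auto simp: bounded_domain_def lmeasurable_open)
  then show "emeasure (lebesgue_on \<Omega>) (space (lebesgue_on \<Omega>)) \<noteq> \<infinity>"
    using fmeasurableD[of \<Omega> lebesgue] fmeasurableD2[of \<Omega> lebesgue]
    by (simp add: emeasure_restrict_space space_restrict_space del: emeasure_completion)
qed

lemma nn_integral_L2:
  assumes "u \<in> L2 \<Omega>"
  shows "(\<integral>\<^sup>+x. ennreal ((norm (u x))\<^sup>2) \<partial>lebesgue_on \<Omega>) = ennreal (L2_inner \<Omega> u u)"
  using assms by (subst nn_integral_eq_integral) (auto simp: L2_def L2_inner_def power2_norm_eq_inner)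

text \<open>Riesz-Fischer. Along a fast subsequence the increments have summable L1 norms, because
  the measure is finite, so the subsequence converges almost everywhere; Fatou's lemma then gives
  convergence of the whole sequence in the mean.\<close>

lemma L2_complete:
  fixes u :: "nat \<Rightarrow> real^'d \<Rightarrow> 'b::euclidean_space"
  assumes dom: "bounded_domain \<Omega>" and u: "\<And>n. u n \<in> L2 \<Omega>"
    and cauchy: "\<And>\<epsilon>. 0 < \<epsilon> \<Longrightarrow> \<exists>N. \<forall>m\<ge>N. \<forall>n\<ge>N. L2_inner \<Omega> (u m - u n) (u m - u n) < \<epsilon>"
  obtains w where "w \<in> L2 \<Omega>" "(\<lambda>n. L2_inner \<Omega> (u n - w) (u n - w)) \<longlonglongrightarrow> 0"
proof -
  interpret M: finite_measure "lebesgue_on \<Omega>" by (rule finite_measure_bounded[OF dom])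
  have "\<exists>N. \<forall>m\<ge>N. \<forall>n\<ge>N. L2_inner \<Omega> (u m - u n) (u m - u n) < (1 / 4) ^ k" for k :: nat
    by (rule cauchy) simp
  then obtain N where N: "\<And>k m n. N k \<le> m \<Longrightarrow> N k \<le> n \<Longrightarrow> L2_inner \<Omega> (u m - u n) (u m - u n) < (1 / 4) ^ k"
    by metis
  \<comment> \<open>Partial sums give a nondecreasing choice of indices with
    \<open>N k \<le> r k\<close>.\<close>
  define r where "r = (\<lambda>k. \<Sum>j\<le>k. N j)"
  have r: "N k \<le> r k" "N k \<le> r (Suc k)" for k
    unfolding r_def by (rule member_le_sum; simp)+
  have r_mono: "r k \<le> r (k + j)" for k j
    by (induction j) (auto simp: r_def)
  define d where "d = (\<lambda>k. u (r (Suc k)) - u (r k))"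
  have d: "d k \<in> L2 \<Omega>" for k by (simp add: d_def u)
  have um [measurable]: "u n \<in> borel_measurable (lebesgue_on \<Omega>)" for n
    using u[of n] by (simp add: L2_def)
  have dm [measurable]: "d k \<in> borel_measurable (lebesgue_on \<Omega>)" for k
    using d[of k] by (simp add: L2_def)
  define B where "B = sqrt (measure (lebesgue_on \<Omega>) \<Omega>)"
  have int_d: "integrable (lebesgue_on \<Omega>) (\<lambda>x. norm (d k x))" and norm_d: "(LINT x|lebesgue_on \<Omega>. norm (d k x)) \<le> B * (1 / 2) ^ k" for k
  proof -
    have n: "(\<lambda>x. norm (d k x)) \<in> L2 \<Omega>" using d[of k] by (auto simp: L2_def)
    have o: "(\<lambda>x. 1 :: real) \<in> L2 \<Omega>" by (auto simp: L2_def)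
    show "integrable (lebesgue_on \<Omega>) (\<lambda>x. norm (d k x))"
      using integrable_L2_inner[OF n o] by simp
    have "(LINT x|lebesgue_on \<Omega>. norm (d k x)) = L2_inner \<Omega> (\<lambda>x. norm (d k x)) (\<lambda>x. 1)"
      by (simp add: L2_inner_def)
    also have "\<dots> \<le> L2.snorm \<Omega> (\<lambda>x. norm (d k x)) * L2.snorm \<Omega> (\<lambda>x. 1 :: real)"
      using L2.Cauchy_Schwarz[OF n o] by simp
    also have "L2.snorm \<Omega> (\<lambda>x. 1 :: real) = B"
      by (simp add: L2.snorm_def L2_inner_def B_def)
    also have "L2.snorm \<Omega> (\<lambda>x. norm (d k x)) = sqrt (L2_inner \<Omega> (d k) (d k))"
      by (simp add: L2.snorm_def L2_inner_def power2_norm_eq_inner flip: power2_eq_square)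
    also have "\<dots> \<le> (1 / 2) ^ k"
    proof (rule real_le_lsqrt)
      show "L2_inner \<Omega> (d k) (d k) \<le> ((1 / 2) ^ k)\<^sup>2"
        using N[OF r(2) r(1), of k] by (simp add: d_def power_mult[symmetric] power_mult_distrib[symmetric] power2_eq_square)
    qed simp
    finally show "(LINT x|lebesgue_on \<Omega>. norm (d k x)) \<le> B * (1 / 2) ^ k"
      by (simp add: B_def mult_right_mono mult.commute)
  qed
  have "(\<integral>\<^sup>+x. (\<Sum>k. ennreal (norm (d k x))) \<partial>lebesgue_on \<Omega>) = (\<Sum>k. \<integral>\<^sup>+x. ennreal (norm (d k x)) \<partial>lebesgue_on \<Omega>)"
    by (intro nn_integral_suminf) measurable
  also have "\<dots> \<le> (\<Sum>k. ennreal (B * (1 / 2) ^ k))"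
    using int_d norm_d by (intro suminf_le) (auto simp: nn_integral_eq_integral intro!: ennreal_leI)
  also have "\<dots> = ennreal (\<Sum>k. B * (1 / 2) ^ k)"
    by (intro suminf_ennreal2) (auto simp: B_def intro: summable_mult summable_geometric)
  also have "\<dots> < \<infinity>" by simp
  finally have "AE x in lebesgue_on \<Omega>. (\<Sum>k. ennreal (norm (d k x))) \<noteq> \<infinity>"
    by (intro nn_integral_noteq_infinite) auto
  then have conv: "AE x in lebesgue_on \<Omega>. convergent (\<lambda>k. u (r k) x)"
  proof (rule AE_mp, intro AE_I2 impI)
    fix x assume "(\<Sum>k. ennreal (norm (d k x))) \<noteq> \<infinity>"
    then have "summable (\<lambda>k. norm (d k x))"
      by (intro summable_suminf_not_top) auto
    then have "summable (\<lambda>k. d k x)" by (rule summable_norm_cancel)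
    then have "convergent (\<lambda>n. u (r 0) x + (\<Sum>k<n. d k x))"
      by (intro convergent_add convergent_const) (simp add: summable_iff_convergent)
    also have "(\<lambda>n. u (r 0) x + (\<Sum>k<n. d k x)) = (\<lambda>n. u (r n) x)"
    proof
      show "u (r 0) x + (\<Sum>k<n. d k x) = u (r n) x" for n
        using sum_lessThan_telescope[of "\<lambda>k. u (r k) x" n] by (simp add: d_def)
    qed
    finally show "convergent (\<lambda>k. u (r k) x)" .
  qed
  define w where "w = (\<lambda>x. lim (\<lambda>k. u (r k) x))"
  have wm [measurable]: "w \<in> borel_measurable (lebesgue_on \<Omega>)"
    unfolding w_def by (rule borel_measurable_lim_metric) (rule um)
  have lim: "AE x in lebesgue_on \<Omega>. (\<lambda>k. u (r k) x) \<longlonglongrightarrow> w x"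
    using conv by (rule AE_mp) (auto simp: w_def convergent_LIMSEQ_iff)
  \<comment> \<open>Fatou's lemma in the index of the subsequence, with n fixed: every late term is
    estimated, not only those of the subsequence.\<close>
  have bound: "(\<integral>\<^sup>+x. ennreal ((norm ((u n - w) x))\<^sup>2) \<partial>lebesgue_on \<Omega>) \<le> ennreal ((1 / 4) ^ k)" if n: "N k \<le> n" for k n
  proof -
    have "(\<integral>\<^sup>+x. ennreal ((norm ((u n - w) x))\<^sup>2) \<partial>lebesgue_on \<Omega>)
        = (\<integral>\<^sup>+x. liminf (\<lambda>j. ennreal ((norm ((u n - u (r j)) x))\<^sup>2)) \<partial>lebesgue_on \<Omega>)"
    proof (rule nn_integral_cong_AE, rule AE_mp[OF lim], intro AE_I2 impI)
      fix x assume "(\<lambda>k. u (r k) x) \<longlonglongrightarrow> w x"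
      then have "(\<lambda>j. ennreal ((norm ((u n - u (r j)) x))\<^sup>2)) \<longlonglongrightarrow> ennreal ((norm ((u n - w) x))\<^sup>2)"
        by (auto intro!: tendsto_intros)
      then show "ennreal ((norm ((u n - w) x))\<^sup>2) = liminf (\<lambda>j. ennreal ((norm ((u n - u (r j)) x))\<^sup>2))"
        by (rule lim_imp_Liminf[OF sequentially_bot, symmetric])
    qed
    also have "\<dots> \<le> liminf (\<lambda>j. \<integral>\<^sup>+x. ennreal ((norm ((u n - u (r j)) x))\<^sup>2) \<partial>lebesgue_on \<Omega>)"
      by (intro nn_integral_liminf) (use um in simp)
    also have "\<dots> = liminf (\<lambda>j. ennreal (L2_inner \<Omega> (u n - u (r j)) (u n - u (r j))))"
      by (simp only: nn_integral_L2[OF L2.mem(3)[OF u u]])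
    also have "\<dots> \<le> ennreal ((1 / 4) ^ k)"
    proof (rule Liminf_le)
      have "N k \<le> r j" if "k \<le> j" for j
        using r(1)[of k] r_mono[of k "j - k"] that by simp
      then show "\<forall>\<^sub>F j in sequentially. ennreal (L2_inner \<Omega> (u n - u (r j)) (u n - u (r j))) \<le> ennreal ((1 / 4) ^ k)"
        unfolding eventually_sequentially using N[OF n] by (intro exI[of _ k]) (auto intro!: ennreal_leI less_imp_le)
    qed simp
    finally show ?thesis .
  qed
  have diff_L2: "u n - w \<in> L2 \<Omega>" if "N 0 \<le> n" for n
  proof -
    have "integrable (lebesgue_on \<Omega>) (\<lambda>x. (norm ((u n - w) x))\<^sup>2)"
      using bound[OF that] um wm by (intro integrableI_bounded) (auto intro: order_le_less_trans)
    then show ?thesis using um wm by (auto simp: L2_def fun_diff_def)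
  qed
  have w: "w \<in> L2 \<Omega>"
  proof -
    have "u (N 0) - (u (N 0) - w) \<in> L2 \<Omega>" by (intro L2.mem u diff_L2) simp
    then show ?thesis by simp
  qed
  moreover have "(\<lambda>n. L2_inner \<Omega> (u n - w) (u n - w)) \<longlonglongrightarrow> 0"
  proof (rule LIMSEQ_I)
    fix \<epsilon> :: real assume "0 < \<epsilon>"
    then obtain k where k: "(1 / 4 :: real) ^ k < \<epsilon>" using real_arch_pow_inv[of \<epsilon> "1/4"] by auto
    have "norm (L2_inner \<Omega> (u n - w) (u n - w) - 0) < \<epsilon>" if "N k \<le> n" for n
    proof -
      have uw: "u n - w \<in> L2 \<Omega>" by (simp add: u w)
      have "ennreal (L2_inner \<Omega> (u n - w) (u n - w)) \<le> ennreal ((1 / 4) ^ k)"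
        using bound[OF that] by (simp only: nn_integral_L2[OF uw])
      then have "L2_inner \<Omega> (u n - w) (u n - w) \<le> (1 / 4) ^ k" by simp
      then show ?thesis using k L2.nonneg[OF uw] by simp
    qed
    then show "\<exists>no. \<forall>n\<ge>no. norm (L2_inner \<Omega> (u n - w) (u n - w) - 0) < \<epsilon>" by blast
  qed
  ultimately show ?thesis by (rule that)
qed

subsection \<open>Smooth functions\<close>

definition grad :: "(real^'d \<Rightarrow> real) \<Rightarrow> real^'d \<Rightarrow> real^'d" where
  "grad f x = (\<chi> i. partial i f x)"

lemma partial_eq: "(f has_derivative D) (at x) \<Longrightarrow> partial i f x = D (axis i 1)"
  unfolding partial_def by (drule frechet_derivative_at) simp

lemma has_derivative_grad:
  assumes "f differentiable (at x)"
  shows "(f has_derivative (\<lambda>h. grad f x \<bullet> h)) (at x)"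
proof -
  let ?D = "frechet_derivative f (at x)"
  have D: "(f has_derivative ?D) (at x)" using assms by (simp add: frechet_derivative_works)
  then have lin: "linear ?D" by (rule has_derivative_linear)
  have "?D h = grad f x \<bullet> h" for h
  proof -
    have "?D h = ?D (\<Sum>i\<in>UNIV. h $ i *\<^sub>R axis i 1)"
      by (simp add: basis_expansion flip: scalar_mult_eq_scaleR)
    also have "\<dots> = (\<Sum>i\<in>UNIV. h $ i * ?D (axis i 1))"
      by (simp add: linear_sum[OF lin] linear_scale[OF lin])
    finally show ?thesis by (simp add: grad_def partial_def inner_vec_def mult.commute)
  qed
  then show ?thesis using D by (metis (no_types, lifting) ext)
qed

lemma C_k_differentiable: "C_k (Suc k) f \<Longrightarrow> f differentiable (at x)"
  by (simp add: differentiable_on_def)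

lemma C_k_Suc: "C_k (Suc k) f \<Longrightarrow> C_k k f"
proof (induction k arbitrary: f)
  case 0
  then show ?case by (simp add: differentiable_imp_continuous_on)
next
  case (Suc k)
  then show ?case by (metis C_k.simps(2))
qed

lemma partial_add:
  assumes "f differentiable (at x)" "g differentiable (at x)"
  shows "partial i (\<lambda>x. f x + g x) x = partial i f x + partial i g x"
  using partial_eq[OF has_derivative_add[OF has_derivative_grad[OF assms(1)] has_derivative_grad[OF assms(2)]], of i]
  by (simp add: inner_axis grad_def)

lemma partial_scale:
  assumes "f differentiable (at x)"
  shows "partial i (\<lambda>x. c * f x) x = c * partial i f x"
  using partial_eq[OF has_derivative_mult_right[OF has_derivative_grad[OF assms(1)]], of i]
  by (simp add: inner_axis grad_def)

lemma partial_mult: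
  assumes "f differentiable (at x)" "g differentiable (at x)"
  shows "partial i (\<lambda>x. f x * g x) x = partial i f x * g x + f x * partial i g x"
  using partial_eq[OF has_derivative_mult[OF has_derivative_grad[OF assms(1)] has_derivative_grad[OF assms(2)]], of i]
  by (simp add: inner_axis grad_def)

lemma C_k_const: "C_k k (\<lambda>x :: real^'d. c)"
proof (induction k arbitrary: c)
  case (Suc k)
  have "partial i (\<lambda>x :: real^'d. c) = (\<lambda>x. 0)" for i c
    by (simp add: fun_eq_iff partial_eq[OF has_derivative_const])
  then show ?case using Suc by simp
qed simp

lemma C_k_scale: "C_k k f \<Longrightarrow> C_k k (\<lambda>x. c * f x)"
proof (induction k arbitrary: f)
  case 0
  then show ?case by (auto intro: continuous_intros)
next
  case (Suc k)
  have "partial i (\<lambda>x. c * f x) = (\<lambda>x. c * partial i f x)" for i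
    using Suc.prems by (intro ext partial_scale C_k_differentiable)
  then show ?case using Suc by (auto simp: differentiable_on_def)
qed

lemma C_k_add: "C_k k f \<Longrightarrow> C_k k g \<Longrightarrow> C_k k (\<lambda>x. f x + g x)"
proof (induction k arbitrary: f g)
  case 0
  then show ?case by (auto intro: continuous_intros)
next
  case (Suc k)
  have "partial i (\<lambda>x. f x + g x) = (\<lambda>x. partial i f x + partial i g x)" for i
    using Suc.prems by (intro ext partial_add C_k_differentiable)
  then show ?case using Suc by (auto simp: differentiable_on_def)
qed

lemma C_k_mult: "C_k k f \<Longrightarrow> C_k k g \<Longrightarrow> C_k k (\<lambda>x. f x * g x)"
proof (induction k arbitrary: f g)
  case 0
  then show ?case by (auto intro: continuous_intros)
next
  case (Suc k)
  have "partial i (\<lambda>x. f x * g x) = (\<lambda>x. partial i f x * g x + f x * partial i g x)" for i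
    using Suc.prems by (intro ext partial_mult C_k_differentiable)
  moreover have "C_k k (\<lambda>x. partial i f x * g x + f x * partial i g x)" for i
    using Suc.prems C_k_Suc[OF Suc.prems(1)] C_k_Suc[OF Suc.prems(2)]
    by (intro C_k_add Suc.IH) simp_all
  ultimately show ?case using Suc.prems by (auto simp: differentiable_on_def)
qed

lemma C_k_prod: "finite I \<Longrightarrow> (\<And>i. i \<in> I \<Longrightarrow> C_k k (f i)) \<Longrightarrow> C_k k (\<lambda>x. \<Prod>i\<in>I. f i x)"
  by (induction I rule: finite_induct) (simp_all add: C_k_const C_k_mult)

text \<open>A sequence in which each function is the derivative of its predecessor is closed under
  differentiation, so all orders of smoothness follow by one induction with n arbitrary.\<close>

lemma C_k_coordinate:
  fixes F :: "nat \<Rightarrow> real \<Rightarrow> real"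
  assumes F: "\<And>n t. (F n has_real_derivative F (Suc n) t) (at t)"
  shows "C_k k (\<lambda>x :: real^'d. F n (c * x $ i + d))"
proof (induction k arbitrary: n)
  case 0
  have "continuous_on UNIV (F n)"
    using F by (intro continuous_at_imp_continuous_on) (auto intro: DERIV_isCont)
  then show ?case
    by (auto intro!: continuous_intros continuous_on_compose2[of UNIV "F n"])
next
  case (Suc k)
  have D: "((\<lambda>x :: real^'d. F n (c * x $ i + d)) has_derivative (\<lambda>h. F (Suc n) (c * x $ i + d) * (c * h $ i))) (at x)" for x
  proof (rule has_derivative_compose[where g = "F n" and f = "\<lambda>x. c * x $ i + d" and f' = "\<lambda>h. c * h $ i"
        and g' = "(*) (F (Suc n) (c * x $ i + d))"])
    show "((\<lambda>x :: real^'d. c * x $ i + d) has_derivative (\<lambda>h. c * h $ i)) (at x)"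
      by (auto intro!: derivative_eq_intros bounded_linear.has_derivative[OF bounded_linear_vec_nth])
    show "(F n has_derivative (*) (F (Suc n) (c * x $ i + d))) (at (c * x $ i + d))"
      using F by (simp add: has_field_derivative_def)
  qed
  then have "(\<lambda>x :: real^'d. F n (c * x $ i + d)) differentiable_on UNIV"
    by (auto simp: differentiable_on_def differentiable_def)
  moreover have "partial j (\<lambda>x :: real^'d. F n (c * x $ i + d)) = (\<lambda>x. (c * axis j 1 $ i) * F (Suc n) (c * x $ i + d))" for j
    using partial_eq[OF D] by (simp add: fun_eq_iff mult_ac)
  ultimately show ?case using C_k_scale[OF Suc] by simp
qed

subsection \<open>Bump functions\<close>

text \<open>The derivatives of \<open>exp (- 1 / t)\<close> are polynomials in \<open>1 / t\<close> times \<open>exp (- 1 / t)\<close>.\<close>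

primrec bump_poly :: "nat \<Rightarrow> real poly" where
  "bump_poly 0 = 1"
| "bump_poly (Suc n) = [:0, 0, 1:] * (bump_poly n - pderiv (bump_poly n))"

definition bump :: "nat \<Rightarrow> real \<Rightarrow> real" where
  "bump n t = (if t \<le> 0 then 0 else poly (bump_poly n) (1 / t) * exp (- (1 / t)))"

lemma poly_times_exp_tendsto_0: "((\<lambda>s. poly p s * exp (- s)) \<longlongrightarrow> 0) (at_top :: real filter)"
proof -
  have "((\<lambda>s. \<Sum>i\<le>degree p. coeff p i * (s ^ i / exp s)) \<longlongrightarrow> (\<Sum>i\<le>degree p. coeff p i * 0)) (at_top :: real filter)"
    by (intro tendsto_intros tendsto_power_div_exp_0)
  then show ?thesis
    by (simp add: poly_altdef exp_minus divide_inverse sum_distrib_right mult.assoc)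
qed

lemma bump_deriv: "(bump n has_real_derivative bump (Suc n) t) (at t)"
proof -
  consider "t < 0" | "t = 0" | "t > 0" by linarith
  then show ?thesis
  proof cases
    case 1
    have "((\<lambda>_. 0) has_real_derivative bump (Suc n) t) (at t)"
      using 1 by (simp add: bump_def)
    then show ?thesis
      by (rule has_field_derivative_transform_within_open[of _ _ _ "{..<0}"]) (use 1 in \<open>auto simp: bump_def\<close>)
  next
    case 3
    have "((\<lambda>t. poly (bump_poly n) (1 / t) * exp (- (1 / t))) has_real_derivative bump (Suc n) t) (at t)"
      using 3 by (auto intro!: derivative_eq_intros simp: bump_def power2_eq_square field_simps)
    then show ?thesis
      by (rule has_field_derivative_transform_within_open[of _ _ _ "{0<..}"]) (use 3 in \<open>auto simp: bump_def\<close>)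
  next
    case 2
    have "((\<lambda>h. (bump n (0 + h) - bump n 0) / h) \<longlongrightarrow> 0) (at 0)"
    proof (rule filterlim_split_at)
      \<comment> \<open>The difference quotient at 0 is again a polynomial in 1 / h times the
        exponential, with one more factor 1 / h.\<close>
      have "((\<lambda>h. poly ([:0, 1:] * bump_poly n) (inverse h) * exp (- inverse h)) \<longlongrightarrow> 0) (at_right (0::real))"
        by (rule filterlim_compose[OF poly_times_exp_tendsto_0 filterlim_inverse_at_top_right])
      moreover have "\<forall>\<^sub>F h in at_right (0::real). poly ([:0, 1:] * bump_poly n) (inverse h) * exp (- inverse h) = (bump n (0 + h) - bump n 0) / h"
        by (auto simp: eventually_at_filter bump_def field_simps)
      ultimately show "((\<lambda>h. (bump n (0 + h) - bump n 0) / h) \<longlongrightarrow> 0) (at_right 0)"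
        by (rule Lim_transform_eventually)
      have "\<forall>\<^sub>F h in at_left (0::real). 0 = (bump n (0 + h) - bump n 0) / h"
        by (auto simp: eventually_at_filter bump_def)
      then show "((\<lambda>h. (bump n (0 + h) - bump n 0) / h) \<longlongrightarrow> 0) (at_left 0)"
        by (rule Lim_transform_eventually[OF tendsto_const])
    qed
    then show ?thesis using 2 by (simp add: DERIV_def bump_def)
  qed
qed

text \<open>Inside the open box the arguments of \<open>bump 0\<close> tend to infinity with n, so
  these functions approximate the indicator of the box from below.\<close>

definition box_bump :: "real^'d \<Rightarrow> real^'d \<Rightarrow> nat \<Rightarrow> real^'d \<Rightarrow> real" where
  "box_bump a b n x =
     (\<Prod>i\<in>UNIV. bump 0 (real (Suc n) * (x $ i - a $ i)) * bump 0 (real (Suc n) * (b $ i - x $ i)))"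

lemma bump_bounds: "0 \<le> bump 0 t" "bump 0 t \<le> 1"
  by (auto simp: bump_def)

lemma box_bump_bounds: "0 \<le> box_bump a b n x" "box_bump a b n x \<le> 1"
proof -
  show "0 \<le> box_bump a b n x" by (simp add: box_bump_def prod_nonneg bump_bounds)
  show "box_bump a b n x \<le> 1"
    unfolding box_bump_def by (intro prod_le_1 conjI mult_nonneg_nonneg mult_le_one bump_bounds)
qed

lemma box_bump_outside: "x \<notin> box a b \<Longrightarrow> box_bump a b n x = 0"
proof -
  assume "x \<notin> box a b"
  then obtain i where "\<not> (a $ i < x $ i \<and> x $ i < b $ i)" by (auto simp: mem_box_cart)
  then have "bump 0 (real (Suc n) * (x $ i - a $ i)) * bump 0 (real (Suc n) * (b $ i - x $ i)) = 0"
    by (auto simp: bump_def mult_le_0_iff)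
  then show ?thesis unfolding box_bump_def by (intro prod_zero) auto
qed

lemma box_bump_tendsto: "(\<lambda>n. box_bump a b n x) \<longlonglongrightarrow> indicator (box a b) x"
proof (cases "x \<in> box a b")
  case True
  have lim: "(\<lambda>n. bump 0 (real (Suc n) * t)) \<longlonglongrightarrow> 1" if "0 < t" for t
  proof -
    have "(\<lambda>n. exp (- (inverse t * inverse (real (Suc n))))) \<longlonglongrightarrow> exp (- (inverse t * 0))"
      by (intro tendsto_intros LIMSEQ_inverse_real_of_nat)
    then show ?thesis using that by (simp add: bump_def inverse_eq_divide mult.commute mult_le_0_iff)
  qed
  have "(\<lambda>n. \<Prod>i\<in>UNIV. bump 0 (real (Suc n) * (x $ i - a $ i)) * bump 0 (real (Suc n) * (b $ i - x $ i)))
      \<longlonglongrightarrow> (\<Prod>i\<in>(UNIV :: 'a set). 1 * 1)"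
    using True by (intro tendsto_intros lim) (auto simp: mem_box_cart)
  then show ?thesis using True by (simp add: box_bump_def)
qed (simp add: box_bump_outside)

lemma box_bump_test:
  fixes a b :: "real^'d"
  assumes "cbox a b \<subseteq> \<Omega>"
  shows "box_bump a b n \<in> test_functions \<Omega>"
proof -
  have "closure {x. box_bump a b n x \<noteq> 0} \<subseteq> cbox a b"
    using box_bump_outside[of _ a b n] box_subset_cbox[of a b] by (intro closure_minimal) auto
  moreover have "C_k k (box_bump a b n)" for k
  proof -
    have 1: "C_k k (\<lambda>x :: real^'d. bump 0 (c * x $ i + d))" for c d i
      by (rule C_k_coordinate[where F = bump, OF bump_deriv])
    have "C_k k (\<lambda>x :: real^'d. bump 0 (real (Suc n) * (x $ i - c)))"
      "C_k k (\<lambda>x :: real^'d. bump 0 (real (Suc n) * (c - x $ i)))" for i c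
      using 1[of "real (Suc n)" i "- (real (Suc n) * c)"] 1[of "- real (Suc n)" i "real (Suc n) * c"]
      by (simp_all add: algebra_simps)
    then show ?thesis
      unfolding box_bump_def[abs_def] by (intro C_k_prod C_k_mult) auto
  qed
  ultimately show ?thesis using assms bounded_subset[OF bounded_cbox]
    by (auto simp: test_functions_def compact_eq_bounded_closed)
qed

subsection \<open>Test functions\<close>

lemma test_C_k: "\<phi> \<in> test_functions \<Omega> \<Longrightarrow> C_k k \<phi>"
  by (simp add: test_functions_def)

lemma test_differentiable: "\<phi> \<in> test_functions \<Omega> \<Longrightarrow> \<phi> differentiable (at x)"
  by (rule C_k_differentiable) (rule test_C_k)

lemma test_has_derivative: "\<phi> \<in> test_functions \<Omega> \<Longrightarrow> (\<phi> has_derivative (\<lambda>h. grad \<phi> x \<bullet> h)) (at x)"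
  by (intro has_derivative_grad test_differentiable)

lemma test_continuous: "\<phi> \<in> test_functions \<Omega> \<Longrightarrow> continuous_on UNIV \<phi>"
  using test_C_k[of \<phi> \<Omega> 0] by simp

lemma test_functionsI:
  assumes "\<And>k. C_k k \<psi>" "{x. \<psi> x \<noteq> 0} \<subseteq> closure {x. \<phi> x \<noteq> 0}" "\<phi> \<in> test_functions \<Omega>"
  shows "\<psi> \<in> test_functions \<Omega>"
proof -
  have "closure {x. \<psi> x \<noteq> 0} \<subseteq> closure {x. \<phi> x \<noteq> 0}"
    using assms(2) by (rule closure_minimal) simp
  then show ?thesis using assms(1,3)
    by (auto simp: test_functions_def compact_eq_bounded_closed intro: bounded_subset)
qed

lemma test_partial:
  assumes \<phi>: "\<phi> \<in> test_functions \<Omega>"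
  shows "partial i \<phi> \<in> test_functions \<Omega>"
proof (rule test_functionsI[OF _ _ \<phi>])
  show "C_k k (partial i \<phi>)" for k using test_C_k[OF \<phi>, of "Suc k"] by simp
  show "{x. partial i \<phi> x \<noteq> 0} \<subseteq> closure {x. \<phi> x \<noteq> 0}"
  proof (rule subsetI, rule ccontr)
    fix x assume x: "x \<in> {x. partial i \<phi> x \<noteq> 0}" "x \<notin> closure {x. \<phi> x \<noteq> 0}"
    define S where "S = - closure {x. \<phi> x \<noteq> 0}"
    have "open S" "x \<in> S" using x by (auto simp: S_def)
    moreover have "\<phi> y = 0" if "y \<in> S" for y
      using closure_subset[of "{x. \<phi> x \<noteq> 0}"] that by (auto simp: S_def)
    ultimately have "(\<phi> has_derivative (\<lambda>h. 0)) (at x)"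
      by (intro has_derivative_transform_within_open[OF has_derivative_const[of 0]]) auto
    then show False using x(1) by (simp add: partial_eq)
  qed
qed

lemma test_scale: "\<phi> \<in> test_functions \<Omega> \<Longrightarrow> (\<lambda>x. c * \<phi> x) \<in> test_functions \<Omega>"
  by (rule test_functionsI[of _ \<phi>]) (auto intro: C_k_scale test_C_k closure_subset[THEN subsetD])

lemma test_mult: "\<phi> \<in> test_functions \<Omega> \<Longrightarrow> (\<And>k. C_k k \<psi>) \<Longrightarrow> (\<lambda>x. \<phi> x * \<psi> x) \<in> test_functions \<Omega>"
  by (rule test_functionsI[of _ \<phi>]) (auto intro: C_k_mult test_C_k closure_subset[THEN subsetD])

lemma test_add:
  assumes \<phi>: "\<phi> \<in> test_functions \<Omega>" and \<psi>: "\<psi> \<in> test_functions \<Omega>"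
  shows "(\<lambda>x. \<phi> x + \<psi> x) \<in> test_functions \<Omega>"
proof -
  have "closure {x. \<phi> x + \<psi> x \<noteq> 0} \<subseteq> closure ({x. \<phi> x \<noteq> 0} \<union> {x. \<psi> x \<noteq> 0})"
    by (rule closure_mono) auto
  then have "closure {x. \<phi> x + \<psi> x \<noteq> 0} \<subseteq> closure {x. \<phi> x \<noteq> 0} \<union> closure {x. \<psi> x \<noteq> 0}"
    by simp
  moreover have "compact (closure {x. \<phi> x \<noteq> 0} \<union> closure {x. \<psi> x \<noteq> 0})"
    using assms by (auto simp: test_functions_def intro: compact_Un)
  ultimately have "compact (closure {x. \<phi> x + \<psi> x \<noteq> 0})"
    by (meson bounded_subset closed_closure compact_eq_bounded_closed)
  then show ?thesis
    using assms \<open>closure {x. \<phi> x + \<psi> x \<noteq> 0} \<subseteq> closure {x. \<phi> x \<noteq> 0} \<union> closure {x. \<psi> x \<noteq> 0}\<close>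
    by (auto simp: test_functions_def intro: C_k_add)
qed

lemma grad_add:
  "\<phi> \<in> test_functions \<Omega> \<Longrightarrow> \<psi> \<in> test_functions \<Omega> \<Longrightarrow> grad (\<lambda>x. \<phi> x + \<psi> x) x = grad \<phi> x + grad \<psi> x"
  by (simp add: grad_def vec_eq_iff partial_add test_differentiable)

lemma grad_scale: "\<phi> \<in> test_functions \<Omega> \<Longrightarrow> grad (\<lambda>x. c * \<phi> x) x = c *\<^sub>R grad \<phi> x"
  by (simp add: grad_def vec_eq_iff partial_scale test_differentiable)

subsection \<open>Continuously differentiable functions with bounded support\<close>

lemma integral_lborel_shift:
  fixes f :: "'a::euclidean_space \<Rightarrow> real"
  assumes [measurable]: "f \<in> borel_measurable borel"
  shows "(LINT x|lborel. f (x + z)) = (LINT x|lborel. f x)"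
proof -
  have "(LINT x|lborel. f x) = (LINT x|distr lborel borel ((+) z). f x)"
    by (simp add: lborel_distr_plus)
  also have "\<dots> = (LINT x|lborel. f (z + x))"
    by (rule integral_distr) measurable
  finally show ?thesis by (simp add: add.commute)
qed

lemma nn_integral_lborel_shift:
  fixes f :: "'a::euclidean_space \<Rightarrow> ennreal"
  assumes [measurable]: "f \<in> borel_measurable borel"
  shows "(\<integral>\<^sup>+x. f (x + z) \<partial>lborel) = (\<integral>\<^sup>+x. f x \<partial>lborel)"
proof -
  have "(\<integral>\<^sup>+x. f x \<partial>lborel) = (\<integral>\<^sup>+x. f x \<partial>distr lborel borel ((+) z))"
    by (simp add: lborel_distr_plus)
  also have "\<dots> = (\<integral>\<^sup>+x. f (z + x) \<partial>lborel)"
    by (rule nn_integral_distr) measurable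
  finally show ?thesis by (simp add: add.commute)
qed

lemma integrable_continuous_bounded_support:
  fixes f :: "'a::euclidean_space \<Rightarrow> real"
  assumes "continuous_on UNIV f" "\<And>x. R < norm x \<Longrightarrow> f x = 0"
  shows "integrable lborel f"
proof -
  have "integrable lborel (\<lambda>x. indicator (cball 0 R) x *\<^sub>R f x)"
    by (rule borel_integrable_compact) (auto intro: continuous_on_subset[OF assms(1)])
  also have "(\<lambda>x. indicator (cball 0 R) x *\<^sub>R f x) = f"
    using assms(2) by (force simp: indicator_def)
  finally show ?thesis .
qed

locale C1_bounded_support =
  fixes f :: "real^'d::finite \<Rightarrow> real" and G :: "real^'d \<Rightarrow> real^'d" and R :: real
  assumes deriv: "\<And>x. (f has_derivative (\<lambda>h. G x \<bullet> h)) (at x)"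
    and cont_G: "continuous_on UNIV G"
    and R_pos: "0 < R" and supp: "\<And>x. R < norm x \<Longrightarrow> f x = 0"
begin

lemma cont_f: "continuous_on UNIV f"
  using deriv by (meson continuous_at_imp_continuous_on has_derivative_continuous)

lemma f_measurable [measurable]: "f \<in> borel_measurable borel"
  by (rule borel_measurable_continuous_onI[OF cont_f])

lemma G_measurable [measurable]: "G \<in> borel_measurable borel"
  by (rule borel_measurable_continuous_onI[OF cont_G])

lemma supp_G: "G x = 0" if "R < norm x"
proof -
  have "open {x :: real^'d. R < norm x}" by (intro open_Collect_less continuous_intros)
  then have "(f has_derivative (\<lambda>h. 0)) (at x)"
    using that supp by (intro has_derivative_transform_within_open[OF has_derivative_const[of 0]]) auto
  then have "(\<lambda>h. G x \<bullet> h) = (\<lambda>h. 0)" using has_derivative_unique deriv by blast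
  then have "G x \<bullet> G x = 0" by metis
  then show ?thesis by simp
qed

lemma G_bounded: obtains B where "0 \<le> B" "\<And>x. norm (G x) \<le> B"
proof -
  have "compact (G ` cball 0 R)"
    by (intro compact_continuous_image continuous_on_subset[OF cont_G]) auto
  then obtain B where B: "0 < B" "\<And>x. x \<in> cball 0 R \<Longrightarrow> norm (G x) \<le> B"
    by (metis bounded_pos compact_imp_bounded imageI)
  have "norm (G x) \<le> B" for x
    using B supp_G[of x] by (cases "x \<in> cball 0 R") auto
  then show ?thesis using B that by (meson less_imp_le)
qed

lemma integrable_sq: "integrable lborel (\<lambda>x. (f x)\<^sup>2)"
  by (rule integrable_continuous_bounded_support[of _ R]) (auto intro!: continuous_intros cont_f simp: supp)

lemma integrable_G_sq: "integrable lborel (\<lambda>x. (norm (G x))\<^sup>2)"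
  by (rule integrable_continuous_bounded_support[of _ R]) (auto intro!: continuous_intros cont_G simp: supp_G)

lemma integrable_shift_sq: "integrable lborel (\<lambda>x. (f (x + z) - f x)\<^sup>2)"
proof (rule integrable_continuous_bounded_support[of _ "R + norm z"])
  show "continuous_on UNIV (\<lambda>x. (f (x + z) - f x)\<^sup>2)"
    by (intro continuous_intros continuous_on_compose2[OF cont_f] cont_f) auto
  fix x :: "real^'d" assume x: "R + norm z < norm x"
  have "norm x \<le> norm (x + z) + norm z" using norm_triangle_ineq4[of "x + z" z] by simp
  then have "R < norm (x + z)" "R < norm x" using x norm_ge_zero[of z] by linarith+
  then show "(f (x + z) - f x)\<^sup>2 = 0" by (simp add: supp)
qed

definition q :: "real^'d \<Rightarrow> nat \<Rightarrow> real^'d \<Rightarrow> real" where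
  "q z n x = real (Suc n) * (f (x + (1 / real (Suc n)) *\<^sub>R z) - f x)"

lemma q_tendsto: "(\<lambda>n. q z n x) \<longlonglongrightarrow> G x \<bullet> z"
proof -
  have "((\<lambda>t. f (x + t *\<^sub>R z)) has_derivative (\<lambda>t. G (x + 0 *\<^sub>R z) \<bullet> (t *\<^sub>R z))) (at 0)"
    by (rule has_derivative_compose[of "\<lambda>t. x + t *\<^sub>R z" "\<lambda>t. t *\<^sub>R z" 0 UNIV f "\<lambda>h. G (x + 0 *\<^sub>R z) \<bullet> h"])
       (auto intro!: derivative_eq_intros deriv)
  then have "((\<lambda>t. f (x + t *\<^sub>R z)) has_real_derivative G x \<bullet> z) (at 0)"
    by (rule has_derivative_imp_has_field_derivative) simp
  then have "((\<lambda>h. (f (x + h *\<^sub>R z) - f x) / h) \<longlongrightarrow> G x \<bullet> z) (at 0)"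
    by (simp add: DERIV_def)
  then have "((\<lambda>h. (f (x + h *\<^sub>R z) - f x) / h) \<circ> (\<lambda>n. inverse (real (Suc n)))) \<longlonglongrightarrow> G x \<bullet> z"
    unfolding tendsto_at_iff_sequentially using LIMSEQ_inverse_real_of_nat by auto
  moreover have "((\<lambda>h. (f (x + h *\<^sub>R z) - f x) / h) \<circ> (\<lambda>n. inverse (real (Suc n)))) = (\<lambda>n. q z n x)"
    by (auto simp: q_def fun_eq_iff inverse_eq_divide)
  ultimately show ?thesis by simp
qed

text \<open>The majorant for dominated convergence: the mean value inequality inside the larger
  ball, and outside it both points of the quotient lie off the support.\<close>

lemma q_bounded:
  assumes "0 \<le> B" "\<And>x. norm (G x) \<le> B"
  shows "\<bar>q z n x\<bar> \<le> (B * norm z) * indicator (cball 0 (R + norm z)) x"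
proof (cases "x \<in> cball 0 (R + norm z)")
  case True
  define y where "y = x + (1 / real (Suc n)) *\<^sub>R z"
  have "norm (f y - f x) \<le> B * norm (y - x)"
  proof (rule differentiable_bound[of UNIV f "\<lambda>x h. G x \<bullet> h"])
    show "onorm (\<lambda>h. G x \<bullet> h) \<le> B" for x
    proof (rule onorm_le)
      show "norm (G x \<bullet> h) \<le> B * norm h" for h
        using Cauchy_Schwarz_ineq2[of "G x" h] mult_right_mono[OF assms(2)[of x] norm_ge_zero[of h]]
        by simp
    qed
  qed (auto intro: deriv)
  also have "\<dots> = B * norm z / real (Suc n)" by (simp add: y_def)
  finally have "\<bar>f y - f x\<bar> \<le> B * norm z / real (Suc n)" by simp
  then have "real (Suc n) * \<bar>f y - f x\<bar> \<le> real (Suc n) * (B * norm z / real (Suc n))"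
    by (rule mult_left_mono) simp
  also have "\<dots> = B * norm z" by simp
  finally show ?thesis using True by (simp add: q_def abs_mult y_def)
next
  case False
  then have x: "R + norm z < norm x" by simp
  have "norm ((1 / real (Suc n)) *\<^sub>R z) \<le> norm z"
    by (simp add: divide_le_eq mult_le_cancel_left1)
  moreover have "norm x \<le> norm (x + (1 / real (Suc n)) *\<^sub>R z) + norm ((1 / real (Suc n)) *\<^sub>R z)"
    using norm_triangle_ineq4[of "x + (1 / real (Suc n)) *\<^sub>R z" "(1 / real (Suc n)) *\<^sub>R z"] by simp
  ultimately have "R < norm (x + (1 / real (Suc n)) *\<^sub>R z)" "R < norm x"
    using x norm_ge_zero[of z] by linarith+
  then have "f (x + (1 / real (Suc n)) *\<^sub>R z) = 0" "f x = 0" by (simp_all add: supp)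
  then show ?thesis using False by (simp add: q_def)
qed

lemma integrable_indicator_cball: "integrable lborel (\<lambda>x :: real^'d. c * indicator (cball 0 r) x :: real)"
  by (intro integrable_mult_right integrable_real_indicator) (use emeasure_lborel_cball_finite in auto)

lemma q_measurable [measurable]: "q z n \<in> borel_measurable borel"
  unfolding q_def by measurable

text \<open>Each difference quotient integrates to 0 by translation invariance, and dominated
  convergence passes this to the derivative. Integration by parts is derived from it.\<close>

lemma integral_deriv_zero: "(LINT x|lborel. G x \<bullet> z) = 0"
proof -
  obtain B where B: "0 \<le> B" "\<And>x. norm (G x) \<le> B" using G_bounded by blast
  have "(\<lambda>n. LINT x|lborel. q z n x) \<longlonglongrightarrow> (LINT x|lborel. G x \<bullet> z)"
    by (rule integral_dominated_convergence[OF _ _ integrable_indicator_cball[of "B * norm z" "R + norm z"]])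
       (auto intro!: AE_I2 q_tendsto q_bounded[OF B])
  moreover have "(LINT x|lborel. q z n x) = 0" for n
  proof -
    have i: "integrable lborel f"
      by (rule integrable_continuous_bounded_support[OF cont_f supp])
    have "integrable lborel (\<lambda>x. f (x + (1 / real (Suc n)) *\<^sub>R z))"
    proof (rule integrable_continuous_bounded_support[of _ "R + norm z"])
      show "continuous_on UNIV (\<lambda>x. f (x + (1 / real (Suc n)) *\<^sub>R z))"
        by (intro continuous_intros continuous_on_compose2[OF cont_f]) auto
      fix x :: "real^'d" assume x: "R + norm z < norm x"
      have "norm ((1 / real (Suc n)) *\<^sub>R z) \<le> norm z"
        by (simp add: divide_le_eq mult_le_cancel_left1)
      moreover have "norm x \<le> norm (x + (1 / real (Suc n)) *\<^sub>R z) + norm ((1 / real (Suc n)) *\<^sub>R z)"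
        using norm_triangle_ineq4[of "x + (1 / real (Suc n)) *\<^sub>R z" "(1 / real (Suc n)) *\<^sub>R z"] by simp
      ultimately show "f (x + (1 / real (Suc n)) *\<^sub>R z) = 0" using x by (intro supp) linarith
    qed
    then show ?thesis using i integral_lborel_shift[OF f_measurable] by (simp add: q_def)
  qed
  ultimately have "(\<lambda>n. 0 :: real) \<longlonglongrightarrow> (LINT x|lborel. G x \<bullet> z)" by simp
  then show ?thesis by (simp add: LIMSEQ_const_iff)
qed

text \<open>The shift by z is split into n+1 equal shifts; the increments telescope, Cauchy-Schwarz
  costs a factor n+1, and translation invariance makes all summands equal. Letting n tend to
  infinity gives \<open>shift_estimate\<close>.\<close>

lemma shift_le_q: "(LINT x|lborel. (f (x + z) - f x)\<^sup>2) \<le> (LINT x|lborel. (q z n x)\<^sup>2)"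
proof -
  define m where "m = Suc n"
  define t where "t = (1 / real m) *\<^sub>R z"
  define d where "d = (\<lambda>x. f (x + t) - f x)"
  have [measurable]: "d \<in> borel_measurable borel" unfolding d_def by measurable
  have mt: "real m *\<^sub>R t = z" by (simp add: t_def m_def)
  have id: "integrable lborel (\<lambda>x. (d (x + y))\<^sup>2)" for y
  proof -
    have "integrable (distr lborel borel ((+) y)) (\<lambda>x. (d x)\<^sup>2)"
      using integrable_shift_sq[of t] by (simp add: lborel_distr_plus d_def)
    then show ?thesis by (subst (asm) integrable_distr_eq) (auto simp: add.commute)
  qed
  have "(f (x + z) - f x)\<^sup>2 \<le> real m * (\<Sum>j<m. (d (x + real j *\<^sub>R t))\<^sup>2)" for x
  proof -
    have "(\<Sum>j<m. d (x + real j *\<^sub>R t)) = f (x + real m *\<^sub>R t) - f (x + real 0 *\<^sub>R t)"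
      using sum_lessThan_telescope[of "\<lambda>j. f (x + real j *\<^sub>R t)" m]
      by (simp add: d_def algebra_simps)
    then have "f (x + z) - f x = (\<Sum>j<m. 1 * d (x + real j *\<^sub>R t))" by (simp add: mt)
    then have "(f (x + z) - f x)\<^sup>2 \<le> (\<Sum>j<m. 1\<^sup>2) * (\<Sum>j<m. (d (x + real j *\<^sub>R t))\<^sup>2)"
      using Cauchy_Schwarz_ineq_sum[of "\<lambda>_. 1" "\<lambda>j. d (x + real j *\<^sub>R t)" "{..<m}"] by simp
    then show ?thesis by simp
  qed
  then have "(LINT x|lborel. (f (x + z) - f x)\<^sup>2) \<le> (LINT x|lborel. real m * (\<Sum>j<m. (d (x + real j *\<^sub>R t))\<^sup>2))"
    by (intro integral_mono integrable_shift_sq integrable_mult_right Bochner_Integration.integrable_sum id)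
  also have "\<dots> = real m * (\<Sum>j<m. LINT x|lborel. (d (x + real j *\<^sub>R t))\<^sup>2)"
    using id by simp
  also have "\<dots> = real m * (\<Sum>j<m. LINT x|lborel. (d x)\<^sup>2)"
    by (subst integral_lborel_shift[of "\<lambda>x. (d x)\<^sup>2"]) auto
  also have "\<dots> = (LINT x|lborel. (q z n x)\<^sup>2)"
    by (simp add: q_def d_def t_def m_def power_mult_distrib power2_eq_square[of "real _"] power2_eq_square[of "1 + real n"] mult.assoc)
  finally show ?thesis .
qed

lemma shift_estimate:
  "(LINT x|lborel. (f (x + z) - f x)\<^sup>2) \<le> (norm z)\<^sup>2 * (LINT x|lborel. (norm (G x))\<^sup>2)"
proof -
  obtain B where B: "0 \<le> B" "\<And>x. norm (G x) \<le> B" using G_bounded by blast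
  have "(\<lambda>n. LINT x|lborel. (q z n x)\<^sup>2) \<longlonglongrightarrow> (LINT x|lborel. (G x \<bullet> z)\<^sup>2)"
  proof (rule integral_dominated_convergence[OF _ _ integrable_indicator_cball[of "(B * norm z)\<^sup>2" "R + norm z"]])
    show "AE x in lborel. (\<lambda>n. (q z n x)\<^sup>2) \<longlonglongrightarrow> (G x \<bullet> z)\<^sup>2"
      by (intro AE_I2 tendsto_power q_tendsto)
    have "norm ((q z n x)\<^sup>2) \<le> (B * norm z)\<^sup>2 * indicator (cball 0 (R + norm z)) x" for n x
    proof -
      have "\<bar>q z n x\<bar>\<^sup>2 \<le> ((B * norm z) * indicator (cball 0 (R + norm z)) x)\<^sup>2"
        by (intro power_mono q_bounded B) auto
      then show ?thesis by (auto simp: indicator_def split: if_splits)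
    qed
    then show "\<And>n. AE x in lborel. norm ((q z n x)\<^sup>2) \<le> (B * norm z)\<^sup>2 * indicator (cball 0 (R + norm z)) x"
      by (intro AE_I2)
  qed measurable
  then have "(LINT x|lborel. (f (x + z) - f x)\<^sup>2) \<le> (LINT x|lborel. (G x \<bullet> z)\<^sup>2)"
    by (rule LIMSEQ_le_const) (use shift_le_q in blast)
  also have "\<dots> \<le> (LINT x|lborel. (norm z)\<^sup>2 * (norm (G x))\<^sup>2)"
  proof (rule integral_mono)
    show "integrable lborel (\<lambda>x. (G x \<bullet> z)\<^sup>2)"
      by (rule integrable_continuous_bounded_support[of _ R]) (auto intro!: continuous_intros cont_G simp: supp_G)
    show "(G x \<bullet> z)\<^sup>2 \<le> (norm z)\<^sup>2 * (norm (G x))\<^sup>2" for x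
      using power_mono[OF Cauchy_Schwarz_ineq2[of "G x" z], of 2] by (simp add: power_mult_distrib mult.commute)
  qed (use integrable_G_sq in simp)
  finally show ?thesis using integrable_G_sq by simp
qed

lemma Poincare:
  "(LINT x|lborel. (f x)\<^sup>2) \<le> (2 * R + 1)\<^sup>2 / 2 * (LINT x|lborel. (norm (G x))\<^sup>2)"
proof -
  \<comment> \<open>Longer than the diameter 2 R of a ball containing the support, so f and its
    translate never overlap and the difference has twice the squared norm of f. The index
    \<open>undefined\<close> just names some coordinate.\<close>
  define z :: "real^'d" where "z = (2 * R + 1) *\<^sub>R axis undefined 1"
  have nz: "norm z = 2 * R + 1" using R_pos by (simp add: z_def norm_axis_1)
  have disj: "f (x + z) = 0 \<or> f x = 0" for x
  proof (rule ccontr)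
    assume "\<not> (f (x + z) = 0 \<or> f x = 0)"
    then have "norm (x + z) \<le> R" "norm x \<le> R" using supp by (meson not_le)+
    then show False using norm_triangle_ineq4[of "x + z" x] nz by simp
  qed
  have eq: "(f (x + z) - f x)\<^sup>2 = (f (x + z))\<^sup>2 + (f x)\<^sup>2" for x
    using disj[of x] by (rule disjE) simp_all
  have "integrable lborel (\<lambda>x. (f (x + z))\<^sup>2)"
  proof -
    have "integrable (distr lborel borel ((+) z)) (\<lambda>x. (f x)\<^sup>2)"
      using integrable_sq by (simp add: lborel_distr_plus)
    then show ?thesis by (subst (asm) integrable_distr_eq) (auto simp: add.commute)
  qed
  then have "(LINT x|lborel. (f (x + z) - f x)\<^sup>2) = 2 * (LINT x|lborel. (f x)\<^sup>2)"
    unfolding eq using integrable_sq integral_lborel_shift[of "\<lambda>x. (f x)\<^sup>2" z] by simp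
  then show ?thesis using shift_estimate[of z] by (simp add: nz)
qed

end

subsection \<open>Approximation by averages over small cubes\<close>

text \<open>Half-open, so that the cubes partition the space and membership is decided by
  floors.\<close>

definition cell :: "real \<Rightarrow> ('d::finite \<Rightarrow> int) \<Rightarrow> (real^'d) set" where
  "cell h k = {x. \<forall>i. of_int (k i) * h \<le> x $ i \<and> x $ i < (of_int (k i) + 1) * h}"

lemma cell_measurable [measurable]: "cell h k \<in> sets borel"
proof -
  have "cell h k = (\<Inter>i. {x. of_int (k i) * h \<le> x $ i} \<inter> {x. x $ i < (of_int (k i) + 1) * h})"
    by (auto simp: cell_def)
  also have "\<dots> \<in> sets borel"
    by (intro sets.finite_INT sets.Int borel_closed borel_open closed_Collect_le open_Collect_less
        continuous_intros) auto
  finally show ?thesis .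
qed

lemma cell_floor: "0 < h \<Longrightarrow> x \<in> cell h k \<longleftrightarrow> k = (\<lambda>i. \<lfloor>x $ i / h\<rfloor>)"
proof -
  assume h: "0 < h"
  have "of_int (k i) * h \<le> x $ i \<and> x $ i < (of_int (k i) + 1) * h \<longleftrightarrow> k i = \<lfloor>x $ i / h\<rfloor>" for i
  proof -
    have "k i = \<lfloor>x $ i / h\<rfloor> \<longleftrightarrow> of_int (k i) \<le> x $ i / h \<and> x $ i / h < of_int (k i) + 1"
      using floor_eq_iff[of "x $ i / h" "k i"] by auto
    then show ?thesis using h by (simp add: pos_le_divide_eq pos_divide_less_eq)
  qed
  then show ?thesis by (simp add: cell_def fun_eq_iff)
qed

lemma emeasure_lborel_cube:
  fixes l u :: "real^'d"
  assumes h: "0 \<le> h" and lu: "\<And>i. u $ i = l $ i + h"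
  shows "emeasure lborel (cbox l u) = ennreal (h ^ CARD('d))" "emeasure lborel (box l u) = ennreal (h ^ CARD('d))"
proof -
  have b: "(u - l) \<bullet> b = h" if "b \<in> Basis" for b
    using that lu by (auto simp: Basis_vec_def inner_axis)
  have "l \<bullet> b \<le> u \<bullet> b" if "b \<in> Basis" for b
    using b[OF that] h by (simp add: inner_diff_left)
  then show "emeasure lborel (cbox l u) = ennreal (h ^ CARD('d))" "emeasure lborel (box l u) = ennreal (h ^ CARD('d))"
    by (simp_all add: emeasure_lborel_cbox emeasure_lborel_box b)
qed

text \<open>Comparison with an open box from inside and a closed box from outside.\<close>

lemma emeasure_cell:
  fixes k :: "'d::finite \<Rightarrow> int"
  assumes h: "0 < h"
  shows "ennreal (h ^ CARD('d)) \<le> emeasure lborel (cell h k)" "emeasure lborel (cell h k) < \<infinity>"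
proof -
  define l :: "real^'d" where "l = (\<chi> i. of_int (k i) * h)"
  define u :: "real^'d" where "u = (\<chi> i. (of_int (k i) + 1) * h)"
  have lu: "u $ i = l $ i + h" for i by (simp add: l_def u_def algebra_simps)
  have "box l u \<subseteq> cell h k"
    by (auto simp: cell_def mem_box_cart l_def u_def less_le)
  then have "emeasure lborel (box l u) \<le> emeasure lborel (cell h k)"
    by (rule emeasure_mono) simp
  then show "ennreal (h ^ CARD('d)) \<le> emeasure lborel (cell h k)"
    using emeasure_lborel_cube[OF less_imp_le[OF h] lu] by simp
  have "cell h k \<subseteq> cbox l u"
    by (auto simp: cell_def mem_box_cart l_def u_def less_le)
  then have "emeasure lborel (cell h k) \<le> emeasure lborel (cbox l u)"
    by (rule emeasure_mono) simp
  then show "emeasure lborel (cell h k) < \<infinity>"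
    using emeasure_lborel_cube[OF less_imp_le[OF h] lu] by (simp add: order_le_less_trans)
qed

lemma finite_cells:
  fixes R h :: real
  assumes "0 < h"
  shows "finite {k :: 'd::finite \<Rightarrow> int. \<exists>x\<in>cell h k. norm x \<le> R}"
proof (rule finite_subset)
  define m where "m = \<lceil>R / h\<rceil>"
  show "{k :: 'd \<Rightarrow> int. \<exists>x\<in>cell h k. norm x \<le> R} \<subseteq> (UNIV \<rightarrow>\<^sub>E {- m..m})"
  proof (clarsimp simp: PiE_UNIV_domain)
    fix k :: "'d \<Rightarrow> int" and x i assume x: "x \<in> cell h k" "norm x \<le> R"
    have xi: "- R \<le> x $ i" "x $ i \<le> R" using component_le_norm_cart[of x i] x(2) by linarith+
    have "k i = \<lfloor>x $ i / h\<rfloor>" using x(1) cell_floor[OF assms, of x k] by simp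
    moreover have "x $ i / h \<le> R / h" "- (R / h) \<le> x $ i / h"
      using xi assms by (simp_all add: divide_right_mono pos_le_divide_eq)
    ultimately show "- m \<le> k i \<and> k i \<le> m"
      unfolding m_def by linarith
  qed
qed (intro finite_PiE, auto)

text \<open>\<open>ennreal\<close> sends negative reals to 0. Subadditivity is what survives, and it
  suffices for summing the variance terms, whose sign need not be examined.\<close>

lemma ennreal_add_le: "ennreal (a + b) \<le> ennreal a + ennreal b"
proof -
  have "ennreal (a + b) \<le> ennreal (max 0 a + max 0 b)" by (rule ennreal_leI) auto
  also have "\<dots> = ennreal (max 0 a) + ennreal (max 0 b)" by simp
  also have "\<dots> = ennreal a + ennreal b" by (simp add: max_def ennreal_neg)
  finally show ?thesis .
qed

lemma ennreal_sum_le: "ennreal (sum g A) \<le> (\<Sum>x\<in>A. ennreal (g x))"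
proof (induction A rule: infinite_finite_induct)
  case (insert x A)
  have "ennreal (g x + sum g A) \<le> ennreal (g x) + ennreal (sum g A)" by (rule ennreal_add_le)
  also have "\<dots> \<le> ennreal (g x) + (\<Sum>x\<in>A. ennreal (g x))" by (intro add_left_mono insert.IH)
  finally show ?case using insert by simp
qed simp_all

section \<open>Variances over cells and the finite-rank estimate\<close>

context C1_bounded_support
begin

text \<open>Expanding the square, the double integral is twice the measure of the cell times the
  integral of f^2, minus twice the squared integral of f; the measure is at least h^d.\<close>

lemma cell_variance:
  fixes k :: "'d \<Rightarrow> int"
  assumes h: "0 < h"
  defines "Q \<equiv> indicator (cell h k) :: real^'d \<Rightarrow> real"
  shows "ennreal (2 * h ^ CARD('d) * (LINT x|lborel. Q x * (f x)\<^sup>2) - 2 * (LINT x|lborel. Q x * f x)\<^sup>2)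
    \<le> (\<integral>\<^sup>+x. \<integral>\<^sup>+y. ennreal (Q x * Q y * (f x - f y)\<^sup>2) \<partial>lborel \<partial>lborel)"
proof -
  define m where "m = measure lborel (cell h k)"
  define I where "I = (LINT x|lborel. Q x * f x)"
  define J where "J = (LINT x|lborel. Q x * (f x)\<^sup>2)"
  have iQ: "integrable lborel Q"
    unfolding Q_def using emeasure_cell(2)[OF h, of k] by (intro integrable_real_indicator) auto
  have Qm [measurable]: "Q \<in> borel_measurable borel" unfolding Q_def by measurable
  have mQ: "(LINT x|lborel. Q x) = m" unfolding Q_def m_def by simp
  have Q01: "0 \<le> Q x" "Q x \<le> 1" "Q x * Q x = Q x" for x by (auto simp: Q_def indicator_def)
  have Q_eq: "Q x = 0 \<or> Q x = 1" for x by (auto simp: Q_def indicator_def)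
  have i1: "integrable lborel f"
    by (rule integrable_continuous_bounded_support[OF cont_f supp])
  have iI: "integrable lborel (\<lambda>x. Q x * f x)"
    by (rule Bochner_Integration.integrable_bound[OF i1])
       (use Q01 in \<open>auto simp: abs_mult mult_left_le_one_le\<close>)
  have iJ: "integrable lborel (\<lambda>x. Q x * (f x)\<^sup>2)"
    by (rule Bochner_Integration.integrable_bound[OF integrable_sq])
       (use Q01 in \<open>auto simp: abs_mult mult_left_le_one_le\<close>)
  have J0: "0 \<le> J" unfolding J_def by (rule integral_nonneg_AE) (use Q01 in auto)
  have hm: "h ^ CARD('d) \<le> m"
    using emeasure_cell[OF h, of k] unfolding m_def
    by (metis emeasure_eq_ennreal_measure ennreal_le_iff less_irrefl measure_nonneg infinity_ennreal_def)
  have inner: "(\<integral>\<^sup>+y. ennreal (Q x * Q y * (f x - f y)\<^sup>2) \<partial>lborel) = ennreal (Q x * ((f x)\<^sup>2 * m - 2 * f x * I + J))" for x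
  proof -
    have eq: "Q x * Q y * (f x - f y)\<^sup>2 = Q x * ((f x)\<^sup>2 * Q y - 2 * f x * (Q y * f y) + Q y * (f y)\<^sup>2)" for y
      by (simp add: power2_eq_square algebra_simps)
    have int: "integrable lborel (\<lambda>y. Q x * Q y * (f x - f y)\<^sup>2)"
      unfolding eq by (intro integrable_mult_right Bochner_Integration.integrable_add Bochner_Integration.integrable_diff iQ iI iJ)
    have "(LINT y|lborel. Q x * Q y * (f x - f y)\<^sup>2) = Q x * ((f x)\<^sup>2 * m - 2 * f x * I + J)"
      unfolding eq using iQ iI iJ by (simp add: mQ I_def J_def)
    then show ?thesis
      using nn_integral_eq_integral[OF int] Q01 by (simp add: AE_I2)
  qed
  have eq: "Q x * ((f x)\<^sup>2 * m - 2 * f x * I + J) = m * (Q x * (f x)\<^sup>2) - 2 * I * (Q x * f x) + J * Q x" for x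
    by (simp add: algebra_simps)
  have int: "integrable lborel (\<lambda>x. Q x * ((f x)\<^sup>2 * m - 2 * f x * I + J))"
    unfolding eq by (intro integrable_mult_right Bochner_Integration.integrable_add Bochner_Integration.integrable_diff iQ iI iJ)
  have "(LINT x|lborel. Q x * ((f x)\<^sup>2 * m - 2 * f x * I + J)) = 2 * m * J - 2 * I\<^sup>2"
    unfolding eq using iQ iI iJ by (simp add: mQ power2_eq_square[of I] flip: I_def J_def)
  moreover have "0 \<le> Q x * ((f x)\<^sup>2 * m - 2 * f x * I + J)" for x
  proof -
    have "0 \<le> (LINT y|lborel. Q y * (f x - f y)\<^sup>2)" by (rule integral_nonneg_AE) (use Q01 in auto)
    also have "(LINT y|lborel. Q y * (f x - f y)\<^sup>2) = (LINT y|lborel. (f x)\<^sup>2 * Q y - 2 * f x * (Q y * f y) + Q y * (f y)\<^sup>2)"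
      by (simp add: power2_eq_square algebra_simps)
    also have "\<dots> = (f x)\<^sup>2 * m - 2 * f x * I + J" using iQ iI iJ by (simp add: mQ I_def J_def)
    finally show ?thesis using Q01 by simp
  qed
  ultimately have "(\<integral>\<^sup>+x. \<integral>\<^sup>+y. ennreal (Q x * Q y * (f x - f y)\<^sup>2) \<partial>lborel \<partial>lborel) = ennreal (2 * m * J - 2 * I\<^sup>2)"
    unfolding inner using nn_integral_eq_integral[OF int] by (simp add: AE_I2)
  moreover have "2 * h ^ CARD('d) * J - 2 * I\<^sup>2 \<le> 2 * m * J - 2 * I\<^sup>2"
    using hm J0 by (intro diff_right_mono mult_right_mono mult_left_mono) auto
  ultimately show ?thesis by (simp add: I_def J_def ennreal_leI)
qed

text \<open>Two points of one cell differ by some z in the cube [-h,h]^d. After substituting y = x +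
  z and exchanging the integrals, \<open>shift_estimate\<close> applies for each z, with |z|^2 \<le>
  d h^2, and the cube has volume (2h)^d.\<close>

lemma cell_double_integral:
  fixes KK :: "('d \<Rightarrow> int) set"
  assumes h: "0 < h" and KK: "finite KK"
  shows "(\<Sum>k\<in>KK. \<integral>\<^sup>+x. \<integral>\<^sup>+y. ennreal (indicator (cell h k) x * indicator (cell h k) y * (f x - f y)\<^sup>2) \<partial>lborel \<partial>lborel)
    \<le> ennreal ((2 * h) ^ CARD('d) * (real CARD('d) * h\<^sup>2 * (LINT x|lborel. (norm (G x))\<^sup>2)))"
proof -
  define C :: "(real^'d) set" where "C = cbox (\<chi> i. - h) (\<chi> i. h)"
  define J where "J = (LINT x|lborel. (norm (G x))\<^sup>2)"
  have Cm [measurable]: "C \<in> sets borel" by (simp add: C_def)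
  have meas: "(\<lambda>x. ennreal (indicator (cell h k) x * indicator (cell h k) y * (f x - f y)\<^sup>2)) \<in> borel_measurable borel" for k y
    by measurable
  have m2: "(\<lambda>(x, y). ennreal (indicator (cell h k) x * indicator (cell h k) y * (f x - f y)\<^sup>2)) \<in> borel_measurable (lborel \<Otimes>\<^sub>M lborel)" for k
    by measurable
  have "(\<Sum>k\<in>KK. \<integral>\<^sup>+x. \<integral>\<^sup>+y. ennreal (indicator (cell h k) x * indicator (cell h k) y * (f x - f y)\<^sup>2) \<partial>lborel \<partial>lborel)
      = (\<integral>\<^sup>+x. (\<Sum>k\<in>KK. \<integral>\<^sup>+y. ennreal (indicator (cell h k) x * indicator (cell h k) y * (f x - f y)\<^sup>2) \<partial>lborel) \<partial>lborel)"
    by (intro nn_integral_sum[symmetric] lborel.borel_measurable_nn_integral m2)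
  also have "\<dots> = (\<integral>\<^sup>+x. \<integral>\<^sup>+y. (\<Sum>k\<in>KK. ennreal (indicator (cell h k) x * indicator (cell h k) y * (f x - f y)\<^sup>2)) \<partial>lborel \<partial>lborel)"
    by (intro nn_integral_cong nn_integral_sum[symmetric]) measurable
  also have "\<dots> \<le> (\<integral>\<^sup>+x. \<integral>\<^sup>+y. ennreal (indicator C (y - x) * (f y - f x)\<^sup>2) \<partial>lborel \<partial>lborel)"
  proof (intro nn_integral_mono)
    fix x y :: "real^'d"
    \<comment> \<open>The only cell containing x, so at most this summand is nonzero.\<close>
    define kx where "kx = (\<lambda>i. \<lfloor>x $ i / h\<rfloor>)"
    have "(\<Sum>k\<in>KK. ennreal (indicator (cell h k) x * indicator (cell h k) y * (f x - f y)\<^sup>2))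
        \<le> (\<Sum>k\<in>{kx}. ennreal (indicator (cell h k) x * indicator (cell h k) y * (f x - f y)\<^sup>2))"
    proof -
      define T where "T = (\<lambda>k. ennreal (indicator (cell h k) x * indicator (cell h k) y * (f x - f y)\<^sup>2))"
      have "(\<Sum>k\<in>KK. T k) \<le> (\<Sum>k\<in>insert kx KK. T k)" using KK by (intro sum_mono2) auto
      also have "\<dots> = (\<Sum>k\<in>{kx}. T k)"
        using KK h by (intro sum.mono_neutral_right) (auto simp: T_def indicator_def cell_floor kx_def)
      finally show ?thesis by (simp add: T_def)
    qed
    also have "\<dots> \<le> ennreal (indicator C (y - x) * (f y - f x)\<^sup>2)"
    proof (cases "x \<in> cell h kx \<and> y \<in> cell h kx")
      case True
      have "- h \<le> (y - x) $ i \<and> (y - x) $ i \<le> h" for i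
      proof -
        have "of_int (kx i) * h \<le> x $ i" "x $ i < (of_int (kx i) + 1) * h"
          "of_int (kx i) * h \<le> y $ i" "y $ i < (of_int (kx i) + 1) * h"
          using True by (auto simp: cell_def)
        then show ?thesis by (simp add: algebra_simps)
      qed
      then have "y - x \<in> C" by (simp add: C_def mem_box_cart)
      then show ?thesis using True by (simp add: power2_commute)
    qed auto
    finally show "(\<Sum>k\<in>KK. ennreal (indicator (cell h k) x * indicator (cell h k) y * (f x - f y)\<^sup>2))
        \<le> ennreal (indicator C (y - x) * (f y - f x)\<^sup>2)" .
  qed
  also have "\<dots> = (\<integral>\<^sup>+x. \<integral>\<^sup>+z. ennreal (indicator C z * (f (x + z) - f x)\<^sup>2) \<partial>lborel \<partial>lborel)"
  proof (rule nn_integral_cong)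
    fix x :: "real^'d"
    show "(\<integral>\<^sup>+y. ennreal (indicator C (y - x) * (f y - f x)\<^sup>2) \<partial>lborel) = (\<integral>\<^sup>+z. ennreal (indicator C z * (f (x + z) - f x)\<^sup>2) \<partial>lborel)"
      using nn_integral_lborel_shift[of "\<lambda>y. ennreal (indicator C (y - x) * (f y - f x)\<^sup>2)" x]
      by (simp add: add.commute)
  qed
  also have "\<dots> = (\<integral>\<^sup>+z. \<integral>\<^sup>+x. ennreal (indicator C z * (f (x + z) - f x)\<^sup>2) \<partial>lborel \<partial>lborel)"
    by (rule lborel_pair.Fubini') measurable
  also have "\<dots> \<le> (\<integral>\<^sup>+z. ennreal (real CARD('d) * h\<^sup>2 * J) * indicator C z \<partial>lborel)"
  proof (rule nn_integral_mono)
    fix z :: "real^'d"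
    show "(\<integral>\<^sup>+x. ennreal (indicator C z * (f (x + z) - f x)\<^sup>2) \<partial>lborel) \<le> ennreal (real CARD('d) * h\<^sup>2 * J) * indicator C z"
    proof (cases "z \<in> C")
      case True
      have zi: "(z $ i)\<^sup>2 \<le> h\<^sup>2" for i
        using True h by (intro abs_le_square_iff[THEN iffD1]) (auto simp: C_def mem_box_cart abs_le_iff minus_le_iff)
      have "(norm z)\<^sup>2 = (\<Sum>i\<in>UNIV. (z $ i)\<^sup>2)"
        by (simp add: power2_norm_eq_inner inner_vec_def flip: power2_eq_square)
      also have "\<dots> \<le> real CARD('d) * h\<^sup>2" by (rule sum_le_card_mult) (rule zi)
      finally have nz: "(norm z)\<^sup>2 \<le> real CARD('d) * h\<^sup>2" .
      have "(\<integral>\<^sup>+x. ennreal ((f (x + z) - f x)\<^sup>2) \<partial>lborel) = ennreal (LINT x|lborel. (f (x + z) - f x)\<^sup>2)"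
        by (rule nn_integral_eq_integral[OF integrable_shift_sq]) simp
      also have "\<dots> \<le> ennreal (real CARD('d) * h\<^sup>2 * J)"
      proof (rule ennreal_leI)
        have "(LINT x|lborel. (f (x + z) - f x)\<^sup>2) \<le> (norm z)\<^sup>2 * J"
          unfolding J_def by (rule shift_estimate)
        also have "\<dots> \<le> real CARD('d) * h\<^sup>2 * J"
          by (intro mult_right_mono nz) (simp add: J_def)
        finally show "(LINT x|lborel. (f (x + z) - f x)\<^sup>2) \<le> real CARD('d) * h\<^sup>2 * J" .
      qed
      finally show ?thesis using True by simp
    qed simp
  qed
  also have "\<dots> = ennreal (real CARD('d) * h\<^sup>2 * J) * emeasure lborel C"
    by (rule nn_integral_cmult_indicator) simp
  also have "emeasure lborel C = ennreal ((2 * h) ^ CARD('d))"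
    unfolding C_def by (rule emeasure_lborel_cube) (use h in auto)
  also have "ennreal (real CARD('d) * h\<^sup>2 * J) * ennreal ((2 * h) ^ CARD('d)) = ennreal ((2 * h) ^ CARD('d) * (real CARD('d) * h\<^sup>2 * J))"
    using h by (subst ennreal_mult[symmetric]) (auto simp: J_def mult.commute)
  finally show ?thesis by (simp add: J_def)
qed

text \<open>Sums the variances over the finitely many cells meeting the ball. Division by 2 h^d
  leaves a factor of order h^2 in front of the gradient term; small cells therefore give the
  compactness of the embedding.\<close>

lemma cell_inequality:
  assumes h: "0 < h"
  defines "KK \<equiv> {k :: 'd \<Rightarrow> int. \<exists>x\<in>cell h k. norm x \<le> R}"
  shows "(LINT x|lborel. (f x)\<^sup>2) \<le> (1 / h ^ CARD('d)) * (\<Sum>k\<in>KK. (LINT x|lborel. indicator (cell h k) x * f x)\<^sup>2)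
    + 2 ^ CARD('d) * real CARD('d) / 2 * h\<^sup>2 * (LINT x|lborel. (norm (G x))\<^sup>2)"
proof -
  define I where "I = (\<lambda>k. LINT x|lborel. indicator (cell h k) x * f x)"
  define J where "J = (\<lambda>k. LINT x|lborel. indicator (cell h k) x * (f x)\<^sup>2)"
  define JG where "JG = (LINT x|lborel. (norm (G x))\<^sup>2)"
  define c where "c = h ^ CARD('d)"
  have c: "0 < c" using h by (simp add: c_def)
  have fin: "finite KK" unfolding KK_def by (rule finite_cells[OF h])
  have iJ: "integrable lborel (\<lambda>x. indicator (cell h k) x * (f x)\<^sup>2)" for k
    by (rule Bochner_Integration.integrable_bound[OF integrable_sq]) (auto simp: indicator_def)
  have sum_J: "(\<Sum>k\<in>KK. J k) = (LINT x|lborel. (f x)\<^sup>2)"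
  proof -
    have "(\<Sum>k\<in>KK. indicator (cell h k) x * (f x)\<^sup>2) = (f x)\<^sup>2" for x
    proof (cases "f x = 0")
      case False
      then have x: "norm x \<le> R" using supp by (meson not_le)
      define kx where "kx = (\<lambda>i. \<lfloor>x $ i / h\<rfloor>)"
      have ind: "indicator (cell h k) x = (if k = kx then 1 else 0 :: real)" for k
        using cell_floor[OF h, of x k] by (simp add: indicator_def kx_def)
      have "kx \<in> KK" using x cell_floor[OF h, of x kx] by (auto simp: KK_def kx_def)
      then show ?thesis using fin by (simp add: ind mult_delta_left)
    qed simp
    then have "(LINT x|lborel. (f x)\<^sup>2) = (LINT x|lborel. (\<Sum>k\<in>KK. indicator (cell h k) x * (f x)\<^sup>2))" by simp
    also have "\<dots> = (\<Sum>k\<in>KK. J k)" unfolding J_def by (rule Bochner_Integration.integral_sum) (rule iJ)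
    finally show ?thesis by simp
  qed
  have "ennreal (\<Sum>k\<in>KK. 2 * c * J k - 2 * (I k)\<^sup>2) \<le> (\<Sum>k\<in>KK. ennreal (2 * c * J k - 2 * (I k)\<^sup>2))"
    by (rule ennreal_sum_le)
  also have "\<dots> \<le> (\<Sum>k\<in>KK. \<integral>\<^sup>+x. \<integral>\<^sup>+y. ennreal (indicator (cell h k) x * indicator (cell h k) y * (f x - f y)\<^sup>2) \<partial>lborel \<partial>lborel)"
    unfolding c_def I_def J_def by (intro sum_mono cell_variance h)
  also have "\<dots> \<le> ennreal ((2 * h) ^ CARD('d) * (real CARD('d) * h\<^sup>2 * JG))"
    unfolding JG_def by (rule cell_double_integral[OF h fin])
  finally have "(\<Sum>k\<in>KK. 2 * c * J k - 2 * (I k)\<^sup>2) \<le> (2 * h) ^ CARD('d) * (real CARD('d) * h\<^sup>2 * JG)"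
    using h by (subst (asm) ennreal_le_iff) (auto simp: JG_def)
  then have "2 * c * (\<Sum>k\<in>KK. J k) \<le> 2 * (\<Sum>k\<in>KK. (I k)\<^sup>2) + 2 ^ CARD('d) * c * (real CARD('d) * h\<^sup>2 * JG)"
    by (simp add: sum_subtractf sum_distrib_left power_mult_distrib c_def)
  then have "(\<Sum>k\<in>KK. J k) \<le> (1 / c) * (\<Sum>k\<in>KK. (I k)\<^sup>2) + 2 ^ CARD('d) * real CARD('d) / 2 * h\<^sup>2 * JG"
    using c by (simp add: field_simps)
  then show ?thesis by (simp add: sum_J I_def c_def JG_def)
qed

end

subsection \<open>Uniqueness of weak gradients\<close>

text \<open>The positive and negative parts are densities of two measures that agree on open boxes.
  Boxes are stable under intersection and generate the Borel sets, so the measures, and then the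
  densities, agree.\<close>

lemma AE_zero_if_box_integrals_zero:
  fixes g :: "'a::euclidean_space \<Rightarrow> real"
  assumes g: "integrable lborel g"
    and zero: "\<And>a b. (LINT x|lborel. indicator (box a b) x * g x) = 0"
  shows "AE x in lborel. g x = 0"
proof -
  have [measurable]: "g \<in> borel_measurable borel"
    using borel_measurable_integrable[OF g] by simp
  define p where "p = (\<lambda>x. max 0 (g x))"
  define m where "m = (\<lambda>x. max 0 (- g x))"
  have [measurable]: "p \<in> borel_measurable borel" "m \<in> borel_measurable borel"
    by (simp_all add: p_def m_def)
  have ip: "integrable lborel p" and im: "integrable lborel m"
    unfolding p_def m_def using g by (auto intro: integrable_max)
  have emeasure: "emeasure (density lborel (\<lambda>x. ennreal (f x))) (box a b) = ennreal (LINT x|lborel. indicator (box a b) x * f x)"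
    if f: "integrable lborel f" "\<And>x. 0 \<le> f x" for f :: "'a \<Rightarrow> real" and a b
  proof -
    have [measurable]: "f \<in> borel_measurable borel"
      using borel_measurable_integrable[OF f(1)] by simp
    have i: "integrable lborel (\<lambda>x. indicator (box a b) x * f x)"
      by (rule Bochner_Integration.integrable_bound[OF f(1)]) (auto simp: indicator_def)
    have "emeasure (density lborel (\<lambda>x. ennreal (f x))) (box a b) = (\<integral>\<^sup>+x. ennreal (f x) * indicator (box a b) x \<partial>lborel)"
      by (rule emeasure_density) auto
    also have "\<dots> = (\<integral>\<^sup>+x. ennreal (indicator (box a b) x * f x) \<partial>lborel)"
      by (intro nn_integral_cong) (auto simp: indicator_def)
    also have "\<dots> = ennreal (LINT x|lborel. indicator (box a b) x * f x)"
      by (rule nn_integral_eq_integral[OF i]) (auto simp: f)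
    finally show ?thesis .
  qed
  have "density lborel (\<lambda>x. ennreal (p x)) = density lborel (\<lambda>x. ennreal (m x))"
  proof (rule measure_eqI_generator_eq)
    let ?E = "range (\<lambda>(a, b). box a b::'a set)"
    show "Int_stable ?E" by (auto simp: Int_stable_def box_Int_box)
    show "?E \<subseteq> Pow UNIV" "sets (density lborel (\<lambda>x. ennreal (p x))) = sigma_sets UNIV ?E"
      "sets (density lborel (\<lambda>x. ennreal (m x))) = sigma_sets UNIV ?E"
      by (simp_all add: borel_eq_box)
    let ?A = "\<lambda>n::nat. box (- (real n *\<^sub>R One)) (real n *\<^sub>R One) :: 'a set"
    show "range ?A \<subseteq> ?E" "(\<Union>i. ?A i) = UNIV" unfolding UN_box_eq_UNIV by auto
    show "emeasure (density lborel (\<lambda>x. ennreal (p x))) (?A i) \<noteq> \<infinity>" for i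
      using emeasure[OF ip] by (simp add: p_def)
    show "emeasure (density lborel (\<lambda>x. ennreal (p x))) X = emeasure (density lborel (\<lambda>x. ennreal (m x))) X" if "X \<in> ?E" for X
    proof -
      obtain a b where X: "X = box a b" using \<open>X \<in> ?E\<close> by auto
      have "integrable lborel (\<lambda>x. indicator (box a b) x * p x)" "integrable lborel (\<lambda>x. indicator (box a b) x * m x)"
        by (rule Bochner_Integration.integrable_bound[OF ip], auto simp: indicator_def)
           (rule Bochner_Integration.integrable_bound[OF im], auto simp: indicator_def)
      then have "(LINT x|lborel. indicator (box a b) x * p x) - (LINT x|lborel. indicator (box a b) x * m x)
          = (LINT x|lborel. indicator (box a b) x * p x - indicator (box a b) x * m x)" by simp
      also have "\<dots> = (LINT x|lborel. indicator (box a b) x * g x)"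
        by (intro Bochner_Integration.integral_cong) (auto simp: p_def m_def max_def indicator_def)
      also have "\<dots> = 0" by (rule zero)
      finally show ?thesis using emeasure[OF ip] emeasure[OF im] by (simp add: X p_def m_def)
    qed
  qed
  then have "AE x in lborel. ennreal (p x) = ennreal (m x)"
    by (intro sigma_finite_measure.density_unique[OF sigma_finite_lborel]) auto
  then show ?thesis
    by (rule AE_mp) (auto simp: p_def m_def max_def split: if_splits)
qed

text \<open>The spaces use the completed measure restricted to \<Omega>, while translations act on
  the Borel measure of the whole space; a Borel function vanishing off \<Omega> sees no
  difference.\<close>

lemma integral_lebesgue_on_eq_lborel:
  fixes f :: "real^'d \<Rightarrow> real"
  assumes "open \<Omega>" "f \<in> borel_measurable borel" "\<And>x. x \<notin> \<Omega> \<Longrightarrow> f x = 0"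
  shows "(LINT x|lebesgue_on \<Omega>. f x) = (LINT x|lborel. f x)"
proof -
  have "(LINT x|lebesgue_on \<Omega>. f x) = (LINT x|lebesgue. indicator \<Omega> x *\<^sub>R f x)"
    using assms(1) by (intro integral_restrict_space) auto
  also have "(\<lambda>x. indicator \<Omega> x *\<^sub>R f x) = f"
    using assms(3) by (auto simp: indicator_def fun_eq_iff)
  also have "(LINT x|lebesgue. f x) = (LINT x|lborel. f x)"
    using assms(2) by (intro integral_completion) simp
  finally show ?thesis .
qed

lemma integrable_lebesgue_on_iff_lborel:
  fixes f :: "real^'d \<Rightarrow> real"
  assumes "open \<Omega>" "f \<in> borel_measurable borel" "\<And>x. x \<notin> \<Omega> \<Longrightarrow> f x = 0"
  shows "integrable (lebesgue_on \<Omega>) f \<longleftrightarrow> integrable lborel f"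
proof -
  have "integrable (lebesgue_on \<Omega>) f \<longleftrightarrow> integrable lebesgue (\<lambda>x. indicator \<Omega> x *\<^sub>R f x)"
    using assms(1) by (intro integrable_restrict_space) auto
  also have "(\<lambda>x. indicator \<Omega> x *\<^sub>R f x) = f"
    using assms(3) by (auto simp: indicator_def fun_eq_iff)
  also have "integrable lebesgue f \<longleftrightarrow> integrable lborel f"
    using assms(2) by (intro integrable_completion) simp
  finally show ?thesis .
qed

lemma borel_measurable_lebesgue_on:
  "f \<in> borel_measurable borel \<Longrightarrow> f \<in> borel_measurable (lebesgue_on \<Omega>)"
  by (intro measurable_restrict_space1 measurable_completion) simp

locale bounded_dom =
  fixes \<Omega> :: "(real^'d::finite) set" and R :: real
  assumes dom: "bounded_domain \<Omega>" and R_pos: "0 < R" and \<Omega>_subset: "\<Omega> \<subseteq> cball 0 R"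
begin

lemma \<Omega>_open: "open \<Omega>"
  using dom by (simp add: bounded_domain_def)

sublocale M: finite_measure "lebesgue_on \<Omega>"
  by (rule finite_measure_bounded[OF dom])

lemma test_zero: "\<phi> \<in> test_functions \<Omega> \<Longrightarrow> x \<notin> \<Omega> \<Longrightarrow> \<phi> x = 0"
  using closure_subset[of "{x. \<phi> x \<noteq> 0}"] by (auto simp: test_functions_def)

lemma test_C1: "\<phi> \<in> test_functions \<Omega> \<Longrightarrow> C1_bounded_support \<phi> (grad \<phi>) R"
proof
  assume \<phi>: "\<phi> \<in> test_functions \<Omega>"
  show "(\<phi> has_derivative (\<lambda>h. grad \<phi> x \<bullet> h)) (at x)" for x
    using \<phi> by (rule test_has_derivative)
  show "continuous_on UNIV (grad \<phi>)"
    unfolding grad_def by (intro continuous_on_vec_lambda test_continuous[OF test_partial[OF \<phi>]])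
  show "\<phi> x = 0" if "R < norm x" for x
  proof -
    have "x \<notin> \<Omega>" using \<Omega>_subset that by auto
    then show ?thesis by (rule test_zero[OF \<phi>])
  qed
qed (rule R_pos)

lemma test_grad_zero: "\<phi> \<in> test_functions \<Omega> \<Longrightarrow> x \<notin> \<Omega> \<Longrightarrow> grad \<phi> x = 0"
  using test_zero[OF test_partial] by (simp add: grad_def vec_eq_iff)

lemma test_inner_lborel:
  assumes \<phi>: "\<phi> \<in> test_functions \<Omega>"
  shows "\<phi> \<in> L2 \<Omega>" "grad \<phi> \<in> L2 \<Omega>"
    "L2_inner \<Omega> \<phi> \<phi> = (LINT x|lborel. (\<phi> x)\<^sup>2)"
    "L2_inner \<Omega> (grad \<phi>) (grad \<phi>) = (LINT x|lborel. (norm (grad \<phi> x))\<^sup>2)"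
proof -
  interpret C: C1_bounded_support \<phi> "grad \<phi>" R by (rule test_C1[OF \<phi>])
  have z1: "(norm (\<phi> x))\<^sup>2 = 0" and z2: "(norm (grad \<phi> x))\<^sup>2 = 0" if "x \<notin> \<Omega>" for x
    using test_zero[OF \<phi> that] test_grad_zero[OF \<phi> that] by simp_all
  show "\<phi> \<in> L2 \<Omega>"
    using integrable_lebesgue_on_iff_lborel[OF \<Omega>_open _ z1] C.integrable_sq
    by (simp add: L2_def borel_measurable_lebesgue_on C.f_measurable)
  show "grad \<phi> \<in> L2 \<Omega>"
    using integrable_lebesgue_on_iff_lborel[OF \<Omega>_open _ z2] C.integrable_G_sq
    by (simp add: L2_def borel_measurable_lebesgue_on C.G_measurable)
  show "L2_inner \<Omega> \<phi> \<phi> = (LINT x|lborel. (\<phi> x)\<^sup>2)"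
    using integral_lebesgue_on_eq_lborel[OF \<Omega>_open _ z1]
    by (simp add: L2_inner_def C.f_measurable flip: power2_eq_square)
  show "L2_inner \<Omega> (grad \<phi>) (grad \<phi>) = (LINT x|lborel. (norm (grad \<phi> x))\<^sup>2)"
    using integral_lebesgue_on_eq_lborel[OF \<Omega>_open _ z2]
    by (simp add: L2_inner_def C.G_measurable flip: power2_norm_eq_inner)
qed

lemma component_L2_eq: "(LINT x|lebesgue_on \<Omega>. g x $ i * \<phi> x) = L2_inner \<Omega> g (\<lambda>x. \<phi> x *\<^sub>R axis i 1)"
  by (simp add: L2_inner_def inner_axis mult.commute)

lemma has_weak_gradient_iff:
  "has_weak_gradient \<Omega> u g \<longleftrightarrow> u \<in> L2 \<Omega> \<and> g \<in> L2 \<Omega> \<and> (\<forall>\<phi>\<in>test_functions \<Omega>. \<forall>i.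
     L2_inner \<Omega> u (partial i \<phi>) = - L2_inner \<Omega> g (\<lambda>x. \<phi> x *\<^sub>R axis i 1))"
  unfolding has_weak_gradient_def component_L2_eq by (simp add: L2_inner_def)

lemma test_axis_L2: "\<phi> \<in> test_functions \<Omega> \<Longrightarrow> (\<lambda>x. \<phi> x *\<^sub>R axis i 1 :: real^'d) \<in> L2 \<Omega>"
  using test_inner_lborel(1)[of \<phi>] by (auto simp: L2_def norm_axis_1)

text \<open>The product of two test functions is a test function, and the integral of its derivative
  vanishes.\<close>

lemma has_weak_gradient_test:
  assumes \<phi>: "\<phi> \<in> test_functions \<Omega>"
  shows "has_weak_gradient \<Omega> \<phi> (grad \<phi>)"
  unfolding has_weak_gradient_def
proof (intro conjI ballI allI)
  fix \<psi> i assume \<psi>: "\<psi> \<in> test_functions \<Omega>"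
  define \<eta> where "\<eta> = (\<lambda>x. \<phi> x * \<psi> x)"
  have \<eta>: "\<eta> \<in> test_functions \<Omega>" unfolding \<eta>_def by (rule test_mult[OF \<phi> test_C_k[OF \<psi>]])
  interpret C: C1_bounded_support \<eta> "grad \<eta>" R by (rule test_C1[OF \<eta>])
  have "partial i \<eta> x = partial i \<phi> x * \<psi> x + \<phi> x * partial i \<psi> x" for x
    unfolding \<eta>_def using \<phi> \<psi> by (intro partial_mult test_differentiable)
  then have eq: "grad \<eta> x \<bullet> axis i 1 = partial i \<phi> x * \<psi> x + \<phi> x * partial i \<psi> x" for x
    by (simp add: inner_axis grad_def)
  have int: "integrable (lebesgue_on \<Omega>) (\<lambda>x. partial i \<phi> x * \<psi> x)" "integrable (lebesgue_on \<Omega>) (\<lambda>x. \<phi> x * partial i \<psi> x)"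
    using integrable_L2_inner[OF test_inner_lborel(1)[OF test_partial[OF \<phi>]] test_inner_lborel(1)[OF \<psi>]]
      integrable_L2_inner[OF test_inner_lborel(1)[OF \<phi>] test_inner_lborel(1)[OF test_partial[OF \<psi>]]]
    by simp_all
  have "0 = (LINT x|lborel. grad \<eta> x \<bullet> axis i 1)"
    by (rule C.integral_deriv_zero[symmetric])
  also have "\<dots> = (LINT x|lebesgue_on \<Omega>. grad \<eta> x \<bullet> axis i 1)"
    using C.G_measurable test_grad_zero[OF \<eta>]
    by (intro integral_lebesgue_on_eq_lborel[OF \<Omega>_open, symmetric]) auto
  also have "\<dots> = (LINT x|lebesgue_on \<Omega>. partial i \<phi> x * \<psi> x) + (LINT x|lebesgue_on \<Omega>. \<phi> x * partial i \<psi> x)"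
    using int by (simp add: eq)
  finally show "(LINT x|lebesgue_on \<Omega>. \<phi> x * partial i \<psi> x) = - (LINT x|lebesgue_on \<Omega>. grad \<phi> x $ i * \<psi> x)"
    by (simp add: grad_def)
qed (auto intro: test_inner_lborel \<phi>)

text \<open>The fundamental lemma of the calculus of variations. Smooth bumps give vanishing
  integrals over boxes whose closure lies in \<Omega>, hence g vanishes on each such box, and
  countably many of them cover \<Omega>.\<close>

lemma test_orthogonal_imp_null:
  fixes g :: "real^'d \<Rightarrow> real"
  assumes g: "g \<in> L2 \<Omega>" and orth: "\<And>\<psi>. \<psi> \<in> test_functions \<Omega> \<Longrightarrow> (LINT x|lebesgue_on \<Omega>. g x * \<psi> x) = 0"
  shows "AE x in lebesgue_on \<Omega>. g x = 0"
proof -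
  have one: "(\<lambda>x. 1 :: real) \<in> L2 \<Omega>" by (auto simp: L2_def)
  have gi: "integrable (lebesgue_on \<Omega>) g" using integrable_L2_inner[OF g one] by simp
  then have gm [measurable]: "g \<in> borel_measurable (lebesgue_on \<Omega>)" by (rule borel_measurable_integrable)
  have box_zero: "(LINT x|lebesgue_on \<Omega>. indicator (box a b) x * g x) = 0" if ab: "cbox a b \<subseteq> \<Omega>" for a b
  proof -
    have [measurable]: "box_bump a b n \<in> borel_measurable (lebesgue_on \<Omega>)" for n
      by (intro borel_measurable_lebesgue_on borel_measurable_continuous_onI test_continuous[OF box_bump_test[OF ab]])
    have "(\<lambda>n. LINT x|lebesgue_on \<Omega>. g x * box_bump a b n x) \<longlonglongrightarrow> (LINT x|lebesgue_on \<Omega>. g x * indicator (box a b) x)"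
    proof (rule integral_dominated_convergence[OF _ _ integrable_norm[OF gi]])
      have [measurable]: "(\<lambda>x. indicator (box a b) x :: real) \<in> borel_measurable (lebesgue_on \<Omega>)"
        by (rule borel_measurable_lebesgue_on) simp
      show "(\<lambda>x. g x * indicator (box a b) x) \<in> borel_measurable (lebesgue_on \<Omega>)" by measurable
      show "AE x in lebesgue_on \<Omega>. (\<lambda>n. g x * box_bump a b n x) \<longlonglongrightarrow> g x * indicator (box a b) x"
        by (intro AE_I2 tendsto_intros box_bump_tendsto)
      show "AE x in lebesgue_on \<Omega>. norm (g x * box_bump a b n x) \<le> norm (g x)" for n
        by (intro AE_I2) (simp add: abs_mult box_bump_bounds mult_left_le)
    qed measurable
    then show ?thesis by (simp add: orth box_bump_test[OF ab] LIMSEQ_const_iff mult.commute)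
  qed
  \<comment> \<open>Extension by zero; the Borel representative \<open>g0\<close> is then accessible
    to the statement about boxes.\<close>
  define g1 where "g1 = (\<lambda>x. indicator \<Omega> x *\<^sub>R g x)"
  have g1m: "g1 \<in> borel_measurable lebesgue"
    unfolding g1_def using gm \<Omega>_open by (subst borel_measurable_restrict_space_iff[symmetric]) auto
  then obtain g0 where g0 [measurable]: "g0 \<in> borel_measurable borel" and g10: "AE x in lborel. g1 x = g0 x"
    using completion_ex_borel_measurable_real[of g1 lborel] by auto
  have g1i: "integrable lebesgue g1"
    unfolding g1_def using gi \<Omega>_open by (subst integrable_restrict_space[symmetric]) auto
  have g0i: "integrable lborel g0"
  proof -
    have "integrable lebesgue g0"
      using g1i integrable_cong_AE_imp[of lebesgue g1 g0] g10 g0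
      by (auto simp: AE_completion eq_commute measurable_completion)
    then show ?thesis by (simp add: integrable_completion)
  qed
  have AE_box: "AE x in lborel. x \<in> box a b \<longrightarrow> g0 x = 0" if ab: "cbox a b \<subseteq> \<Omega>" for a b
  proof -
    have "AE x in lborel. indicator (box a b) x * g0 x = 0"
    proof (rule AE_zero_if_box_integrals_zero)
      show "integrable lborel (\<lambda>x. indicator (box a b) x * g0 x)"
        by (rule Bochner_Integration.integrable_bound[OF g0i]) (auto simp: indicator_def)
      fix p q :: "real^'d"
      \<comment> \<open>Cutting an arbitrary box with the fixed one gives a box again, and its
        closure is still inside \<Omega> if it is nonempty.\<close>
      obtain c d where cd: "box p q \<inter> box a b = box c d" using box_Int_box by blast
      have eq: "indicator (box p q) x * (indicator (box a b) x * g0 x) = indicator (box c d) x * g0 x" for x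
        unfolding cd[symmetric] by (auto simp: indicator_def)
      show "(LINT x|lborel. indicator (box p q) x * (indicator (box a b) x * g0 x)) = 0"
      proof (cases "box c d = {}")
        case False
        have "box c d \<subseteq> box a b" using cd by auto
        then have "closure (box c d) \<subseteq> cbox a b"
          using box_subset_cbox[of a b] by (intro closure_minimal) auto
        then have sub: "cbox c d \<subseteq> \<Omega>" using False ab by (simp add: closure_box)
        have "(LINT x|lborel. indicator (box c d) x * g0 x) = (LINT x|lebesgue. indicator (box c d) x * g0 x)"
          by (rule integral_completion[symmetric]) measurable
        also have "\<dots> = (LINT x|lebesgue. indicator \<Omega> x *\<^sub>R (indicator (box c d) x * g x))"
        proof (rule integral_cong_AE)
          show "(\<lambda>x. indicator (box c d) x * g0 x) \<in> borel_measurable lebesgue"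
            by (rule measurable_completion) measurable
          have "(\<lambda>x. indicator (box c d) x :: real) \<in> borel_measurable lebesgue"
            by (rule measurable_completion) measurable
          then have "(\<lambda>x. indicator (box c d) x * g1 x) \<in> borel_measurable lebesgue"
            using g1m by (rule borel_measurable_times)
          then show "(\<lambda>x. indicator \<Omega> x *\<^sub>R (indicator (box c d) x * g x)) \<in> borel_measurable lebesgue"
            by (simp add: g1_def mult.left_commute)
          show "AE x in lebesgue. indicator (box c d) x * g0 x = indicator \<Omega> x *\<^sub>R (indicator (box c d) x * g x)"
            using AE_completion[OF g10] by (rule AE_mp) (auto simp: g1_def)
        qed
        also have "\<dots> = (LINT x|lebesgue_on \<Omega>. indicator (box c d) x * g x)"
          using \<Omega>_open by (intro integral_restrict_space[symmetric]) auto
        also have "\<dots> = 0" by (rule box_zero[OF sub])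
        finally show ?thesis by (simp only: eq)
      qed (simp add: eq)
    qed
    then show ?thesis by (rule AE_mp) (auto simp: indicator_def)
  qed
  \<comment> \<open>The cover consists of closed boxes; their boundaries are null sets and do not
    matter.\<close>
  obtain \<D> where D: "countable \<D>" "\<D> \<subseteq> Pow \<Omega>" "\<And>X. X \<in> \<D> \<Longrightarrow> \<exists>a b. X = cbox a b" "\<Union>\<D> = \<Omega>"
    using open_countable_Union_open_cbox[OF \<Omega>_open] by blast
  have "AE x in lborel. \<forall>X\<in>\<D>. x \<in> X \<longrightarrow> g0 x = 0"
  proof (rule AE_ball_countable'[OF _ D(1)])
    fix X assume X: "X \<in> \<D>"
    then obtain a b where ab: "X = cbox a b" using D(3) by blast
    have "AE x in lborel. x \<notin> cbox a b - box a b"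
      by (intro AE_not_in) (auto simp: null_sets_def emeasure_lborel_cbox_eq emeasure_lborel_box_eq emeasure_Diff box_subset_cbox)
    moreover have "AE x in lborel. x \<in> box a b \<longrightarrow> g0 x = 0"
      using X D(2) ab by (intro AE_box) auto
    ultimately show "AE x in lborel. x \<in> X \<longrightarrow> g0 x = 0" by eventually_elim (auto simp: ab)
  qed
  then have "AE x in lborel. x \<in> \<Omega> \<longrightarrow> g x = 0"
    using g10 by eventually_elim (use D(4) in \<open>auto simp: g1_def indicator_def\<close>)
  then show ?thesis
    using \<Omega>_open by (subst AE_restrict_space_iff) (auto dest: AE_completion)
qed

lemma component_L2: "g \<in> L2 \<Omega> \<Longrightarrow> (\<lambda>x. g x $ i) \<in> L2 \<Omega>" for g :: "real^'d \<Rightarrow> real^'d"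
proof -
  assume g: "g \<in> L2 \<Omega>"
  then have [measurable]: "g \<in> borel_measurable (lebesgue_on \<Omega>)" by (simp add: L2_def)
  have gi: "(\<lambda>x. g x $ i) \<in> borel_measurable (lebesgue_on \<Omega>)"
    by (intro borel_measurable_continuous_on[where f = "\<lambda>y. y $ i"] continuous_intros) measurable
  moreover have "integrable (lebesgue_on \<Omega>) (\<lambda>x. (g x $ i)\<^sup>2)"
  proof (rule Bochner_Integration.integrable_bound)
    show "integrable (lebesgue_on \<Omega>) (\<lambda>x. (norm (g x))\<^sup>2)" using g by (simp add: L2_def)
    show "AE x in lebesgue_on \<Omega>. norm ((g x $ i)\<^sup>2) \<le> norm ((norm (g x))\<^sup>2)"
      by (intro AE_I2) (simp add: component_le_norm_cart abs_le_square_iff[symmetric])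
  qed (use gi in measurable)
  ultimately show ?thesis by (simp add: L2_def)
qed

text \<open>\<open>weak_gradient\<close> is chosen by \<open>SOME\<close>. This makes norms of
  gradients independent of the choice, so that convenient gradients such as
  \<open>grad \<phi>\<close> or limits can be used.\<close>

lemma weak_gradient_unique:
  assumes "has_weak_gradient \<Omega> u g" "has_weak_gradient \<Omega> u g'"
  shows "L2_inner \<Omega> (g - g') (g - g') = 0"
proof -
  have gg: "g \<in> L2 \<Omega>" "g' \<in> L2 \<Omega>" using assms by (auto simp: has_weak_gradient_def)
  have "AE x in lebesgue_on \<Omega>. (g - g') x $ i = 0" for i
  proof (rule test_orthogonal_imp_null)
    show "(\<lambda>x. (g - g') x $ i) \<in> L2 \<Omega>" by (intro component_L2 L2.mem gg)
    fix \<psi> assume \<psi>: "\<psi> \<in> test_functions \<Omega>"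
    have "L2_inner \<Omega> g (\<lambda>x. \<psi> x *\<^sub>R axis i 1) = L2_inner \<Omega> g' (\<lambda>x. \<psi> x *\<^sub>R axis i 1)"
    proof -
      have "L2_inner \<Omega> u (partial i \<psi>) = - L2_inner \<Omega> g (\<lambda>x. \<psi> x *\<^sub>R axis i 1)"
        using assms(1) \<psi> unfolding has_weak_gradient_iff by blast
      moreover have "L2_inner \<Omega> u (partial i \<psi>) = - L2_inner \<Omega> g' (\<lambda>x. \<psi> x *\<^sub>R axis i 1)"
        using assms(2) \<psi> unfolding has_weak_gradient_iff by blast
      ultimately show ?thesis by linarith
    qed
    then have "L2_inner \<Omega> (g - g') (\<lambda>x. \<psi> x *\<^sub>R axis i 1) = 0"
      using \<psi> by (simp add: L2.diff_left gg test_axis_L2)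
    then show "(LINT x|lebesgue_on \<Omega>. (g - g') x $ i * \<psi> x) = 0"
      unfolding component_L2_eq .
  qed
  then have "AE x in lebesgue_on \<Omega>. \<forall>i\<in>UNIV. (g - g') x $ i = 0"
    by (intro AE_finite_allI) auto
  then have "AE x in lebesgue_on \<Omega>. (g - g') x = 0"
    by (rule AE_mp) (auto simp: vec_eq_iff)
  then show ?thesis by (rule AE_null_L2)
qed

end

subsection \<open>The space \<open>H\<^sub>0\<^sup>1(\<Omega>)\<close>\<close>

context bounded_dom
begin

lemma has_weak_gradient_add:
  assumes "has_weak_gradient \<Omega> u g" "has_weak_gradient \<Omega> v h"
  shows "has_weak_gradient \<Omega> (u + v) (g + h)"
  using assms unfolding has_weak_gradient_iff
  by (simp add: L2.add_left test_axis_L2 test_partial test_inner_lborel(1))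

lemma has_weak_gradient_scale:
  assumes "has_weak_gradient \<Omega> u g"
  shows "has_weak_gradient \<Omega> (c *\<^sub>R u) (c *\<^sub>R g)"
  using assms unfolding has_weak_gradient_iff
  by (simp add: L2.scale_left test_axis_L2 test_partial test_inner_lborel(1))

lemma has_weak_gradient_diff:
  assumes "has_weak_gradient \<Omega> u g" "has_weak_gradient \<Omega> v h"
  shows "has_weak_gradient \<Omega> (u - v) (g - h)"
  using has_weak_gradient_add[OF assms(1) has_weak_gradient_scale[OF assms(2), of "-1"]] by simp

lemma has_weak_gradient_L2: "has_weak_gradient \<Omega> u g \<Longrightarrow> u \<in> L2 \<Omega>" "has_weak_gradient \<Omega> u g \<Longrightarrow> g \<in> L2 \<Omega>"
  by (simp_all add: has_weak_gradient_def)

lemma H1_weak_gradient: "u \<in> H1 \<Omega> \<Longrightarrow> has_weak_gradient \<Omega> u (weak_gradient \<Omega> u)"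
  unfolding weak_gradient_def H1_def by (auto intro: someI[of "has_weak_gradient \<Omega> u"])

lemma H10_weak_gradient: "u \<in> H10 \<Omega> \<Longrightarrow> has_weak_gradient \<Omega> u (weak_gradient \<Omega> u)"
  by (simp add: H10_def H1_weak_gradient)

lemma weak_gradient_inner_eq:
  assumes "has_weak_gradient \<Omega> u g"
  shows "L2_inner \<Omega> (weak_gradient \<Omega> u) (weak_gradient \<Omega> u) = L2_inner \<Omega> g g"
proof -
  have wg: "has_weak_gradient \<Omega> u (weak_gradient \<Omega> u)"
    using assms by (intro H1_weak_gradient) (auto simp: H1_def)
  show ?thesis
    using has_weak_gradient_L2(2)[OF wg] has_weak_gradient_L2(2)[OF assms] weak_gradient_unique[OF wg assms]
    by (rule L2.null_diff)
qed

text \<open>The squared H1 distance, expressed with a given weak gradient of u rather than the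
  chosen gradient of the difference.\<close>

definition energy_dist :: "(real^'d \<Rightarrow> real) \<Rightarrow> (real^'d \<Rightarrow> real^'d) \<Rightarrow> (real^'d \<Rightarrow> real) \<Rightarrow> real" where
  "energy_dist u g \<phi> = L2_inner \<Omega> (\<phi> - u) (\<phi> - u) + L2_inner \<Omega> (grad \<phi> - g) (grad \<phi> - g)"

lemma energy_dist_nonneg:
  assumes "has_weak_gradient \<Omega> u g" "\<phi> \<in> test_functions \<Omega>"
  shows "0 \<le> L2_inner \<Omega> (\<phi> - u) (\<phi> - u)" "0 \<le> L2_inner \<Omega> (grad \<phi> - g) (grad \<phi> - g)"
  using has_weak_gradient_L2[OF assms(1)] test_inner_lborel(1,2)[OF assms(2)]
  by (auto intro: L2.nonneg)

lemma H1_norm_eq: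
  assumes u: "has_weak_gradient \<Omega> u g" and \<phi>: "\<phi> \<in> test_functions \<Omega>"
  shows "H1_norm \<Omega> (\<lambda>x. u x - \<phi> x) = sqrt (energy_dist u g \<phi>)"
proof -
  have eq: "(\<lambda>x. u x - \<phi> x) = u - \<phi>" by (simp add: fun_eq_iff)
  have hw: "has_weak_gradient \<Omega> (u - \<phi>) (g - grad \<phi>)"
    by (rule has_weak_gradient_diff[OF u has_weak_gradient_test[OF \<phi>]])
  have L: "u \<in> L2 \<Omega>" "g \<in> L2 \<Omega>" "\<phi> \<in> L2 \<Omega>" "grad \<phi> \<in> L2 \<Omega>"
    using has_weak_gradient_L2[OF u] test_inner_lborel(1,2)[OF \<phi>] by auto
  have wg: "weak_gradient \<Omega> (u - \<phi>) \<in> L2 \<Omega>"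
    by (rule has_weak_gradient_L2(2)[OF H1_weak_gradient]) (use hw in \<open>auto simp: H1_def\<close>)
  have "(L2_norm \<Omega> (u - \<phi>))\<^sup>2 = L2_inner \<Omega> (\<phi> - u) (\<phi> - u)"
    using L L2.snorm_minus_commute[of u \<Omega> \<phi>] by (simp add: L2_norm_eq_snorm L2.snorm_square)
  moreover have "(L2_norm \<Omega> (weak_gradient \<Omega> (u - \<phi>)))\<^sup>2 = L2_inner \<Omega> (g - grad \<phi>) (g - grad \<phi>)"
    using wg by (simp add: L2_norm_eq_snorm L2.snorm_square weak_gradient_inner_eq[OF hw])
  moreover have "L2_inner \<Omega> (g - grad \<phi>) (g - grad \<phi>) = L2_inner \<Omega> (grad \<phi> - g) (grad \<phi> - g)"
    using L L2.snorm_minus_commute[of g \<Omega> "grad \<phi>"] by (simp flip: L2.snorm_square)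
  ultimately show ?thesis by (simp add: H1_norm_def eq energy_dist_def)
qed

lemma H10_iff:
  assumes u: "has_weak_gradient \<Omega> u g"
  shows "u \<in> H10 \<Omega> \<longleftrightarrow> (\<forall>e>0. \<exists>\<phi>\<in>test_functions \<Omega>. energy_dist u g \<phi> < e)"
proof -
  have "u \<in> H10 \<Omega> \<longleftrightarrow> (\<forall>e>0. \<exists>\<phi>\<in>test_functions \<Omega>. sqrt (energy_dist u g \<phi>) < e)"
    using u by (auto simp: H10_def H1_def H1_norm_eq)
  also have "\<dots> \<longleftrightarrow> (\<forall>e>0. \<exists>\<phi>\<in>test_functions \<Omega>. energy_dist u g \<phi> < e)"
  proof safe
    fix e :: real assume e: "0 < e" and *: "\<forall>e>0. \<exists>\<phi>\<in>test_functions \<Omega>. sqrt (energy_dist u g \<phi>) < e"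
    then obtain \<phi> where "\<phi> \<in> test_functions \<Omega>" "sqrt (energy_dist u g \<phi>) < sqrt e"
      by (meson real_sqrt_gt_zero)
    then show "\<exists>\<phi>\<in>test_functions \<Omega>. energy_dist u g \<phi> < e" by auto
  next
    fix e :: real assume e: "0 < e" and *: "\<forall>e>0. \<exists>\<phi>\<in>test_functions \<Omega>. energy_dist u g \<phi> < e"
    then obtain \<phi> where \<phi>: "\<phi> \<in> test_functions \<Omega>" "energy_dist u g \<phi> < e\<^sup>2"
      by (meson zero_less_power)
    then have "sqrt (energy_dist u g \<phi>) < e" using e by (simp add: real_less_lsqrt)
    then show "\<exists>\<phi>\<in>test_functions \<Omega>. sqrt (energy_dist u g \<phi>) < e" using \<phi> by auto
  qed
  finally show ?thesis .
qed

lemma H10_approx: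
  assumes u: "u \<in> H10 \<Omega>" and g: "has_weak_gradient \<Omega> u g"
  obtains \<phi> :: "nat \<Rightarrow> real^'d \<Rightarrow> real" where "\<And>n. \<phi> n \<in> test_functions \<Omega>"
    "(\<lambda>n. L2_inner \<Omega> (\<phi> n - u) (\<phi> n - u)) \<longlonglongrightarrow> 0"
    "(\<lambda>n. L2_inner \<Omega> (grad (\<phi> n) - g) (grad (\<phi> n) - g)) \<longlonglongrightarrow> 0"
proof -
  have "\<exists>\<phi>\<in>test_functions \<Omega>. energy_dist u g \<phi> < inverse (real (Suc n))" for n
    using u unfolding H10_iff[OF g] by simp
  then obtain \<phi> where \<phi>: "\<And>n. \<phi> n \<in> test_functions \<Omega>" "\<And>n. energy_dist u g (\<phi> n) < inverse (real (Suc n))"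
    by metis
  have le: "norm (L2_inner \<Omega> (\<phi> n - u) (\<phi> n - u)) \<le> inverse (real (Suc n))"
    "norm (L2_inner \<Omega> (grad (\<phi> n) - g) (grad (\<phi> n) - g)) \<le> inverse (real (Suc n))" for n
    using energy_dist_nonneg[OF g \<phi>(1)[of n]] \<phi>(2)[of n] by (simp_all add: energy_dist_def)
  have "(\<lambda>n. L2_inner \<Omega> (\<phi> n - u) (\<phi> n - u)) \<longlonglongrightarrow> 0"
    by (rule Lim_null_comparison[OF always_eventually[OF allI[OF le(1)]] LIMSEQ_inverse_real_of_nat])
  moreover have "(\<lambda>n. L2_inner \<Omega> (grad (\<phi> n) - g) (grad (\<phi> n) - g)) \<longlonglongrightarrow> 0"
    by (rule Lim_null_comparison[OF always_eventually[OF allI[OF le(2)]] LIMSEQ_inverse_real_of_nat])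
  ultimately show ?thesis using \<phi>(1) by (intro that)
qed

lemma test_zero_mem: "0 \<in> test_functions \<Omega>"
  by (simp add: test_functions_def zero_fun_def C_k_const)

lemma test_H10:
  assumes "\<phi> \<in> test_functions \<Omega>"
  shows "\<phi> \<in> H10 \<Omega>"
  unfolding H10_iff[OF has_weak_gradient_test[OF assms]]
  using assms by (intro allI impI bexI[of _ \<phi>]) (auto simp: energy_dist_def L2_inner_def)

lemma H10_add:
  assumes u: "u \<in> H10 \<Omega>" and v: "v \<in> H10 \<Omega>"
  shows "u + v \<in> H10 \<Omega>"
proof -
  define g where "g = weak_gradient \<Omega> u"
  define h where "h = weak_gradient \<Omega> v"
  have g: "has_weak_gradient \<Omega> u g" and h: "has_weak_gradient \<Omega> v h"
    using u v by (simp_all add: g_def h_def H10_weak_gradient)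
  note gh = has_weak_gradient_add[OF g h]
  show ?thesis unfolding H10_iff[OF gh]
  proof (intro allI impI)
    fix e :: real assume e: "0 < e"
    obtain \<phi> where \<phi>: "\<phi> \<in> test_functions \<Omega>" "energy_dist u g \<phi> < e / 4"
      using u e unfolding H10_iff[OF g] by (meson zero_less_divide_iff zero_less_numeral)
    obtain \<psi> where \<psi>: "\<psi> \<in> test_functions \<Omega>" "energy_dist v h \<psi> < e / 4"
      using v e unfolding H10_iff[OF h] by (meson zero_less_divide_iff zero_less_numeral)
    have L: "u \<in> L2 \<Omega>" "g \<in> L2 \<Omega>" "v \<in> L2 \<Omega>" "h \<in> L2 \<Omega>" "\<phi> \<in> L2 \<Omega>" "grad \<phi> \<in> L2 \<Omega>" "\<psi> \<in> L2 \<Omega>" "grad \<psi> \<in> L2 \<Omega>"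
      using has_weak_gradient_L2[OF g] has_weak_gradient_L2[OF h] test_inner_lborel(1,2)[OF \<phi>(1)] test_inner_lborel(1,2)[OF \<psi>(1)]
      by auto
    have sum: "\<phi> + \<psi> = (\<lambda>x. \<phi> x + \<psi> x)" by (simp add: fun_eq_iff)
    have grad_sum: "grad (\<phi> + \<psi>) = grad \<phi> + grad \<psi>"
      unfolding sum using grad_add[OF \<phi>(1) \<psi>(1)] by (simp add: fun_eq_iff)
    have 1: "(\<phi> + \<psi>) - (u + v) = (\<phi> - u) + (\<psi> - v)" and 2: "(grad \<phi> + grad \<psi>) - (g + h) = (grad \<phi> - g) + (grad \<psi> - h)"
      by simp_all
    have "energy_dist (u + v) (g + h) (\<phi> + \<psi>) \<le> 2 * energy_dist u g \<phi> + 2 * energy_dist v h \<psi>"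
      unfolding energy_dist_def grad_sum 1 2
      using L2.square_sum_le[of "\<phi> - u" \<Omega> "\<psi> - v"] L2.square_sum_le[of "grad \<phi> - g" \<Omega> "grad \<psi> - h"] L by simp
    also have "\<dots> < e" using \<phi> \<psi> by simp
    finally show "\<exists>\<phi>\<in>test_functions \<Omega>. energy_dist (u + v) (g + h) \<phi> < e"
      using test_add[OF \<phi>(1) \<psi>(1)] by (auto simp flip: sum)
  qed
qed

lemma H10_scale:
  assumes u: "u \<in> H10 \<Omega>"
  shows "c *\<^sub>R u \<in> H10 \<Omega>"
proof -
  define g where "g = weak_gradient \<Omega> u"
  have g: "has_weak_gradient \<Omega> u g" using u by (simp add: g_def H10_weak_gradient)
  show ?thesis unfolding H10_iff[OF has_weak_gradient_scale[OF g]]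
  proof (intro allI impI)
    fix e :: real assume e: "0 < e"
    then obtain \<phi> where \<phi>: "\<phi> \<in> test_functions \<Omega>" "energy_dist u g \<phi> < e / (c\<^sup>2 + 1)"
      using u unfolding H10_iff[OF g] by (meson divide_pos_pos add_nonneg_pos zero_le_power2 zero_less_one)
    have L: "u \<in> L2 \<Omega>" "g \<in> L2 \<Omega>" "\<phi> \<in> L2 \<Omega>" "grad \<phi> \<in> L2 \<Omega>"
      using has_weak_gradient_L2[OF g] test_inner_lborel(1,2)[OF \<phi>(1)] by auto
    have cp: "c *\<^sub>R \<phi> = (\<lambda>x. c * \<phi> x)" by (simp add: scaleR_fun_def)
    have grad_c: "grad (c *\<^sub>R \<phi>) = c *\<^sub>R grad \<phi>"
      unfolding cp using grad_scale[OF \<phi>(1)] by (simp add: fun_eq_iff scaleR_fun_def)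
    have "energy_dist (c *\<^sub>R u) (c *\<^sub>R g) (c *\<^sub>R \<phi>) = c\<^sup>2 * energy_dist u g \<phi>"
      unfolding energy_dist_def grad_c
      using L by (simp add: L2.scale_left L2.scale_right distrib_left power2_eq_square flip: scaleR_diff_right)
    also have "\<dots> \<le> (c\<^sup>2 + 1) * energy_dist u g \<phi>"
      using energy_dist_nonneg[OF g \<phi>(1)] by (intro mult_right_mono) (auto simp: energy_dist_def)
    also have "\<dots> < e"
    proof -
      have "0 < c\<^sup>2 + 1" by (simp add: add_nonneg_pos)
      then show ?thesis using \<phi>(2) by (simp add: pos_less_divide_eq mult.commute)
    qed
    finally show "\<exists>\<phi>\<in>test_functions \<Omega>. energy_dist (c *\<^sub>R u) (c *\<^sub>R g) \<phi> < e"
      using test_scale[OF \<phi>(1), of c] by (auto simp flip: cp)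
  qed
qed

lemma subspace_H10: "subspace (H10 \<Omega>)"
  by (rule subspaceI) (auto intro: H10_add H10_scale test_H10 test_zero_mem)

lemma H10_L2: "u \<in> H10 \<Omega> \<Longrightarrow> u \<in> L2 \<Omega>"
  by (rule has_weak_gradient_L2(1)[OF H10_weak_gradient])

lemma H10_Poincare:
  assumes u: "u \<in> H10 \<Omega>" and g: "has_weak_gradient \<Omega> u g"
  shows "L2_inner \<Omega> u u \<le> (2 * R + 1)\<^sup>2 / 2 * L2_inner \<Omega> g g"
proof -
  obtain \<phi> :: "nat \<Rightarrow> real^'d \<Rightarrow> real" where \<phi>: "\<And>n. \<phi> n \<in> test_functions \<Omega>"
    and lim: "(\<lambda>n. L2_inner \<Omega> (\<phi> n - u) (\<phi> n - u)) \<longlonglongrightarrow> 0" "(\<lambda>n. L2_inner \<Omega> (grad (\<phi> n) - g) (grad (\<phi> n) - g)) \<longlonglongrightarrow> 0"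
    using H10_approx[OF u g] by blast
  have "(\<lambda>n. L2_inner \<Omega> (\<phi> n) (\<phi> n)) \<longlonglongrightarrow> L2_inner \<Omega> u u"
    by (rule L2.tendsto_square[OF test_inner_lborel(1)[OF \<phi>] has_weak_gradient_L2(1)[OF g] lim(1)])
  moreover have "(\<lambda>n. (2 * R + 1)\<^sup>2 / 2 * L2_inner \<Omega> (grad (\<phi> n)) (grad (\<phi> n))) \<longlonglongrightarrow> (2 * R + 1)\<^sup>2 / 2 * L2_inner \<Omega> g g"
    by (intro tendsto_mult_left L2.tendsto_square[OF test_inner_lborel(2)[OF \<phi>] has_weak_gradient_L2(2)[OF g] lim(2)])
  moreover have "L2_inner \<Omega> (\<phi> n) (\<phi> n) \<le> (2 * R + 1)\<^sup>2 / 2 * L2_inner \<Omega> (grad (\<phi> n)) (grad (\<phi> n))" for n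
    using C1_bounded_support.Poincare[OF test_C1[OF \<phi>]] by (simp add: test_inner_lborel[OF \<phi>])
  ultimately show ?thesis by (intro LIMSEQ_le) auto
qed

lemma indicator_L2: "A \<in> sets borel \<Longrightarrow> (indicator A :: real^'d \<Rightarrow> real) \<in> L2 \<Omega>" for A :: "(real^'d) set"
proof -
  assume A: "A \<in> sets borel"
  have m: "(indicator A :: real^'d \<Rightarrow> real) \<in> borel_measurable (lebesgue_on \<Omega>)"
    using A by (intro borel_measurable_lebesgue_on) simp
  have "integrable (lebesgue_on \<Omega>) (indicator A :: real^'d \<Rightarrow> real)"
    using m by (intro M.integrable_const_bound[where B = 1]) (auto simp: indicator_def)
  moreover have "(\<lambda>x. (norm (indicator A x :: real))\<^sup>2) = indicator A"
    by (auto simp: fun_eq_iff indicator_def)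
  ultimately have "integrable (lebesgue_on \<Omega>) (\<lambda>x. (norm (indicator A x :: real))\<^sup>2)"
    by (simp only:)
  then show ?thesis using m by (simp add: L2_def)
qed

lemma H10_cell_inequality:
  assumes h: "0 < h" and u: "u \<in> H10 \<Omega>" and g: "has_weak_gradient \<Omega> u g"
  defines "KK \<equiv> {k :: 'd \<Rightarrow> int. \<exists>x\<in>cell h k. norm x \<le> R}"
  shows "L2_inner \<Omega> u u \<le> (1 / h ^ CARD('d)) * (\<Sum>k\<in>KK. (L2_inner \<Omega> u (indicator (cell h k)))\<^sup>2)
    + 2 ^ CARD('d) * real CARD('d) / 2 * h\<^sup>2 * L2_inner \<Omega> g g"
proof -
  obtain \<phi> :: "nat \<Rightarrow> real^'d \<Rightarrow> real" where \<phi>: "\<And>n. \<phi> n \<in> test_functions \<Omega>"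
    and lim: "(\<lambda>n. L2_inner \<Omega> (\<phi> n - u) (\<phi> n - u)) \<longlonglongrightarrow> 0" "(\<lambda>n. L2_inner \<Omega> (grad (\<phi> n) - g) (grad (\<phi> n) - g)) \<longlonglongrightarrow> 0"
    using H10_approx[OF u g] by blast
  define c where "c = 2 ^ CARD('d) * real CARD('d) / 2 * h\<^sup>2"
  have cell_eq: "(LINT x|lborel. indicator (cell h k) x * \<phi> n x) = L2_inner \<Omega> (\<phi> n) (indicator (cell h k))" for k n
  proof -
    interpret C: C1_bounded_support "\<phi> n" "grad (\<phi> n)" R by (rule test_C1[OF \<phi>])
    have "(LINT x|lebesgue_on \<Omega>. indicator (cell h k) x * \<phi> n x) = (LINT x|lborel. indicator (cell h k) x * \<phi> n x)"
      by (rule integral_lebesgue_on_eq_lborel[OF \<Omega>_open]) (auto simp: test_zero[OF \<phi>] C.f_measurable)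
    then show ?thesis by (simp add: L2_inner_def mult.commute)
  qed
  have "(\<lambda>n. L2_inner \<Omega> (\<phi> n) (\<phi> n)) \<longlonglongrightarrow> L2_inner \<Omega> u u"
    by (rule L2.tendsto_square[OF test_inner_lborel(1)[OF \<phi>] has_weak_gradient_L2(1)[OF g] lim(1)])
  moreover have "(\<lambda>n. (1 / h ^ CARD('d)) * (\<Sum>k\<in>KK. (L2_inner \<Omega> (\<phi> n) (indicator (cell h k)))\<^sup>2) + c * L2_inner \<Omega> (grad (\<phi> n)) (grad (\<phi> n)))
      \<longlonglongrightarrow> (1 / h ^ CARD('d)) * (\<Sum>k\<in>KK. (L2_inner \<Omega> u (indicator (cell h k)))\<^sup>2) + c * L2_inner \<Omega> g g"
    by (intro tendsto_add tendsto_mult_left tendsto_sum tendsto_power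
        L2.tendsto_left[OF test_inner_lborel(1)[OF \<phi>] has_weak_gradient_L2(1)[OF g] indicator_L2[OF cell_measurable] lim(1)]
        L2.tendsto_square[OF test_inner_lborel(2)[OF \<phi>] has_weak_gradient_L2(2)[OF g] lim(2)])
  moreover have "L2_inner \<Omega> (\<phi> n) (\<phi> n) \<le> (1 / h ^ CARD('d)) * (\<Sum>k\<in>KK. (L2_inner \<Omega> (\<phi> n) (indicator (cell h k)))\<^sup>2) + c * L2_inner \<Omega> (grad (\<phi> n)) (grad (\<phi> n))" for n
    using C1_bounded_support.cell_inequality[OF test_C1[OF \<phi>] h, of n]
    by (simp only: test_inner_lborel[OF \<phi>] cell_eq c_def KK_def)
  ultimately have "L2_inner \<Omega> u u \<le> (1 / h ^ CARD('d)) * (\<Sum>k\<in>KK. (L2_inner \<Omega> u (indicator (cell h k)))\<^sup>2) + c * L2_inner \<Omega> g g"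
    by (intro LIMSEQ_le) auto
  then show ?thesis by (simp add: c_def)
qed

text \<open>Only the gradients are assumed Cauchy; the Poincare inequality transfers this to the
  functions. The defining identity of weak gradients passes to the limit for each fixed test
  function, and a test function close to some late \<open>u n\<close> is close to the limit.\<close>

lemma H10_complete:
  fixes u :: "nat \<Rightarrow> real^'d \<Rightarrow> real"
  assumes u: "\<And>n. u n \<in> H10 \<Omega>" and g: "\<And>n. has_weak_gradient \<Omega> (u n) (g n)"
    and cauchy: "\<And>\<epsilon>. 0 < \<epsilon> \<Longrightarrow> \<exists>N. \<forall>m\<ge>N. \<forall>n\<ge>N. L2_inner \<Omega> (g m - g n) (g m - g n) < \<epsilon>"
  obtains w h where "w \<in> H10 \<Omega>" "has_weak_gradient \<Omega> w h" "(\<lambda>n. L2_inner \<Omega> (g n - h) (g n - h)) \<longlonglongrightarrow> 0"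
proof -
  have uL: "u n \<in> L2 \<Omega>" and gL: "g n \<in> L2 \<Omega>" for n using has_weak_gradient_L2[OF g] by auto
  define c where "c = (2 * R + 1)\<^sup>2 / 2"
  have c: "0 < c" using R_pos by (simp add: c_def)
  have diff_H10: "u m - u n \<in> H10 \<Omega>" for m n by (rule subspace_diff[OF subspace_H10 u u])
  have "\<exists>N. \<forall>m\<ge>N. \<forall>n\<ge>N. L2_inner \<Omega> (u m - u n) (u m - u n) < \<epsilon>" if \<epsilon>: "0 < \<epsilon>" for \<epsilon>
  proof -
    obtain N where N: "\<And>m n. N \<le> m \<Longrightarrow> N \<le> n \<Longrightarrow> L2_inner \<Omega> (g m - g n) (g m - g n) < \<epsilon> / c"
      using cauchy[of "\<epsilon> / c"] \<epsilon> c by auto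
    have "L2_inner \<Omega> (u m - u n) (u m - u n) < \<epsilon>" if "N \<le> m" "N \<le> n" for m n
    proof -
      have "L2_inner \<Omega> (u m - u n) (u m - u n) \<le> c * L2_inner \<Omega> (g m - g n) (g m - g n)"
        unfolding c_def by (rule H10_Poincare[OF diff_H10 has_weak_gradient_diff[OF g g]])
      also have "\<dots> < c * (\<epsilon> / c)" using N[OF that] c by (rule mult_strict_left_mono)
      also have "\<dots> = \<epsilon>" using c by simp
      finally show ?thesis .
    qed
    then show ?thesis by blast
  qed
  from L2_complete[OF dom uL this]
  obtain w where w: "w \<in> L2 \<Omega>" "(\<lambda>n. L2_inner \<Omega> (u n - w) (u n - w)) \<longlonglongrightarrow> 0" .
  from L2_complete[OF dom gL cauchy]
  obtain h where h: "h \<in> L2 \<Omega>" "(\<lambda>n. L2_inner \<Omega> (g n - h) (g n - h)) \<longlonglongrightarrow> 0" .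
  have wh: "has_weak_gradient \<Omega> w h"
    unfolding has_weak_gradient_iff
  proof (intro conjI ballI allI w(1) h(1))
    fix \<phi> i assume \<phi>: "\<phi> \<in> test_functions \<Omega>"
    have "(\<lambda>n. L2_inner \<Omega> (u n) (partial i \<phi>)) \<longlonglongrightarrow> L2_inner \<Omega> w (partial i \<phi>)"
      by (rule L2.tendsto_left[OF uL w(1) test_inner_lborel(1)[OF test_partial[OF \<phi>]] w(2)])
    moreover have "(\<lambda>n. L2_inner \<Omega> (u n) (partial i \<phi>)) = (\<lambda>n. - L2_inner \<Omega> (g n) (\<lambda>x. \<phi> x *\<^sub>R axis i 1))"
      using g \<phi> unfolding has_weak_gradient_iff by blast
    moreover have "(\<lambda>n. - L2_inner \<Omega> (g n) (\<lambda>x. \<phi> x *\<^sub>R axis i 1)) \<longlonglongrightarrow> - L2_inner \<Omega> h (\<lambda>x. \<phi> x *\<^sub>R axis i 1)"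
      by (intro tendsto_minus L2.tendsto_left[OF gL h(1) test_axis_L2[OF \<phi>] h(2)])
    ultimately show "L2_inner \<Omega> w (partial i \<phi>) = - L2_inner \<Omega> h (\<lambda>x. \<phi> x *\<^sub>R axis i 1)"
      by (simp only:) (rule LIMSEQ_unique)
  qed
  have "w \<in> H10 \<Omega>"
    unfolding H10_iff[OF wh]
  proof (intro allI impI)
    fix e :: real assume e: "0 < e"
    have "(\<lambda>n. L2_inner \<Omega> (u n - w) (u n - w) + L2_inner \<Omega> (g n - h) (g n - h)) \<longlonglongrightarrow> 0 + 0"
      by (intro tendsto_add w h)
    then have "\<forall>\<^sub>F n in sequentially. L2_inner \<Omega> (u n - w) (u n - w) + L2_inner \<Omega> (g n - h) (g n - h) < e / 4"
      by (rule order_tendstoD(2)) (use e in simp)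
    then obtain n where n: "L2_inner \<Omega> (u n - w) (u n - w) + L2_inner \<Omega> (g n - h) (g n - h) < e / 4"
      unfolding eventually_sequentially by blast
    obtain \<phi> where \<phi>: "\<phi> \<in> test_functions \<Omega>" "energy_dist (u n) (g n) \<phi> < e / 4"
      using u[of n] e unfolding H10_iff[OF g] by (meson zero_less_divide_iff zero_less_numeral)
    have L: "\<phi> \<in> L2 \<Omega>" "grad \<phi> \<in> L2 \<Omega>" using test_inner_lborel(1,2)[OF \<phi>(1)] by auto
    have 1: "\<phi> - w = (\<phi> - u n) + (u n - w)" and 2: "grad \<phi> - h = (grad \<phi> - g n) + (g n - h)" by simp_all
    have "L2_inner \<Omega> (\<phi> - w) (\<phi> - w) \<le> 2 * L2_inner \<Omega> (\<phi> - u n) (\<phi> - u n) + 2 * L2_inner \<Omega> (u n - w) (u n - w)"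
      unfolding 1 by (intro L2.square_sum_le L2.mem L uL w)
    moreover have "L2_inner \<Omega> (grad \<phi> - h) (grad \<phi> - h) \<le> 2 * L2_inner \<Omega> (grad \<phi> - g n) (grad \<phi> - g n) + 2 * L2_inner \<Omega> (g n - h) (g n - h)"
      unfolding 2 by (intro L2.square_sum_le L2.mem L gL h)
    ultimately have "energy_dist w h \<phi> < e"
      using n \<phi>(2) by (simp add: energy_dist_def)
    then show "\<exists>\<phi>\<in>test_functions \<Omega>. energy_dist w h \<phi> < e" using \<phi>(1) by blast
  qed
  then show ?thesis using wh h(2) by (rule that)
qed

text \<open>Ensures that changing a function on a null set changes nothing in the form, see
  \<open>form_null\<close>.\<close>

lemma null_weak_gradient:
  assumes u: "u \<in> L2 \<Omega>" "L2_inner \<Omega> u u = 0"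
  shows "has_weak_gradient \<Omega> u 0"
  unfolding has_weak_gradient_iff
  using u L2.null_left[of u \<Omega>] L2.zero_left by (auto simp: test_inner_lborel(1) test_partial test_axis_L2)

end

subsection \<open>Multiplicities\<close>

text \<open>Gaussian elimination: the last equation is solved for a variable with nonzero
  coefficient, and induction applies to the remaining variables and equations.\<close>

lemma underdetermined_system:
  fixes c :: "'i \<Rightarrow> nat \<Rightarrow> real"
  assumes "finite I" "m < card I"
  shows "\<exists>x. (\<exists>i\<in>I. x i \<noteq> 0) \<and> (\<forall>k<m. (\<Sum>i\<in>I. x i * c i k) = 0)"
  using assms
proof (induction m arbitrary: I c)
  case 0
  then have "I \<noteq> {}" by auto
  then show ?case by (intro exI[of _ "\<lambda>_. 1"]) auto
next
  case (Suc m)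
  show ?case
  proof (cases "\<forall>i\<in>I. c i m = 0")
    case True
    obtain x where "\<exists>i\<in>I. x i \<noteq> 0" "\<forall>k<m. (\<Sum>i\<in>I. x i * c i k) = 0"
      using Suc.IH[of I c] Suc.prems by auto
    then show ?thesis using True by (intro exI[of _ x]) (auto simp: less_Suc_eq)
  next
    case False
    then obtain p where p: "p \<in> I" "c p m \<noteq> 0" by auto
    define J where "J = I - {p}"
    have J: "finite J" "p \<notin> J" "I = insert p J" using Suc.prems p by (auto simp: J_def)
    have "m < card J" using Suc.prems J by simp
    then obtain x where x: "\<exists>i\<in>J. x i \<noteq> 0"
      "\<forall>k<m. (\<Sum>i\<in>J. x i * (c i k - c i m / c p m * c p k)) = 0"
      using Suc.IH[of J "\<lambda>i k. c i k - c i m / c p m * c p k"] J by auto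
    \<comment> \<open>Giving the pivot variable the value \<open>- s\<close> satisfies equation
      m.\<close>
    define s where "s = (\<Sum>i\<in>J. x i * c i m) / c p m"
    define y where "y = x(p := - s)"
    have y_J: "(\<Sum>i\<in>J. y i * h i) = (\<Sum>i\<in>J. x i * h i)" for h
      using J by (intro sum.cong) (auto simp: y_def)
    have y_I: "(\<Sum>i\<in>I. y i * h i) = - s * h p + (\<Sum>i\<in>J. x i * h i)" for h
      using J y_J by (simp add: y_def)
    have "(\<Sum>i\<in>I. y i * c i k) = 0" if k: "k < Suc m" for k
    proof (cases "k = m")
      case True
      then show ?thesis using p by (simp add: y_I s_def)
    next
      case False
      then have "k < m" using k by simp
      then have "0 = (\<Sum>i\<in>J. x i * (c i k - c i m / c p m * c p k))" using x by simp
      also have "\<dots> = (\<Sum>i\<in>J. x i * c i k) - s * c p k"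
        by (simp add: right_diff_distrib sum_subtractf s_def sum_divide_distrib sum_distrib_right mult.assoc)
      finally show ?thesis by (simp add: y_I)
    qed
    moreover have "\<exists>i\<in>I. y i \<noteq> 0" using x(1) J by (auto simp: y_def)
    ultimately show ?thesis by blast
  qed
qed

lemma eigenvalue_sequence_mono:
  assumes "eigenvalue_sequence \<Omega> \<V> lam" "1 \<le> i" "i \<le> j"
  shows "lam i \<le> lam j"
  using assms(3,2)
proof (induction j rule: dec_induct)
  case (step n)
  have "lam n \<le> lam (Suc n)" using assms(1) step by (simp add: eigenvalue_sequence_def)
  then show ?case using step by simp
qed simp

lemma sum_fun_apply: "(\<Sum>i\<in>I. f i) x = (\<Sum>i\<in>I. f i x)"
  by (induction I rule: infinite_finite_induct) auto

text \<open>More than m elements expanded in m basis functions admit a nontrivial relation up to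
  null sets; pairing it with one \<open>v j\<close> contradicts orthogonality and
  positivity.\<close>

lemma has_dim_ae_orthogonal_card:
  fixes v :: "'i \<Rightarrow> real^'d \<Rightarrow> real"
  assumes dim: "has_dim_ae \<Omega> S m" and I: "finite I" and v: "\<And>i. i \<in> I \<Longrightarrow> v i \<in> S" and S: "S \<subseteq> L2 \<Omega>"
    and orth: "\<And>i j. i \<in> I \<Longrightarrow> j \<in> I \<Longrightarrow> i \<noteq> j \<Longrightarrow> L2_inner \<Omega> (v i) (v j) = 0"
    and pos: "\<And>i. i \<in> I \<Longrightarrow> 0 < L2_inner \<Omega> (v i) (v i)"
  shows "card I \<le> m"
proof (rule ccontr)
  assume "\<not> card I \<le> m"
  then have card: "m < card I" by simp
  obtain b where b: "\<And>u. u \<in> S \<Longrightarrow> \<exists>c :: nat \<Rightarrow> real. ae_eq \<Omega> u (\<lambda>x. \<Sum>k<m. c k * b k x)"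
    using dim unfolding has_dim_ae_def by blast
  have "\<exists>c. \<forall>i\<in>I. ae_eq \<Omega> (v i) (\<lambda>x. \<Sum>k<m. c i k * b k x)"
    by (rule bchoice) (use b v in blast)
  then obtain c where c: "\<And>i. i \<in> I \<Longrightarrow> ae_eq \<Omega> (v i) (\<lambda>x. \<Sum>k<m. c i k * b k x)" by blast
  obtain x where x: "\<exists>i\<in>I. x i \<noteq> 0" "\<forall>k<m. (\<Sum>i\<in>I. x i * c i k) = 0"
    using underdetermined_system[OF I card, of c] by blast
  define y where "y = (\<Sum>i\<in>I. x i *\<^sub>R v i)"
  have vL: "v i \<in> L2 \<Omega>" if "i \<in> I" for i using v[OF that] S by auto
  have yL: "y \<in> L2 \<Omega>" unfolding y_def using vL by (intro L2.mem) auto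
  have "AE z in lebesgue_on \<Omega>. \<forall>i\<in>I. v i z = (\<Sum>k<m. c i k * b k z)"
    using c I by (intro AE_finite_allI) (auto simp: ae_eq_def)
  then have "AE z in lebesgue_on \<Omega>. y z = 0"
  proof (rule AE_mp, intro AE_I2 impI)
    fix z assume "\<forall>i\<in>I. v i z = (\<Sum>k<m. c i k * b k z)"
    then have "y z = (\<Sum>i\<in>I. \<Sum>k<m. x i * c i k * b k z)"
      by (simp add: y_def sum_fun_apply scaleR_fun_def sum_distrib_left mult.assoc)
    also have "\<dots> = (\<Sum>k<m. \<Sum>i\<in>I. x i * c i k * b k z)" by (rule sum.swap)
    also have "\<dots> = (\<Sum>k<m. (\<Sum>i\<in>I. x i * c i k) * b k z)" by (simp add: sum_distrib_right)
    also have "\<dots> = 0" using x(2) by simp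
    finally show "y z = 0" .
  qed
  then have y0: "L2_inner \<Omega> y y = 0" by (rule AE_null_L2)
  obtain j where j: "j \<in> I" "x j \<noteq> 0" using x(1) by blast
  have "0 = L2_inner \<Omega> y (v j)" using L2.null_left[OF yL vL[OF j(1)] y0] by simp
  also have "\<dots> = (\<Sum>i\<in>I. x i * L2_inner \<Omega> (v i) (v j))"
    unfolding y_def using vL j(1) by (simp add: L2.sum_left L2.scale_left)
  also have "\<dots> = (\<Sum>i\<in>I. if i = j then x j * L2_inner \<Omega> (v j) (v j) else 0)"
    using orth j(1) by (intro sum.cong) auto
  also have "\<dots> = x j * L2_inner \<Omega> (v j) (v j)" using I j(1) by simp
  finally show False using j pos[OF j(1)] by simp
qed

subsection \<open>The form \<open>a\<close>\<close>

locale potential_form = bounded_dom \<Omega> R for \<Omega> :: "(real^'d::finite) set" and R +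
  fixes \<V> :: "real^'d \<Rightarrow> real" and c1 c2 :: real
  assumes adm: "admissible_potential \<Omega> \<V> c1 c2"
begin

lemma c1_pos: "0 < c1" and c2_pos: "0 < c2"
  using adm by (simp_all add: admissible_potential_def)

sublocale a0: psd_on "H10 \<Omega>" "form_a \<Omega> \<V>"
proof
  have ip: "inner_product_on_H10 \<Omega> (form_a \<Omega> \<V>)" using adm by (simp add: admissible_potential_def)
  then show "form_a \<Omega> \<V> u v = form_a \<Omega> \<V> v u" if "u \<in> H10 \<Omega>" "v \<in> H10 \<Omega>" for u v
    using that by (simp add: inner_product_on_H10_def)
  show "form_a \<Omega> \<V> (u + v) w = form_a \<Omega> \<V> u w + form_a \<Omega> \<V> v w"
    if "u \<in> H10 \<Omega>" "v \<in> H10 \<Omega>" "w \<in> H10 \<Omega>" for u v w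
    using ip that by (simp add: inner_product_on_H10_def plus_fun_def)
  show "form_a \<Omega> \<V> (c *\<^sub>R u) v = c * form_a \<Omega> \<V> u v" if "u \<in> H10 \<Omega>" "v \<in> H10 \<Omega>" for c u v
    using ip that by (simp add: inner_product_on_H10_def scaleR_fun_def)
  show "0 \<le> form_a \<Omega> \<V> u u" if "u \<in> H10 \<Omega>" for u
    using ip that by (simp add: inner_product_on_H10_def)
qed (rule subspace_H10)

text \<open>Formulated for any weak gradient, so that differences and limits of gradients can be
  inserted directly.\<close>

lemma form_bounds:
  assumes u: "u \<in> H10 \<Omega>" and g: "has_weak_gradient \<Omega> u g"
  shows "c1 * L2_inner \<Omega> g g \<le> form_a \<Omega> \<V> u u" "form_a \<Omega> \<V> u u \<le> c2 * L2_inner \<Omega> g g"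
proof -
  have eq: "(L2_norm \<Omega> (weak_gradient \<Omega> u))\<^sup>2 = L2_inner \<Omega> g g"
    using weak_gradient_inner_eq[OF g] has_weak_gradient_L2(2)[OF H10_weak_gradient[OF u]]
    by (simp add: L2_norm_eq_snorm L2.snorm_square)
  show "c1 * L2_inner \<Omega> g g \<le> form_a \<Omega> \<V> u u" "form_a \<Omega> \<V> u u \<le> c2 * L2_inner \<Omega> g g"
    using adm u unfolding admissible_potential_def eq[symmetric] by blast+
qed

definition \<kappa> :: real where "\<kappa> = (2 * R + 1)\<^sup>2 / 2 / c1"

lemma \<kappa>_pos: "0 < \<kappa>"
  using R_pos c1_pos by (simp add: \<kappa>_def)

lemma L2_le_form:
  assumes u: "u \<in> H10 \<Omega>"
  shows "L2_inner \<Omega> u u \<le> \<kappa> * form_a \<Omega> \<V> u u"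
proof -
  define g where "g = weak_gradient \<Omega> u"
  have g: "has_weak_gradient \<Omega> u g" using u by (simp add: g_def H10_weak_gradient)
  have "L2_inner \<Omega> u u \<le> (2 * R + 1)\<^sup>2 / 2 * L2_inner \<Omega> g g" by (rule H10_Poincare[OF u g])
  also have "\<dots> = \<kappa> * (c1 * L2_inner \<Omega> g g)" using c1_pos by (simp add: \<kappa>_def)
  also have "\<dots> \<le> \<kappa> * form_a \<Omega> \<V> u u"
    using form_bounds(1)[OF u g] \<kappa>_pos by (intro mult_left_mono) auto
  finally show ?thesis .
qed

text \<open>Such a u has weak gradient 0, and the upper bound by \<open>c2\<close> forces its energy
  to vanish. This converts equations almost everywhere into null vectors of the form.\<close>

lemma form_null:
  assumes u: "u \<in> H10 \<Omega>" "AE x in lebesgue_on \<Omega>. u x = 0"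
  shows "form_a \<Omega> \<V> u u = 0"
proof -
  have "has_weak_gradient \<Omega> u 0"
    by (rule null_weak_gradient[OF H10_L2[OF u(1)] AE_null_L2[OF u(2)]])
  then have "form_a \<Omega> \<V> u u \<le> c2 * L2_inner \<Omega> 0 (0 :: real^'d \<Rightarrow> real^'d)" by (rule form_bounds(2)[OF u(1)])
  also have "\<dots> = 0" by (simp add: L2_inner_def)
  finally show ?thesis using a0.nonneg[OF u(1)] by simp
qed

text \<open>
  A linear projection onto \<open>H\<^sub>0\<^sup>1(\<Omega>)\<close> turns the forms on this subspace into forms on the whole
  space of functions, to which the abstract results apply.
\<close>

definition P :: "(real^'d \<Rightarrow> real) \<Rightarrow> real^'d \<Rightarrow> real" where
  "P = (SOME p. linear p \<and> range p \<subseteq> H10 \<Omega> \<and> (\<forall>u\<in>H10 \<Omega>. p u = u))"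

lemma P_linear: "linear P" and P_H10 [simp]: "P u \<in> H10 \<Omega>" and P_id: "u \<in> H10 \<Omega> \<Longrightarrow> P u = u"
proof -
  \<comment> \<open>A left inverse of the inclusion, extended linearly to all functions: an
    algebraic projection, without any continuity.\<close>
  have "\<exists>p. linear p \<and> range p \<subseteq> H10 \<Omega> \<and> (\<forall>u\<in>H10 \<Omega>. p u = u)"
    using linear_exists_left_inverse_on[OF linear_id subspace_H10] by (auto simp: inj_on_def)
  from someI_ex[OF this] have "linear P \<and> range P \<subseteq> H10 \<Omega> \<and> (\<forall>u\<in>H10 \<Omega>. P u = u)"
    unfolding P_def .
  then show "linear P" "P u \<in> H10 \<Omega>" "u \<in> H10 \<Omega> \<Longrightarrow> P u = u" by auto
qed

definition a :: "(real^'d \<Rightarrow> real) \<Rightarrow> (real^'d \<Rightarrow> real) \<Rightarrow> real" where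
  "a u v = form_a \<Omega> \<V> (P u) (P v)"

definition b :: "(real^'d \<Rightarrow> real) \<Rightarrow> (real^'d \<Rightarrow> real) \<Rightarrow> real" where
  "b u v = L2_inner \<Omega> (P u) (P v)"

lemma a_H10: "u \<in> H10 \<Omega> \<Longrightarrow> v \<in> H10 \<Omega> \<Longrightarrow> a u v = form_a \<Omega> \<V> u v"
  by (simp add: a_def P_id)

lemma b_H10: "u \<in> H10 \<Omega> \<Longrightarrow> v \<in> H10 \<Omega> \<Longrightarrow> b u v = L2_inner \<Omega> u v"
  by (simp add: b_def P_id)

lemma P_L2 [simp]: "P u \<in> L2 \<Omega>"
  by (rule H10_L2) simp

sublocale a: psd_form a
proof
  show "a u v = a v u" for u v unfolding a_def by (rule a0.sym) simp_all
qed (simp_all add: a_def linear_add[OF P_linear] linear_scale[OF P_linear]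
    a0.add_left a0.scale_left a0.nonneg)

sublocale b: psd_form b
proof
  show "b u v = b v u" for u v unfolding b_def by (rule L2.sym) simp_all
qed (simp_all add: b_def linear_add[OF P_linear] linear_scale[OF P_linear]
    L2.add_left L2.scale_left L2.nonneg)

sublocale compact_pair a b \<kappa>
proof
  show "0 < \<kappa>" by (rule \<kappa>_pos)
  show b_le: "b v v \<le> \<kappa> * a v v" for v by (simp add: a_def b_def L2_le_form)
  show "\<exists>w. (\<lambda>n. a (u n - w) (u n - w)) \<longlonglongrightarrow> 0"
    if cauchy: "\<And>\<epsilon>. 0 < \<epsilon> \<Longrightarrow> \<exists>N. \<forall>m\<ge>N. \<forall>n\<ge>N. a (u m - u n) (u m - u n) < \<epsilon>" for u
  proof -
    define g where "g = (\<lambda>n. weak_gradient \<Omega> (P (u n)))"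
    have g: "has_weak_gradient \<Omega> (P (u n)) (g n)" for n by (simp add: g_def H10_weak_gradient)
    have "\<exists>N. \<forall>m\<ge>N. \<forall>n\<ge>N. L2_inner \<Omega> (g m - g n) (g m - g n) < \<epsilon>" if \<epsilon>: "0 < \<epsilon>" for \<epsilon>
    proof -
      obtain N where N: "\<And>m n. N \<le> m \<Longrightarrow> N \<le> n \<Longrightarrow> a (u m - u n) (u m - u n) < c1 * \<epsilon>"
        using cauchy[of "c1 * \<epsilon>"] \<epsilon> c1_pos by auto
      have "L2_inner \<Omega> (g m - g n) (g m - g n) < \<epsilon>" if mn: "N \<le> m" "N \<le> n" for m n
      proof -
        have "c1 * L2_inner \<Omega> (g m - g n) (g m - g n) \<le> form_a \<Omega> \<V> (P (u m) - P (u n)) (P (u m) - P (u n))"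
          by (rule form_bounds(1)[OF _ has_weak_gradient_diff[OF g g]]) simp
        also have "\<dots> < c1 * \<epsilon>" using N[OF mn] by (simp add: a_def linear_diff[OF P_linear])
        finally show ?thesis using c1_pos by simp
      qed
      then show ?thesis by blast
    qed
    from H10_complete[OF P_H10 g this]
    obtain w h where w: "w \<in> H10 \<Omega>" "has_weak_gradient \<Omega> w h" "(\<lambda>n. L2_inner \<Omega> (g n - h) (g n - h)) \<longlonglongrightarrow> 0" .
    have "(\<lambda>n. a (u n - w) (u n - w)) \<longlonglongrightarrow> 0"
    proof (rule Lim_null_comparison)
      have "a (u n - w) (u n - w) \<le> c2 * L2_inner \<Omega> (g n - h) (g n - h)" for n
        unfolding a_def linear_diff[OF P_linear] P_id[OF w(1)]
        by (rule form_bounds(2)[OF _ has_weak_gradient_diff[OF g w(2)]]) (simp add: w)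
      then show "\<forall>\<^sub>F n in sequentially. norm (a (u n - w) (u n - w)) \<le> c2 * L2_inner \<Omega> (g n - h) (g n - h)"
        by (simp add: a.nonneg)
      show "(\<lambda>n. c2 * L2_inner \<Omega> (g n - h) (g n - h)) \<longlonglongrightarrow> 0"
        using tendsto_mult_left[OF w(3), of c2] by simp
    qed
    then show ?thesis by blast
  qed
  show "\<exists>(m::nat) f. (\<forall>j<m. (\<forall>u v. f j (u - v) = f j u - f j v) \<and> (\<exists>K. \<forall>v. \<bar>f j v\<bar> \<le> K * a.snorm v)) \<and>
      (\<forall>v. b v v \<le> \<epsilon> * a v v + (\<Sum>j<m. (f j v)\<^sup>2))" if \<epsilon>: "0 < \<epsilon>" for \<epsilon>
  proof -
    define c where "c = 2 ^ CARD('d) * real CARD('d) / 2"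
    have c: "0 < c" by (simp add: c_def)
    \<comment> \<open>The cell size for which the gradient term c h^2 |\<nabla>v|^2 equals
      \<epsilon> c1 |\<nabla>v|^2, hence is at most \<epsilon> times the energy.\<close>
    define h where "h = sqrt (\<epsilon> * c1 / c)"
    have h: "0 < h" using \<epsilon> c1_pos c by (simp add: h_def)
    have h2: "c * h\<^sup>2 = \<epsilon> * c1" using \<epsilon> c1_pos c by (simp add: h_def)
    define KK where "KK = {k :: 'd \<Rightarrow> int. \<exists>x\<in>cell h k. norm x \<le> R}"
    have "finite KK" unfolding KK_def by (rule finite_cells[OF h])
    then obtain \<beta> where \<beta>: "bij_betw \<beta> {0..<card KK} KK" using ex_bij_betw_nat_finite by blast
    \<comment> \<open>Moves the factor 1 / h^d of the cell inequality inside the squares.\<close>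
    define s where "s = 1 / sqrt (h ^ CARD('d))"
    have s2: "s\<^sup>2 = 1 / h ^ CARD('d)" using h by (simp add: s_def power_divide)
    define f where "f = (\<lambda>j v. s * L2_inner \<Omega> (P v) (indicator (cell h (\<beta> j))))"
    have ind: "(indicator (cell h k) :: real^'d \<Rightarrow> real) \<in> L2 \<Omega>" for k
      by (rule indicator_L2[OF cell_measurable])
    have "f j (u - v) = f j u - f j v" for j u v
      by (simp add: f_def linear_diff[OF P_linear] L2.diff_left ind right_diff_distrib)
    moreover have "\<bar>f j v\<bar> \<le> (\<bar>s\<bar> * L2.snorm \<Omega> (indicator (cell h (\<beta> j)) :: real^'d \<Rightarrow> real) * sqrt \<kappa>) * a.snorm v" for j v
    proof -
      have "\<bar>f j v\<bar> \<le> \<bar>s\<bar> * (L2.snorm \<Omega> (P v) * L2.snorm \<Omega> (indicator (cell h (\<beta> j)) :: real^'d \<Rightarrow> real))"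
        unfolding f_def abs_mult by (intro mult_left_mono L2.Cauchy_Schwarz ind) auto
      also have "L2.snorm \<Omega> (P v) \<le> sqrt \<kappa> * a.snorm v"
        using real_sqrt_le_mono[OF b_le[of v]] by (simp add: b_def L2.snorm_def a.snorm_def real_sqrt_mult)
      finally show ?thesis using ind by (simp add: mult_ac mult_left_mono mult_right_mono)
    qed
    moreover have "b v v \<le> \<epsilon> * a v v + (\<Sum>j<card KK. (f j v)\<^sup>2)" for v
    proof -
      define g where "g = weak_gradient \<Omega> (P v)"
      have g: "has_weak_gradient \<Omega> (P v) g" by (simp add: g_def H10_weak_gradient)
      have "(\<Sum>j<card KK. (f j v)\<^sup>2) = (1 / h ^ CARD('d)) * (\<Sum>j\<in>{0..<card KK}. (L2_inner \<Omega> (P v) (indicator (cell h (\<beta> j))))\<^sup>2)"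
        by (simp add: f_def power_mult_distrib s2 sum_distrib_left atLeast0LessThan)
      also have "(\<Sum>j\<in>{0..<card KK}. (L2_inner \<Omega> (P v) (indicator (cell h (\<beta> j))))\<^sup>2) = (\<Sum>k\<in>KK. (L2_inner \<Omega> (P v) (indicator (cell h k)))\<^sup>2)"
        by (rule sum.reindex_bij_betw[OF \<beta>])
      finally have "b v v \<le> (\<Sum>j<card KK. (f j v)\<^sup>2) + c * h\<^sup>2 * L2_inner \<Omega> g g"
        using H10_cell_inequality[OF h P_H10 g] by (simp add: b_def KK_def c_def)
      also have "c * h\<^sup>2 * L2_inner \<Omega> g g = \<epsilon> * (c1 * L2_inner \<Omega> g g)" by (simp add: h2)
      also have "\<dots> \<le> \<epsilon> * a v v"
        unfolding a_def using form_bounds(1)[OF P_H10 g] \<epsilon> by (intro mult_left_mono) auto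
      finally show ?thesis by simp
    qed
    ultimately show ?thesis by (intro exI[of _ "card KK"] exI[of _ f]) blast
  qed
qed

lemma solution_op_spec:
  assumes u: "u \<in> H10 \<Omega>"
  shows "solution_op \<Omega> \<V> (L2_inner \<Omega> u) \<in> H10 \<Omega>" "a (solution_op \<Omega> \<V> (L2_inner \<Omega> u)) v = b u v"
proof -
  obtain w where w: "\<And>v. a w v = b u v" using solution_exists by blast
  have "form_a \<Omega> \<V> (P w) v = L2_inner \<Omega> u v" if "v \<in> H10 \<Omega>" for v
    using w[of v] u that by (simp add: a_def b_def P_id)
  then have "\<exists>w. w \<in> H10 \<Omega> \<and> (\<forall>v\<in>H10 \<Omega>. form_a \<Omega> \<V> w v = L2_inner \<Omega> u v)"
    using P_H10 by blast
  then have s: "solution_op \<Omega> \<V> (L2_inner \<Omega> u) \<in> H10 \<Omega> \<and>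
      (\<forall>v\<in>H10 \<Omega>. form_a \<Omega> \<V> (solution_op \<Omega> \<V> (L2_inner \<Omega> u)) v = L2_inner \<Omega> u v)"
    unfolding solution_op_def by (rule someI_ex)
  then show "solution_op \<Omega> \<V> (L2_inner \<Omega> u) \<in> H10 \<Omega>" by blast
  show "a (solution_op \<Omega> \<V> (L2_inner \<Omega> u)) v = b u v"
    using s u by (simp add: a_def b_def P_id)
qed

text \<open>A violation would produce an eigenfunction w, orthogonal to all e, with eigenvalue \<mu>
  < \<lambda>_(N+1). By monotonicity every occurrence of \<mu> in the sequence has index at most N,
  so the e already fill the multiplicity of \<mu>, and w exceeds the dimension of the
  eigenspace.\<close>

lemma spectral_gap:
  fixes e :: "'n::finite \<Rightarrow> real^'d \<Rightarrow> real" and idx :: "'n \<Rightarrow> nat"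
  assumes lam: "eigenvalue_sequence \<Omega> \<V> lam"
    and idx: "bij_betw idx UNIV {1..CARD('n)}"
    and e_H10: "\<And>i. e i \<in> H10 \<Omega>"
    and e_orth: "\<And>i j. b (e i) (e j) = (if i = j then 1 else 0)"
    and e_eigen: "\<And>i. e i \<in> eigenspace \<Omega> \<V> (lam (idx i))"
    and z: "\<And>i. b (e i) z = 0"
  shows "lam (CARD('n) + 1) * b z z \<le> a z z"
proof (rule ccontr)
  assume "\<not> lam (CARD('n) + 1) * b z z \<le> a z z"
  then have z': "a z z < lam (CARD('n) + 1) * b z z" by simp
  have e_a: "a (e i) v = lam (idx i) * b (e i) v" for i v
    using e_eigen[of i] by (simp add: eigenspace_def a_def b_def P_id)
  obtain \<mu> w where \<mu>: "\<mu> < lam (CARD('n) + 1)" and w: "0 < b w w" "\<And>i. b (e i) w = 0" "\<And>v. a w v = \<mu> * b w v"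
    using orthogonal_eigenvector[of e "\<lambda>i. lam (idx i)" z, OF e_orth e_a z z'] by blast
  have w_e: "b w (e i) = 0" for i using w(2)[of i] b.sym[of w "e i"] by simp
  \<comment> \<open>\<open>K\<close> is empty if \<mu> does not occur in the sequence; the
    eigenspace then has dimension 0 and the same count applies.\<close>
  define K where "K = {k. 1 \<le> k \<and> lam k = \<mu>}"
  have K: "finite K" "has_dim_ae \<Omega> (eigenspace \<Omega> \<V> \<mu>) (card K)"
    using lam by (auto simp: eigenvalue_sequence_def K_def)
  have K_sub: "K \<subseteq> {1..CARD('n)}"
  proof
    fix k assume k: "k \<in> K"
    have "\<not> CARD('n) + 1 \<le> k" using eigenvalue_sequence_mono[OF lam, of "CARD('n) + 1" k] k \<mu> by (auto simp: K_def)
    then show "k \<in> {1..CARD('n)}" using k by (auto simp: K_def)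
  qed
  define T where "T = {i. lam (idx i) = \<mu>}"
  have range: "range idx = {1..CARD('n)}" using idx by (simp add: bij_betw_def)
  have "idx ` T = K"
  proof
    show "idx ` T \<subseteq> K" using range by (auto simp: T_def K_def)
    show "K \<subseteq> idx ` T"
    proof
      fix k assume k: "k \<in> K"
      then have "k \<in> range idx" using K_sub range by blast
      then obtain i where "k = idx i" by blast
      then show "k \<in> idx ` T" using k by (simp add: T_def K_def)
    qed
  qed
  moreover have "inj_on idx T" using idx by (auto simp: bij_betw_def intro: inj_on_subset)
  ultimately have card_T: "card T = card K" using card_image[of idx T] by simp
  \<comment> \<open>\<open>None\<close> stands for the additional eigenvector. It is represented by
    \<open>P w\<close>, because w itself need not lie in \<open>H10 \<Omega>\<close>.\<close>
  define v where "v = (\<lambda>j. case j of None \<Rightarrow> P w | Some i \<Rightarrow> e i)"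
  define I where "I = insert None (Some ` T)"
  have "card I \<le> card K"
  proof (rule has_dim_ae_orthogonal_card[OF K(2), of I v])
    show "finite I" by (simp add: I_def)
    show "eigenspace \<Omega> \<V> \<mu> \<subseteq> L2 \<Omega>" by (auto simp: eigenspace_def H10_L2)
    have "form_a \<Omega> \<V> (P w) y = \<mu> * L2_inner \<Omega> (P w) y" if "y \<in> H10 \<Omega>" for y
      using w(3)[of y] that by (simp add: a_def b_def P_id)
    then have "P w \<in> eigenspace \<Omega> \<V> \<mu>" by (simp add: eigenspace_def)
    then show "v j \<in> eigenspace \<Omega> \<V> \<mu>" if "j \<in> I" for j
      using that e_eigen by (auto simp: v_def I_def T_def)
    have bv: "L2_inner \<Omega> (v i) (v j) = b (case i of None \<Rightarrow> w | Some i \<Rightarrow> e i) (case j of None \<Rightarrow> w | Some i \<Rightarrow> e i)" for i j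
      by (auto simp: v_def b_def P_id e_H10 split: option.split)
    show "L2_inner \<Omega> (v i) (v j) = 0" if "i \<in> I" "j \<in> I" "i \<noteq> j" for i j
      unfolding bv using that w(2) w_e e_orth by (auto split: option.split)
    show "0 < L2_inner \<Omega> (v i) (v i)" for i
      unfolding bv using w(1) e_orth by (auto split: option.split)
  qed
  moreover have "card I = Suc (card T)" by (simp add: I_def card_image)
  ultimately show False using card_T by simp
qed

end

section \<open>Transfer of the abstract iteration to the scheme on \<Omega>\<close>

theorem theorem4p10:
  fixes \<Omega> :: "(real^'d::finite) set"
    and \<V> :: "real^'d \<Rightarrow> real"
    and c1 c2 :: real
    and lam :: "nat \<Rightarrow> real"
    and idx :: "'n::finite \<Rightarrow> nat"
    and Ustar U0 :: "('d, 'n) tuple"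
  assumes "bounded_domain \<Omega>"
    and "admissible_potential \<Omega> \<V> c1 c2"
    and "eigenvalue_sequence \<Omega> \<V> lam"
    and "lam CARD('n) < lam (CARD('n) + 1)"
    and "bij_betw idx UNIV {1..CARD('n)}"
    and "Ustar \<in> stiefel \<Omega>"
    and "\<forall>i. eigenfunction \<Omega> \<V> (lam (idx i)) (Ustar i)"
    and "U0 \<in> stiefel \<Omega>"
    and "E_GS lam CARD('n) \<le> energy \<Omega> \<V> U0"
    and "energy \<Omega> \<V> U0 < E_ES lam CARD('n)"
  shows "\<exists>taubar>0. \<forall>taumin taumax :: real. 0 < taumin \<longrightarrow> taumin \<le> taumax \<longrightarrow> taumax \<le> taubar \<longrightarrow>
    (\<forall>(tau :: nat \<Rightarrow> real) (U :: nat \<Rightarrow> ('d, 'n) tuple).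
       (\<forall>n. tau n \<in> {taumin..taumax}) \<longrightarrow>
       U 0 = U0 \<longrightarrow>
       (\<forall>n. U (Suc n) \<in> stiefel \<Omega> \<and> scheme_step \<Omega> \<V> (tau n) (U n) (U (Suc n))) \<longrightarrow>
       (\<exists>C>0. \<exists>c>0. \<exists>Q :: real^'n^'n. orthogonal_matrix Q \<and>
          (\<forall>n. energy \<Omega> \<V> (U n) - energy \<Omega> \<V> Ustar \<le> C * exp (- 2 * c * real n) \<and>
               norm_a \<Omega> \<V> (\<lambda>i x. U n i x - tuple_mult Ustar Q i x) \<le> C * exp (- c * real n))))"
proof -
  define N where "N = CARD('n)"
  have N: "1 \<le> N" by (simp add: N_def)
  have "bounded \<Omega>" using assms(1) by (simp add: bounded_domain_def)
  then obtain R0 where "\<And>x. x \<in> \<Omega> \<Longrightarrow> norm x \<le> R0" by (auto simp: bounded_iff)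
  then have R0: "\<Omega> \<subseteq> cball 0 R0" by auto
  \<comment> \<open>The maximum with 1 makes the radius positive.\<close>
  define R where "R = max 1 R0"
  interpret potential_form \<Omega> R \<V> c1 c2
  proof
    show "\<Omega> \<subseteq> cball 0 R" using R0 by (auto simp: R_def)
  qed (use assms in \<open>auto simp: R_def\<close>)
  have stiefel: "u i \<in> H10 \<Omega>" "b (u i) (u j) = (if i = j then 1 else 0)"
    if "u \<in> stiefel \<Omega>" for u :: "('d, 'n) tuple" and i j
  proof -
    have H: "u k \<in> H10 \<Omega>" for k using that by (simp add: stiefel_def)
    then show "u i \<in> H10 \<Omega>" .
    have "gram \<Omega> u u $ i $ j = (mat 1 :: real^'n^'n) $ i $ j" using that by (simp add: stiefel_def)
    then show "b (u i) (u j) = (if i = j then 1 else 0)" by (simp add: gram_def mat_def b_H10 H)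
  qed
  have norm_a_eq: "norm_a \<Omega> \<V> u = sqrt (\<Sum>k\<in>UNIV. a (u k) (u k))"
    if "\<And>k. u k \<in> H10 \<Omega>" for u :: "('d, 'n) tuple"
    using that by (simp add: norm_a_def a_H10)
  have energy_eq: "energy \<Omega> \<V> u = 1 / 2 * (\<Sum>k\<in>UNIV. a (u k) (u k))"
    if "\<And>k. u k \<in> H10 \<Omega>" for u :: "('d, 'n) tuple"
    using that by (simp add: energy_def norm_a_eq sum_nonneg a.nonneg)
  have e_eigen: "Ustar i \<in> eigenspace \<Omega> \<V> (lam (idx i))" for i
    using assms(7) by (simp add: eigenfunction_def)
  have e_a: "a (Ustar i) v = lam (idx i) * b (Ustar i) v" for i v
    using e_eigen[of i] by (simp add: eigenspace_def a_def b_def P_id)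
  have idx: "1 \<le> idx i" "idx i \<le> N" for i
    using assms(5) by (auto simp: bij_betw_def N_def)
  note mono = eigenvalue_sequence_mono[OF assms(3)]
  have lam_sum: "(\<Sum>i\<in>UNIV. lam (idx i)) = (\<Sum>i=1..N. lam i)"
    unfolding N_def by (rule sum.reindex_bij_betw[OF assms(5)])
  interpret GS: ground_state a b Ustar "\<lambda>i. lam (idx i)" "lam N" "lam (N + 1)" \<kappa>
  proof
    show "0 < lam (idx i)" for i
      using mono[of 1 "idx i"] idx(1)[of i] assms(3) by (simp add: eigenvalue_sequence_def)
    show "lam (idx i) \<le> lam N" for i by (rule mono[OF idx])
    show "lam N < lam (N + 1)" using assms(4) by (simp add: N_def)
    show "lam (N + 1) * b z z \<le> a z z" if "\<And>i. b (Ustar i) z = 0" for z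
      unfolding N_def
      by (rule spectral_gap[OF assms(3,5) stiefel[OF assms(6)] e_eigen that])
  qed (auto simp: \<kappa>_pos b_le_a stiefel[OF assms(6)] e_a)
  define S where "S = (\<Sum>i\<in>UNIV. lam (idx i))"
  have E_star: "energy \<Omega> \<V> Ustar = 1 / 2 * S"
    using stiefel[OF assms(6)] by (simp add: energy_eq e_a S_def)
  define sol :: "('d, 'n) tuple \<Rightarrow> ('d, 'n) tuple" where "sol = solution_op_tuple \<Omega> \<V>"
  have sol: "sol u i \<in> H10 \<Omega>" "a (sol u i) v = b (u i) v" if "u \<in> stiefel \<Omega>" for u i v
    using solution_op_spec[OF stiefel(1)[OF that]] by (simp_all add: sol_def solution_op_tuple_def)
  \<comment> \<open>Doubling the bound by \<open>E_ES\<close> leaves exactly the gap above the sum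
    of the first N eigenvalues.\<close>
  have "(\<Sum>k\<in>UNIV. a (U0 k) (U0 k)) < S + (lam (N + 1) - lam N)"
    using assms(10) stiefel(1)[OF assms(8)] by (simp add: energy_eq E_ES_def S_def lam_sum N_def)
  then obtain taubar where taubar: "0 < taubar" and main:
    "\<And>taumin (tau :: nat \<Rightarrow> real) u g. 0 < taumin \<Longrightarrow> (\<forall>n. taumin \<le> tau n \<and> tau n \<le> taubar) \<Longrightarrow>
    u 0 = U0 \<Longrightarrow> (\<forall>n i j. b (u n i) (u n j) = (if i = j then 1 else 0)) \<Longrightarrow>
    (\<forall>n i v. a (g n i) v = b (u n i) v) \<Longrightarrow>
    (\<forall>n k. a (GS.step_defect (tau n) (u n) (g n) (u (Suc n)) k) (GS.step_defect (tau n) (u n) (g n) (u (Suc n)) k) = 0) \<Longrightarrow>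
    GS.exp_convergent u"
    using GS.exponential_convergence[OF stiefel(2)[OF assms(8)] sol(2)[OF assms(8)]]
    unfolding S_def[symmetric] by blast
  show ?thesis
  proof (rule exI[of _ taubar], intro conjI taubar allI impI)
    fix taumin taumax and tau :: "nat \<Rightarrow> real" and U :: "nat \<Rightarrow> ('d, 'n) tuple"
    assume tm: "0 < taumin" "taumin \<le> taumax" "taumax \<le> taubar"
      and tau: "\<forall>n. tau n \<in> {taumin..taumax}" and U_0: "U 0 = U0"
      and step: "\<forall>n. U (Suc n) \<in> stiefel \<Omega> \<and> scheme_step \<Omega> \<V> (tau n) (U n) (U (Suc n))"
    have tau_bounds: "taumin \<le> tau n" "tau n \<le> taubar" for n
      using tau[rule_format, of n] tm by auto
    have tau_pos: "0 < tau n" for n using tau_bounds(1)[of n] tm by simp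
    have U: "U n \<in> stiefel \<Omega>" for n using step U_0 assms(8) by (cases n) auto
    note U_H10 = stiefel(1)[OF U]
    have null: "a (GS.step_defect (tau n) (U n) (sol (U n)) (U (Suc n)) k) (GS.step_defect (tau n) (U n) (sol (U n)) (U (Suc n)) k) = 0"
      for n k
    proof -
      define w where "w = (1/2) *\<^sub>R (U n k + U (Suc n) k)"
      define d where "d = GS.step_defect (tau n) (U n) (sol (U n)) (U (Suc n)) k"
      have d: "d = U (Suc n) k - U n k + tau n *\<^sub>R ((\<Sum>i\<in>UNIV. b (sol (U n) i) w *\<^sub>R U n i) - (\<Sum>i\<in>UNIV. b (U n i) w *\<^sub>R sol (U n) i))"
        by (simp add: d_def GS.step_defect_def w_def Let_def)
      have d_H10: "d \<in> H10 \<Omega>" unfolding d by (intro a0.mem U_H10 sol U)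
      have w_H10: "w \<in> H10 \<Omega>" unfolding w_def by (intro a0.mem U_H10)
      have w_eq: "(\<lambda>y. (U (Suc n) k y + U n k y) / 2) = w"
        by (simp add: w_def fun_eq_iff scaleR_fun_def add.commute)
      have L_eq: "L_op \<Omega> \<V> (U n) (\<lambda>j y. (U (Suc n) j y + U n j y) / 2) k x =
          ((\<Sum>i\<in>UNIV. b (sol (U n) i) w *\<^sub>R U n i) - (\<Sum>i\<in>UNIV. b (U n i) w *\<^sub>R sol (U n) i)) x" for x
        by (simp add: L_op_def tuple_mult_def gram_def w_eq sum_fun_apply scaleR_fun_def
            b_H10[OF sol(1)[OF U] w_H10] b_H10[OF U_H10 w_H10] mult.commute flip: sol_def)
      have "ae_eq \<Omega> (\<lambda>x. (U (Suc n) k x - U n k x) / tau n)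
          (\<lambda>x. - L_op \<Omega> \<V> (U n) (\<lambda>j y. (U (Suc n) j y + U n j y) / 2) k x)"
        using step by (simp add: scheme_step_def)
      \<comment> \<open>Multiplying the scheme by the time step shows that the defect vanishes
        almost everywhere; as an element of \<open>H10 \<Omega>\<close> it then has zero
        energy.\<close>
      then have "AE x in lebesgue_on \<Omega>. d x = 0"
        unfolding ae_eq_def
      proof (rule AE_mp, intro AE_I2 impI)
        fix x assume "(U (Suc n) k x - U n k x) / tau n = - L_op \<Omega> \<V> (U n) (\<lambda>j y. (U (Suc n) j y + U n j y) / 2) k x"
        then have "U (Suc n) k x - U n k x = - (tau n * L_op \<Omega> \<V> (U n) (\<lambda>j y. (U (Suc n) j y + U n j y) / 2) k x)"
          using tau_pos[of n] by (simp add: divide_eq_eq mult.commute)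
        then show "d x = 0" by (simp add: d L_eq scaleR_fun_def)
      qed
      then show ?thesis using form_null[OF d_H10] by (simp add: a_H10 d_H10 flip: d_def)
    qed
    have "GS.exp_convergent U"
      by (rule main[of taumin tau U "\<lambda>n. sol (U n)"])
         (use tm tau_bounds U_0 stiefel(2)[OF U] sol(2)[OF U] null in auto)
    then obtain C c and Q :: "'n \<Rightarrow> 'n \<Rightarrow> real" where C: "0 < C" and c: "0 < c"
      and Q: "\<And>i j. (\<Sum>k\<in>UNIV. Q k i * Q k j) = (if i = j then 1 else 0)"
      and energy_le: "\<And>n. (\<Sum>k\<in>UNIV. a (U n k) (U n k)) - S \<le> C * exp (- 2 * c * real n)"
      and dist_le: "\<And>n. sqrt (\<Sum>k\<in>UNIV. a (U n k - (\<Sum>i\<in>UNIV. Q i k *\<^sub>R Ustar i)) (U n k - (\<Sum>i\<in>UNIV. Q i k *\<^sub>R Ustar i))) \<le> C * exp (- c * real n)"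
      unfolding GS.exp_convergent_def S_def[symmetric] by blast
    define Qm :: "real^'n^'n" where "Qm = (\<chi> i j. Q i j)"
    have "orthogonal_matrix Qm"
      using Q by (simp add: orthogonal_matrix Qm_def matrix_matrix_mult_def transpose_def mat_def vec_eq_iff)
    moreover have "energy \<Omega> \<V> (U n) - energy \<Omega> \<V> Ustar \<le> C * exp (- 2 * c * real n)" for n
    proof -
      have "energy \<Omega> \<V> (U n) - energy \<Omega> \<V> Ustar = 1 / 2 * ((\<Sum>k\<in>UNIV. a (U n k) (U n k)) - S)"
        by (simp only: energy_eq[OF U_H10] E_star right_diff_distrib)
      also have "\<dots> \<le> 1 / 2 * (C * exp (- 2 * c * real n))" using energy_le by (intro mult_left_mono) auto
      also have "\<dots> \<le> C * exp (- 2 * c * real n)" using C by simp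
      finally show ?thesis .
    qed
    moreover have "norm_a \<Omega> \<V> (\<lambda>i x. U n i x - tuple_mult Ustar Qm i x) \<le> C * exp (- c * real n)" for n
    proof -
      have eq: "(\<lambda>x. U n k x - tuple_mult Ustar Qm k x) = U n k - (\<Sum>i\<in>UNIV. Q i k *\<^sub>R Ustar i)" for k
        by (simp add: fun_eq_iff tuple_mult_def sum_fun_apply scaleR_fun_def Qm_def mult.commute)
      have "U n k - (\<Sum>i\<in>UNIV. Q i k *\<^sub>R Ustar i) \<in> H10 \<Omega>" for k
        by (intro a0.mem U_H10 stiefel(1)[OF assms(6)])
      then show ?thesis using dist_le[of n] unfolding eq by (subst norm_a_eq)
    qed
    ultimately show "\<exists>C>0. \<exists>c>0. \<exists>Q :: real^'n^'n. orthogonal_matrix Q \<and>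
          (\<forall>n. energy \<Omega> \<V> (U n) - energy \<Omega> \<V> Ustar \<le> C * exp (- 2 * c * real n) \<and>
               norm_a \<Omega> \<V> (\<lambda>i x. U n i x - tuple_mult Ustar Q i x) \<le> C * exp (- c * real n))"
      using C c by blast
  qed
qed

end
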